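(* Let $R$ be a unital commutative ring and let $(\mathcal B,\mathcal L,\theta,\mathcal I)$ be a generalized Boolean dynamical system with inverse semigroup $S=S_{(\mathcal B,\mathcal L,\theta,\mathcal I)}$, graded by $\varphi(\alpha,A,\beta)=\alpha\beta^{-1}\in\mathbb F[\mathcal L]$. Then there is an isomorphism of $R$-algebras $$L_R(\mathcal B,\mathcal L,\theta,\mathcal I)\;\cong\; L_R(S_{(\mathcal B,\mathcal L,\theta,\mathcal I)})$$ from the generalized Boolean dynamical system algebra onto the partial skew group ring of $S$, given on generators by $$p_B\mapsto(\omega,B,\omega)\delta_e,\qquad s_{a,A}\mapsto(a,A,a)\delta_a,\qquad s_{a,A}^{*}\mapsto(\omega,A,\omega)\delta_{a^{-1}}$$ for $B\in\mathcal B$, $a\in\mathcal L$, $A\in\mathcal I_a$ (a triple with middle entry $\emptyset$ is read as $0$).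
   Context: A generalized Boolean algebra $\mathcal B$ is a distributive lattice with relative complements and a least element $\emptyset$; write $\cup,\cap,\setminus,\subseteq$ for join, meet, relative complement and order. Morphisms preserve $\emptyset$ and all operations. An ideal is a nonempty subset closed under $\cup$ and under $\cap$ with arbitrary elements of $\mathcal B$. A generalized Boolean dynamical system $(\mathcal B,\mathcal L,\theta,\mathcal I)$ consists of a generalized Boolean algebra $\mathcal B$, a set $\mathcal L$, morphisms $\theta_\alpha:\mathcal B\to\mathcal B$ ($\alpha\in\mathcal L$), and ideals $\mathcal I_\alpha$ of $\mathcal B$ ($\alpha\in\mathcal L$) with $\mathcal F_\alpha:=\{A\in\mathcal B: A\subseteq\theta_\alpha(B)\text{ for some }B\in\mathcal B\}\subseteq\mathcal I_\alpha$. Put $\Delta_A=\{\alpha\in\mathcal L:\theta_\alpha(A)\ne\emptyset\}$ and $\mathcal B_{\mathrm{reg}}=\{A\in\mathcal B: 0<|\Delta_B|<\infty\text{ for all }\emptyset\neq B\subseteq A\}$. $L_R(\mathcal B,\mathcal L,\theta,\mathcal I)$ is the universal associative (not necessarily unital) $R$-algebra generated by $\{p_A\}_{A\in\mathcal B}\cup\{s_{\alpha,B},s_{\alpha,B}^*\}_{\alpha\in\mathcal L,B\in\mathcal I_\alpha}$ subject to: (1) $p_\emptyset=0$, $p_{A\cap A'}=p_Ap_{A'}$, $p_{A\cup A'}=p_A+p_{A'}-p_{A\cap A'}$; (2) $p_As_{\alpha,B}=s_{\alpha,B}p_{\theta_\alpha(A)}$ and $s_{\alpha,B}^*p_A=p_{\theta_\alpha(A)}s_{\alpha,B}^*$;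 (3) $s_{\alpha,B}^*s_{\alpha',B'}=\delta_{\alpha,\alpha'}p_{B\cap B'}$; (4) $s_{\alpha,B}p_{B'}=s_{\alpha,B\cap B'}$ and $p_{B'}s_{\alpha,B}^*=s_{\alpha,B\cap B'}^*$; (5) $p_A=\sum_{\alpha\in\Delta_A}s_{\alpha,\theta_\alpha(A)}s_{\alpha,\theta_\alpha(A)}^*$ for all $A\in\mathcal B_{\mathrm{reg}}$. Words: $\mathcal L^*$ is the set of finite words over $\mathcal L$, including the empty word $\omega$. $\theta_\omega=\mathrm{id}$, $\mathcal I_\omega=\mathcal B$; for $\alpha=\alpha_1\cdots\alpha_n$, $n\ge1$, $\theta_\alpha=\theta_{\alpha_n}\circ\cdots\circ\theta_{\alpha_1}$ and $\mathcal I_\alpha=\{A\in\mathcal B:A\subseteq\theta_{\alpha_2\cdots\alpha_n}(B)\text{ for some }B\in\mathcal I_{\alpha_1}\}$. Inverse semigroup: $S_{(\mathcal B,\mathcal L,\theta,\mathcal I)}=\{(\alpha,A,\beta):\alpha,\beta\in\mathcal L^*,\ \emptyset\ne A\in\mathcal I_\alpha\cap\mathcal I_\beta\}\cup\{0\}$, with $(\alpha,A,\beta)^*=(\beta,A,\alpha)$ and product $(\alpha,A,\beta)(\gamma,B,\delta)$ equal to $(\alpha,A\cap B,\delta)$ if $\beta=\gamma$ and $A\cap B\neq\emptyset$; $(\alpha\gamma',\theta_{\gamma'}(A)\cap B,\delta)$ if $\gamma=\beta\gamma'$ and $\theta_{\gamma'}(A)\cap B\ne\emptyset$; $(\alpha,A\cap\theta_{\beta'}(B),\delta\beta')$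 if $\beta=\gamma\beta'$ and $A\cap\theta_{\beta'}(B)\neq\emptyset$; and $0$ otherwise. Its semilattice of idempotents is $E=\{(\alpha,A,\alpha):\alpha\in\mathcal L^*,\emptyset\ne A\in\mathcal I_\alpha\}\cup\{0\}$. $\mathbb F[\mathcal L]$ is the free group on $\mathcal L$, with identity $e$. For $g\in\mathbb F[\mathcal L]$ put $E_g=\{ss^*:s\in S\setminus\{0\},\varphi(s)=g\}\cup\{0\}$, an order ideal of $E$. Explicitly, if the reduced form of $g$ is $p_1p_2^{-1}$ with $p_1,p_2\in\mathcal L^*$, then $E_g=\{(p_1p,A,p_1p):p\in\mathcal L^*,\emptyset\neq A\in\mathcal I_{p_1p}\cap\mathcal I_{p_2p}\}\cup\{0\}$, and otherwise $E_g=\{0\}$. The order isomorphism $\phi_g:E_{g^{-1}}\to E_g$ sends $s^*s\mapsto ss^*$ ($\varphi(s)=g$) and $0\mapsto 0$; for $g=p_1p_2^{-1}$ it sends $(p_2p,A,p_2p)\mapsto(p_1p,A,p_1p)$. Partial skew group ring $L_R(S)$: A tight filter is a subset $\xi\subseteq E$ that is nonempty, upward closed, closed under meets, with $0\notin\xi$, and such that for every $x\in\xi$ and every finite cover $Z$ of $x$ (a finite set $Z$ of elements $\le x$ such that every nonzero $y\le x$ satisfies $y\wedge z\ne0$ for some $z\in Z$) one has $Z\cap\xi\neq\emptyset$. Let $X$ be the set of tight filters, $U_x=\{\xi\in X:x\in\xi\}$, and let $D$ be the $R$-algebra (pointwise operations) of functions $X\to R$ spanned by the indicator functions $1_{U_x}$,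 $x\in E$; write $x$ also for $1_{U_x}$. For $g\in\mathbb F[\mathcal L]$ let $D_g\subseteq D$ be the ideal spanned by $\{1_{U_x}:x\in E_g\}$ and let $\phi_g:D_{g^{-1}}\to D_g$ be the $R$-algebra isomorphism with $1_{U_x}\mapsto1_{U_{\phi_g(x)}}$. Then $L_R(S)$ is the set of finite formal sums $\sum_g f_g\delta_g$ with $f_g\in D_g$, with multiplication $(f\delta_g)(h\delta_k)=\phi_g(\phi_{g^{-1}}(f)h)\delta_{gk}$. *)

theory Defs
  imports
    "HOL-Algebra.QuotRing"
    "HOL-Algebra.Module"
    "HOL-Library.Sublist"
    "HOL-Library.Function_Algebras"
    "HOL-Library.Poly_Mapping"
begin

section \<open>Algebras without unit\<close>

text \<open>
  The coefficient ring is a type of sort \<open>{comm_ring, comm_monoid_mult}\<close>: a commutative ring with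
  unit. This differs from \<^class>\<open>comm_ring_1\<close> only in that the zero ring is allowed.

  Algebras are carried by the library record \<^type>\<open>module\<close>, whose field \<open>one\<close> has no meaning for a
  nonunital algebra. Nothing below depends on it; the concrete algebras set it to \<^term>\<open>undefined\<close>.
\<close>

locale nonunital_algebra = abelian_group A
  for A :: "('r::{comm_ring, comm_monoid_mult}, 'a, 'm) module_scheme" (structure) +
  assumes m_closed: "\<lbrakk>x \<in> carrier A; y \<in> carrier A\<rbrakk> \<Longrightarrow> x \<otimes> y \<in> carrier A"
    and m_assoc: "\<lbrakk>x \<in> carrier A; y \<in> carrier A; z \<in> carrier A\<rbrakk> \<Longrightarrow> (x \<otimes> y) \<otimes> z = x \<otimes> (y \<otimes> z)"
    and l_distr: "\<lbrakk>x \<in> carrier A; y \<in> carrier A; z \<in> carrier A\<rbrakk> \<Longrightarrow> (x \<oplus> y) \<otimes> z = x \<otimes> z \<oplus> y \<otimes> z"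
    and r_distr: "\<lbrakk>x \<in> carrier A; y \<in> carrier A; z \<in> carrier A\<rbrakk> \<Longrightarrow> z \<otimes> (x \<oplus> y) = z \<otimes> x \<oplus> z \<otimes> y"
    and smult_closed: "x \<in> carrier A \<Longrightarrow> r \<odot> x \<in> carrier A"
    and smult_add: "\<lbrakk>x \<in> carrier A; y \<in> carrier A\<rbrakk> \<Longrightarrow> r \<odot> (x \<oplus> y) = r \<odot> x \<oplus> r \<odot> y"
    and add_smult: "x \<in> carrier A \<Longrightarrow> (r + s) \<odot> x = r \<odot> x \<oplus> s \<odot> x"
    and mult_smult: "x \<in> carrier A \<Longrightarrow> (r * s) \<odot> x = r \<odot> (s \<odot> x)"
    and one_smult: "x \<in> carrier A \<Longrightarrow> 1 \<odot> x = x"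
    and smult_l_assoc: "\<lbrakk>x \<in> carrier A; y \<in> carrier A\<rbrakk> \<Longrightarrow> (r \<odot> x) \<otimes> y = r \<odot> (x \<otimes> y)"
    and smult_r_assoc: "\<lbrakk>x \<in> carrier A; y \<in> carrier A\<rbrakk> \<Longrightarrow> x \<otimes> (r \<odot> y) = r \<odot> (x \<otimes> y)"

definition algebra_iso ::
    "('r, 'a, 'm) module_scheme \<Rightarrow> ('r, 'b, 'n) module_scheme \<Rightarrow> ('a \<Rightarrow> 'b) set" where
  "algebra_iso A B = {h. bij_betw h (carrier A) (carrier B) \<and>
     (\<forall>x\<in>carrier A. \<forall>y\<in>carrier A. h (x \<oplus>\<^bsub>A\<^esub> y) = h x \<oplus>\<^bsub>B\<^esub> h y) \<and>
     (\<forall>x\<in>carrier A. \<forall>y\<in>carrier A. h (x \<otimes>\<^bsub>A\<^esub> y) = h x \<otimes>\<^bsub>B\<^esub> h y) \<and>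
     (\<forall>r. \<forall>x\<in>carrier A. h (r \<odot>\<^bsub>A\<^esub> x) = r \<odot>\<^bsub>B\<^esub> h x)}"

inductive_set generated_ideal :: "('r, 'a, 'm) module_scheme \<Rightarrow> 'a set \<Rightarrow> 'a set"
  for A :: "('r, 'a, 'm) module_scheme" (structure) and X :: "'a set" where
  zero: "\<zero> \<in> generated_ideal A X"
| base: "x \<in> X \<Longrightarrow> x \<in> generated_ideal A X"
| add: "\<lbrakk>x \<in> generated_ideal A X; y \<in> generated_ideal A X\<rbrakk> \<Longrightarrow> x \<oplus> y \<in> generated_ideal A X"
| smult: "x \<in> generated_ideal A X \<Longrightarrow> r \<odot> x \<in> generated_ideal A X"
| l_mult: "\<lbrakk>a \<in> carrier A; x \<in> generated_ideal A X\<rbrakk> \<Longrightarrow> a \<otimes> x \<in> generated_ideal A X"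
| r_mult: "\<lbrakk>x \<in> generated_ideal A X; a \<in> carrier A\<rbrakk> \<Longrightarrow> x \<otimes> a \<in> generated_ideal A X"

definition quotient_algebra ::
    "('r, 'a, 'm) module_scheme \<Rightarrow> 'a set \<Rightarrow> ('r, 'a set) module" where
  "quotient_algebra A J =
     \<lparr>carrier = a_rcosets\<^bsub>A\<^esub> J, mult = rcoset_mult A J, one = undefined,
      zero = J, add = set_add A, smult = (\<lambda>r X. \<Union>x\<in>X. J +>\<^bsub>A\<^esub> (r \<odot>\<^bsub>A\<^esub> x))\<rparr>"

text \<open>
  The free nonunital algebra on a set \<open>G\<close> has the nonempty words over \<open>G\<close> as a basis;
  \<open>Poly_Mapping.single w r\<close> is \<open>r\<close> times the word \<open>w\<close>.
\<close>

definition free_mult ::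
    "('g list \<Rightarrow>\<^sub>0 'r::comm_ring) \<Rightarrow> ('g list \<Rightarrow>\<^sub>0 'r) \<Rightarrow> ('g list \<Rightarrow>\<^sub>0 'r)"  (infixl "\<star>" 70) where
  "x \<star> y = (\<Sum>u\<in>Poly_Mapping.keys x. \<Sum>v\<in>Poly_Mapping.keys y.
     Poly_Mapping.single (u @ v) (Poly_Mapping.lookup x u * Poly_Mapping.lookup y v))"

definition free_algebra :: "'g set \<Rightarrow> ('r::comm_ring, 'g list \<Rightarrow>\<^sub>0 'r) module" where
  "free_algebra G =
     \<lparr>carrier = {x. \<forall>w\<in>Poly_Mapping.keys x. w \<noteq> [] \<and> set w \<subseteq> G}, mult = (\<star>), one = undefined,
      zero = 0, add = (+), smult = (\<lambda>r. Poly_Mapping.map ((*) r))\<rparr>"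

definition relation_ideal ::
    "'g set \<Rightarrow> (('g list \<Rightarrow>\<^sub>0 'r::comm_ring) \<times> ('g list \<Rightarrow>\<^sub>0 'r)) set \<Rightarrow> ('g list \<Rightarrow>\<^sub>0 'r) set" where
  "relation_ideal G Rel = generated_ideal (free_algebra G) {x - y | x y. (x, y) \<in> Rel}"

definition presented_algebra ::
    "'g set \<Rightarrow> (('g list \<Rightarrow>\<^sub>0 'r::comm_ring) \<times> ('g list \<Rightarrow>\<^sub>0 'r)) set
      \<Rightarrow> ('r, ('g list \<Rightarrow>\<^sub>0 'r) set) module" where
  "presented_algebra G Rel = quotient_algebra (free_algebra G) (relation_ideal G Rel)"

section \<open>Free groups\<close>

text \<open>
  Elements are reduced words; the letter \<open>(a, True)\<close> stands for \<open>a\<close> and \<open>(a, False)\<close> for its inverse.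
\<close>

definition inverse_letter :: "'l \<times> bool \<Rightarrow> 'l \<times> bool" where
  "inverse_letter x = (fst x, \<not> snd x)"

definition reduced :: "('l \<times> bool) list \<Rightarrow> bool" where
  "reduced w \<longleftrightarrow> successively (\<lambda>x y. y \<noteq> inverse_letter x) w"

fun cons_cancel :: "'l \<times> bool \<Rightarrow> ('l \<times> bool) list \<Rightarrow> ('l \<times> bool) list" where
  "cons_cancel x [] = [x]"
| "cons_cancel x (y # w) = (if y = inverse_letter x then w else x # y # w)"

definition free_group :: "'l set \<Rightarrow> ('l \<times> bool) list monoid" where
  "free_group L =
     \<lparr>carrier = {w. reduced w \<and> set w \<subseteq> L \<times> UNIV}, mult = foldr cons_cancel, one = []\<rparr>"

definition positive_word :: "'l list \<Rightarrow> ('l \<times> bool) list" where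
  "positive_word = map (\<lambda>a. (a, True))"

section \<open>Generalized Boolean dynamical systems\<close>

class generalized_boolean_algebra = distrib_lattice + order_bot + minus +
  assumes inf_minus: "inf (x - y) y = bot"
    and sup_minus: "sup (x - y) (inf x y) = x"

definition gba_morphism ::
    "('b::generalized_boolean_algebra \<Rightarrow> 'c::generalized_boolean_algebra) \<Rightarrow> bool" where
  "gba_morphism h \<longleftrightarrow> h bot = bot \<and>
     (\<forall>A B. h (sup A B) = sup (h A) (h B)) \<and>
     (\<forall>A B. h (inf A B) = inf (h A) (h B)) \<and>
     (\<forall>A B. h (A - B) = h A - h B)"

definition gba_ideal :: "'b::generalized_boolean_algebra set \<Rightarrow> bool" where
  "gba_ideal J \<longleftrightarrow> J \<noteq> {} \<and> (\<forall>A\<in>J. \<forall>B\<in>J. sup A B \<in> J) \<and> (\<forall>A\<in>J. \<forall>B. inf A B \<in> J)"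

datatype ('l, 'b) generator = Gen_p 'b | Gen_s 'l 'b | Gen_s_star 'l 'b

text \<open>Elements of the inverse semigroup; \<open>Triple \<alpha> A \<beta>\<close> is a member only if \<open>A \<noteq> bot\<close>.\<close>

datatype ('l, 'b) triple = Zero | Triple "'l list" 'b "'l list"

definition triple :: "'l list \<Rightarrow> 'b::order_bot \<Rightarrow> 'l list \<Rightarrow> ('l, 'b) triple" where
  "triple \<alpha> A \<beta> = (if A = bot then Zero else Triple \<alpha> A \<beta>)"

locale gbds =
  fixes \<L> :: "'l set"
    and \<theta> :: "'l \<Rightarrow> 'b::generalized_boolean_algebra \<Rightarrow> 'b"
    and \<I> :: "'l \<Rightarrow> 'b set"
  assumes action_morphism: "\<alpha> \<in> \<L> \<Longrightarrow> gba_morphism (\<theta> \<alpha>)"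
    and ideal: "\<alpha> \<in> \<L> \<Longrightarrow> gba_ideal (\<I> \<alpha>)"
    and range_subset: "\<alpha> \<in> \<L> \<Longrightarrow> {A. \<exists>B. A \<le> \<theta> \<alpha> B} \<subseteq> \<I> \<alpha>"
begin

definition \<Delta> :: "'b \<Rightarrow> 'l set" where
  "\<Delta> A = {\<alpha> \<in> \<L>. \<theta> \<alpha> A \<noteq> bot}"

definition regular :: "'b set" where
  "regular = {A. \<forall>B. B \<noteq> bot \<and> B \<le> A \<longrightarrow> \<Delta> B \<noteq> {} \<and> finite (\<Delta> B)}"

subsection \<open>The algebra given by generators and relations\<close>

definition generators :: "('l, 'b) generator set" where
  "generators = {Gen_p A | A. True} \<union> {Gen_s \<alpha> B | \<alpha> B. \<alpha> \<in> \<L> \<and> B \<in> \<I> \<alpha>}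
     \<union> {Gen_s_star \<alpha> B | \<alpha> B. \<alpha> \<in> \<L> \<and> B \<in> \<I> \<alpha>}"

abbreviation p :: "'b \<Rightarrow> ('l, 'b) generator list \<Rightarrow>\<^sub>0 'r::{comm_ring, comm_monoid_mult}" where
  "p A \<equiv> Poly_Mapping.single [Gen_p A] 1"

abbreviation s :: "'l \<Rightarrow> 'b \<Rightarrow> ('l, 'b) generator list \<Rightarrow>\<^sub>0 'r::{comm_ring, comm_monoid_mult}" where
  "s \<alpha> B \<equiv> Poly_Mapping.single [Gen_s \<alpha> B] 1"

abbreviation s_star :: "'l \<Rightarrow> 'b \<Rightarrow> ('l, 'b) generator list \<Rightarrow>\<^sub>0 'r::{comm_ring, comm_monoid_mult}" where
  "s_star \<alpha> B \<equiv> Poly_Mapping.single [Gen_s_star \<alpha> B] 1"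

inductive_set relations ::
    "((('l, 'b) generator list \<Rightarrow>\<^sub>0 'r::{comm_ring, comm_monoid_mult}) \<times> (('l, 'b) generator list \<Rightarrow>\<^sub>0 'r)) set"
  where
  p_bot: "(p bot, 0) \<in> relations"
| p_inf: "(p (inf A A'), p A \<star> p A') \<in> relations"
| p_sup: "(p (sup A A'), p A + p A' - p (inf A A')) \<in> relations"
| p_s: "\<lbrakk>\<alpha> \<in> \<L>; B \<in> \<I> \<alpha>\<rbrakk> \<Longrightarrow> (p A \<star> s \<alpha> B, s \<alpha> B \<star> p (\<theta> \<alpha> A)) \<in> relations"
| s_star_p: "\<lbrakk>\<alpha> \<in> \<L>; B \<in> \<I> \<alpha>\<rbrakk> \<Longrightarrow> (s_star \<alpha> B \<star> p A, p (\<theta> \<alpha> A) \<star> s_star \<alpha> B) \<in> relations"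
| s_star_s: "\<lbrakk>\<alpha> \<in> \<L>; B \<in> \<I> \<alpha>; \<alpha>' \<in> \<L>; B' \<in> \<I> \<alpha>'\<rbrakk> \<Longrightarrow>
    (s_star \<alpha> B \<star> s \<alpha>' B', if \<alpha> = \<alpha>' then p (inf B B') else 0) \<in> relations"
| s_p: "\<lbrakk>\<alpha> \<in> \<L>; B \<in> \<I> \<alpha>\<rbrakk> \<Longrightarrow> (s \<alpha> B \<star> p B', s \<alpha> (inf B B')) \<in> relations"
| p_s_star: "\<lbrakk>\<alpha> \<in> \<L>; B \<in> \<I> \<alpha>\<rbrakk> \<Longrightarrow> (p B' \<star> s_star \<alpha> B, s_star \<alpha> (inf B B')) \<in> relations"
| p_regular: "A \<in> regular \<Longrightarrow>
    (p A, \<Sum>\<alpha>\<in>\<Delta> A. s \<alpha> (\<theta> \<alpha> A) \<star> s_star \<alpha> (\<theta> \<alpha> A)) \<in> relations"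

definition bds_algebra ::
    "('r::{comm_ring, comm_monoid_mult}, (('l, 'b) generator list \<Rightarrow>\<^sub>0 'r) set) module" where
  "bds_algebra = presented_algebra generators relations"

definition generator_class ::
    "('l, 'b) generator \<Rightarrow> (('l, 'b) generator list \<Rightarrow>\<^sub>0 'r::{comm_ring, comm_monoid_mult}) set" where
  "generator_class x =
     relation_ideal generators relations +>\<^bsub>free_algebra generators\<^esub> Poly_Mapping.single [x] 1"

subsection \<open>The inverse semigroup and its grading\<close>

primrec \<theta>_word :: "'l list \<Rightarrow> 'b \<Rightarrow> 'b" where
  "\<theta>_word [] = id"
| "\<theta>_word (a # \<alpha>) = \<theta>_word \<alpha> \<circ> \<theta> a"

fun \<I>_word :: "'l list \<Rightarrow> 'b set" where
  "\<I>_word [] = UNIV"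
| "\<I>_word (a # \<alpha>) = {A. \<exists>B\<in>\<I> a. A \<le> \<theta>_word \<alpha> B}"

definition \<S> :: "('l, 'b) triple set" where
  "\<S> = {Triple \<alpha> A \<beta> | \<alpha> A \<beta>.
     \<alpha> \<in> lists \<L> \<and> \<beta> \<in> lists \<L> \<and> A \<noteq> bot \<and> A \<in> \<I>_word \<alpha> \<inter> \<I>_word \<beta>} \<union> {Zero}"

fun star :: "('l, 'b) triple \<Rightarrow> ('l, 'b) triple" where
  "star Zero = Zero"
| "star (Triple \<alpha> A \<beta>) = Triple \<beta> A \<alpha>"

fun triple_prod :: "('l, 'b) triple \<Rightarrow> ('l, 'b) triple \<Rightarrow> ('l, 'b) triple"  (infixl "\<bullet>" 70) where
  "Zero \<bullet> t = Zero"
| "t \<bullet> Zero = Zero"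
| "Triple \<alpha> A \<beta> \<bullet> Triple \<gamma> B \<delta> =
     (if \<beta> = \<gamma> then triple \<alpha> (inf A B) \<delta>
      else if prefix \<beta> \<gamma> then
        let \<gamma>' = drop (length \<beta>) \<gamma> in triple (\<alpha> @ \<gamma>') (inf (\<theta>_word \<gamma>' A) B) \<delta>
      else if prefix \<gamma> \<beta> then
        let \<beta>' = drop (length \<gamma>) \<beta> in triple \<alpha> (inf A (\<theta>_word \<beta>' B)) (\<delta> @ \<beta>')
      else Zero)"

text \<open>The value at \<open>Zero\<close> plays no role.\<close>

fun grade :: "('l, 'b) triple \<Rightarrow> ('l \<times> bool) list" where
  "grade Zero = undefined"
| "grade (Triple \<alpha> A \<beta>) =
     positive_word \<alpha> \<otimes>\<^bsub>free_group \<L>\<^esub> inv\<^bsub>free_group \<L>\<^esub> positive_word \<beta>"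

definition E :: "('l, 'b) triple set" where
  "E = {Triple \<alpha> A \<alpha> | \<alpha> A. \<alpha> \<in> lists \<L> \<and> A \<noteq> bot \<and> A \<in> \<I>_word \<alpha>} \<union> {Zero}"

text \<open>On idempotents the product is the meet.\<close>

definition E_le :: "('l, 'b) triple \<Rightarrow> ('l, 'b) triple \<Rightarrow> bool"  (infix "\<preceq>" 50) where
  "x \<preceq> y \<longleftrightarrow> x \<bullet> y = x"

definition E_grade :: "('l \<times> bool) list \<Rightarrow> ('l, 'b) triple set" where
  "E_grade g = {t \<bullet> star t | t. t \<in> \<S> - {Zero} \<and> grade t = g} \<union> {Zero}"

definition E_iso :: "('l \<times> bool) list \<Rightarrow> ('l, 'b) triple \<Rightarrow> ('l, 'b) triple" where
  "E_iso g x = (if x = Zero then Zero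
     else THE y. \<exists>t \<in> \<S> - {Zero}. grade t = g \<and> star t \<bullet> t = x \<and> t \<bullet> star t = y)"

subsection \<open>Tight filters and the partial skew group ring\<close>

definition finite_cover :: "('l, 'b) triple \<Rightarrow> ('l, 'b) triple set \<Rightarrow> bool" where
  "finite_cover x Z \<longleftrightarrow> finite Z \<and> Z \<subseteq> E \<and> (\<forall>z\<in>Z. z \<preceq> x) \<and>
     (\<forall>y\<in>E. y \<noteq> Zero \<and> y \<preceq> x \<longrightarrow> (\<exists>z\<in>Z. y \<bullet> z \<noteq> Zero))"

definition tight_filters :: "('l, 'b) triple set set" where
  "tight_filters = {\<xi>. \<xi> \<subseteq> E \<and> \<xi> \<noteq> {} \<and> Zero \<notin> \<xi> \<and>
     (\<forall>x\<in>\<xi>. \<forall>y\<in>E. x \<preceq> y \<longrightarrow> y \<in> \<xi>) \<and>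
     (\<forall>x\<in>\<xi>. \<forall>y\<in>\<xi>. x \<bullet> y \<in> \<xi>) \<and>
     (\<forall>x\<in>\<xi>. \<forall>Z. finite_cover x Z \<longrightarrow> Z \<inter> \<xi> \<noteq> {})}"

text \<open>
  A function on \<^const>\<open>tight_filters\<close> is represented by its extension by zero to the whole type.
  Ring operations on functions are the pointwise ones of \<^theory>\<open>HOL-Library.Function_Algebras\<close>.
\<close>

definition indicator ::
    "('l, 'b) triple \<Rightarrow> ('l, 'b) triple set \<Rightarrow> 'r::{comm_ring, comm_monoid_mult}" where
  "indicator x = (\<lambda>\<xi>. if \<xi> \<in> tight_filters \<and> x \<in> \<xi> then 1 else 0)"

definition indicator_span ::
    "('l, 'b) triple set \<Rightarrow> (('l, 'b) triple set \<Rightarrow> 'r::{comm_ring, comm_monoid_mult}) set" where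
  "indicator_span Y = {\<Sum>x\<in>F. (\<lambda>\<xi>. c x * indicator x \<xi>) | F c. finite F \<and> F \<subseteq> Y}"

text \<open>
  The ideal \<open>D\<^sub>g\<close> of \<open>D = indicator_span E\<close>. The linear span is an ideal because \<^term>\<open>E_grade g\<close> is
  an order ideal of \<^term>\<open>E\<close>.
\<close>

definition D ::
    "('l \<times> bool) list \<Rightarrow> ('r::{comm_ring, comm_monoid_mult}, ('l, 'b) triple set \<Rightarrow> 'r) module" where
  "D g = \<lparr>carrier = indicator_span (E_grade g), mult = (*), one = undefined,
          zero = 0, add = (+), smult = (\<lambda>r f \<xi>. r * f \<xi>)\<rparr>"

definition D_iso ::
    "('l \<times> bool) list \<Rightarrow> (('l, 'b) triple set \<Rightarrow> 'r::{comm_ring, comm_monoid_mult})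
      \<Rightarrow> (('l, 'b) triple set \<Rightarrow> 'r)" where
  "D_iso g = (THE h. h \<in> algebra_iso (D (inv\<^bsub>free_group \<L>\<^esub> g)) (D g) \<and>
     h \<in> extensional (carrier (D (inv\<^bsub>free_group \<L>\<^esub> g))) \<and>
     (\<forall>x \<in> E_grade (inv\<^bsub>free_group \<L>\<^esub> g). h (indicator x) = indicator (E_iso g x)))"

text \<open>\<open>Poly_Mapping.single g f\<close> is the formal term \<open>f \<delta>\<^sub>g\<close>.\<close>

definition skew_mult ::
    "(('l \<times> bool) list \<Rightarrow>\<^sub>0 (('l, 'b) triple set \<Rightarrow> 'r::{comm_ring, comm_monoid_mult}))
      \<Rightarrow> (('l \<times> bool) list \<Rightarrow>\<^sub>0 (('l, 'b) triple set \<Rightarrow> 'r))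
      \<Rightarrow> (('l \<times> bool) list \<Rightarrow>\<^sub>0 (('l, 'b) triple set \<Rightarrow> 'r))" where
  "skew_mult x y = (\<Sum>g\<in>Poly_Mapping.keys x. \<Sum>k\<in>Poly_Mapping.keys y.
     Poly_Mapping.single (g \<otimes>\<^bsub>free_group \<L>\<^esub> k)
       (D_iso g (D_iso (inv\<^bsub>free_group \<L>\<^esub> g) (Poly_Mapping.lookup x g) * Poly_Mapping.lookup y k)))"

definition skew_group_ring ::
    "('r::{comm_ring, comm_monoid_mult},
      ('l \<times> bool) list \<Rightarrow>\<^sub>0 (('l, 'b) triple set \<Rightarrow> 'r)) module" where
  "skew_group_ring =
     \<lparr>carrier = {x. \<forall>g\<in>Poly_Mapping.keys x.
        g \<in> carrier (free_group \<L>) \<and> Poly_Mapping.lookup x g \<in> carrier (D g)},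
      mult = skew_mult, one = undefined, zero = 0, add = (+),
      smult = (\<lambda>r. Poly_Mapping.map (\<lambda>f \<xi>. r * f \<xi>))\<rparr>"

end

end

theory Submission
  imports Defs
begin

text \<open>
  Both algebras are spanned by images of the inverse semigroup \<open>\<S>\<close>, and they satisfy the same linear
  relations between these images.

  In the partial skew group ring an element \<open>t \<noteq> Zero\<close> of \<open>\<S>\<close> has the image \<open>tt\<^sup>* \<delta>\<close>, with \<open>\<delta>\<close> at the
  grade of \<open>t\<close> (\<open>basis\<close>). These images span the ring and multiply like \<open>\<S>\<close> (\<open>basis_mult\<close>), so
  associativity of the ring comes from that of \<open>\<S>\<close>. The isomorphisms of the partial action are
  obtained from an action on tight filters: conjugation by \<open>t\<close> carries covers to covers, so a tight
  filter that contains \<open>tt\<^sup>*\<close> can be pulled back along \<open>t\<close> (\<open>pull_tight\<close>), and the result depends on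
  the grade of \<open>t\<close> only.

  Each generator of the presented algebra has a value in \<open>\<S>\<close>, hence so has each word, and \<open>rep\<close> sends
  a word to the image of its value. Most relations already hold in \<open>\<S>\<close>. The two that are linear,
  \<open>p\<^bsub>A \<union> A'\<^esub> = p\<^bsub>A\<^esub> + p\<^bsub>A'\<^esub> - p\<^bsub>A \<inter> A'\<^esub>\<close> and \<open>p\<^bsub>A\<^esub> = \<Sum>\<^sub>\<alpha> s\<^sub>\<alpha> s\<^sub>\<alpha>\<^sup>*\<close> for regular \<open>A\<close>, hold because tight
  filters respect the covers of \<open>A \<union> A'\<close> by \<open>A\<close> and \<open>A'\<close>, and of \<open>A\<close> by the elements
  \<open>(\<alpha>, \<theta>\<^sub>\<alpha>(A), \<alpha>)\<close>. So \<open>rep\<close> induces a surjective homomorphism.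

  It remains to see that it is injective. Modulo the relations a word depends on its value only: it is
  congruent to the normal form of its value (\<open>word_normal_form\<close>), and normal forms multiply like \<open>\<S>\<close>
  (\<open>normal_form_mult\<close>). The decisive fact is that a finite cover \<open>Z\<close> of an idempotent \<open>x = (\<alpha>, A, \<alpha>)\<close> puts the normal
  form of \<open>x\<close> into the left ideal generated by those of \<open>Z\<close> (\<open>cover_left_span\<close>): remove from \<open>A\<close> what
  is covered by members of \<open>Z\<close> whose word is a prefix of \<open>\<alpha>\<close>; each nonempty subset of the rest is met
  by a member with a longer word, which makes the rest regular; expand it by
  the relation for regular sets and apply induction to the summands. If \<open>Z\<close> does not cover \<open>x\<close>, there
  is an ultrafilter that contains \<open>x\<close> and misses \<open>Z\<close>, and ultrafilters are tight (\<open>ex_tight_filter\<close>).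
  Together these show that linear relations between indicators of tight filters hold between normal
  forms of idempotents (\<open>vanishing_left_span\<close>). Elements \<open>t\<close>, \<open>u\<close> of the same grade satisfy
  \<open>tt\<^sup>*u = uu\<^sup>*t\<close>, which reduces linear relations in an arbitrary degree to those between idempotents
  (\<open>graded_relation\<close>).
\<close>

section \<open>Free groups\<close>

lemma inverse_letter_inverse_letter [simp]: "inverse_letter (inverse_letter x) = x"
  by (simp add: inverse_letter_def)

lemma reduced_Nil [simp]: "reduced []"
  by (simp add: reduced_def)

lemma reduced_Cons: "reduced (x # w) \<longleftrightarrow> reduced w \<and> (w = [] \<or> hd w \<noteq> inverse_letter x)"
  by (auto simp: reduced_def successively_Cons)

lemma reduced_cons_cancel: "reduced w \<Longrightarrow> reduced (cons_cancel x w)"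
  by (cases w) (auto simp: reduced_Cons)

lemma cons_cancel_inverse_letter:
  "reduced w \<Longrightarrow> cons_cancel x (cons_cancel (inverse_letter x) w) = w"
proof (cases w)
  case (Cons y w')
  assume "reduced w"
  then show ?thesis
    by (cases w') (auto simp: Cons reduced_Cons)
qed simp

lemma cons_cancel_inverse_letter':
  "reduced w \<Longrightarrow> cons_cancel (inverse_letter x) (cons_cancel x w) = w"
  using cons_cancel_inverse_letter[of w "inverse_letter x"] by simp

lemma reduced_foldr_cons_cancel: "reduced w \<Longrightarrow> reduced (foldr cons_cancel u w)"
  by (induction u) (auto simp: reduced_cons_cancel)

lemma foldr_cons_cancel_cons_cancel:
  assumes "reduced w"
  shows "foldr cons_cancel (cons_cancel x u) w = cons_cancel x (foldr cons_cancel u w)"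
proof (cases u)
  case (Cons y u')
  then show ?thesis
    using cons_cancel_inverse_letter[OF reduced_foldr_cons_cancel[OF assms, of u'], of x] by auto
qed simp

lemma foldr_cons_cancel_assoc:
  "reduced w \<Longrightarrow>
     foldr cons_cancel (foldr cons_cancel u v) w = foldr cons_cancel u (foldr cons_cancel v w)"
  by (induction u) (auto simp: foldr_cons_cancel_cons_cancel)

lemma foldr_cons_cancel_Nil: "reduced w \<Longrightarrow> foldr cons_cancel w [] = w"
proof (induction w)
  case (Cons x w)
  then show ?case by (cases w) (auto simp: reduced_Cons)
qed simp

lemma set_cons_cancel: "set (cons_cancel x w) \<subseteq> insert x (set w)"
  by (cases w) auto

lemma set_foldr_cons_cancel: "set (foldr cons_cancel u w) \<subseteq> set u \<union> set w"
proof (induction u)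
  case (Cons x u)
  then show ?case using set_cons_cancel[of x "foldr cons_cancel u w"] by auto
qed simp

lemma foldr_cons_cancel_inverse:
  "reduced w \<Longrightarrow> foldr cons_cancel (rev (map inverse_letter u)) (foldr cons_cancel u w) = w"
proof (induction u)
  case (Cons x u)
  then show ?case by (simp add: cons_cancel_inverse_letter' reduced_foldr_cons_cancel)
qed simp

lemma reduced_rev_map_inverse_letter: "reduced w \<Longrightarrow> reduced (rev (map inverse_letter w))"
proof -
  have "successively (\<lambda>x y. x \<noteq> inverse_letter y) (map inverse_letter w) \<longleftrightarrow>
      successively (\<lambda>x y. y \<noteq> inverse_letter x) w"
    unfolding successively_map
    by (intro successively_cong refl) (auto simp: inverse_letter_def prod_eq_iff)
  then show "reduced w \<Longrightarrow> ?thesis" by (simp add: reduced_def)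
qed

lemma group_free_group: "group (free_group L)"
proof (rule groupI)
  fix x y z
  assume *: "x \<in> carrier (free_group L)" "y \<in> carrier (free_group L)" "z \<in> carrier (free_group L)"
  show "x \<otimes>\<^bsub>free_group L\<^esub> y \<in> carrier (free_group L)"
    using * set_foldr_cons_cancel[of x y] by (auto simp: free_group_def reduced_foldr_cons_cancel)
  show "x \<otimes>\<^bsub>free_group L\<^esub> y \<otimes>\<^bsub>free_group L\<^esub> z = x \<otimes>\<^bsub>free_group L\<^esub> (y \<otimes>\<^bsub>free_group L\<^esub> z)"
    using * by (simp add: free_group_def foldr_cons_cancel_assoc)
next
  fix x assume *: "x \<in> carrier (free_group L)"
  have "rev (map inverse_letter x) \<in> carrier (free_group L)"
    using * by (auto simp: free_group_def reduced_rev_map_inverse_letter inverse_letter_def)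
  moreover have "rev (map inverse_letter x) \<otimes>\<^bsub>free_group L\<^esub> x = \<one>\<^bsub>free_group L\<^esub>"
    using * foldr_cons_cancel_inverse[of "[]" x] by (simp add: free_group_def foldr_cons_cancel_Nil)
  ultimately show "\<exists>y\<in>carrier (free_group L). y \<otimes>\<^bsub>free_group L\<^esub> x = \<one>\<^bsub>free_group L\<^esub>"
    by blast
qed (auto simp: free_group_def)

lemma reduced_positive_word: "reduced (positive_word \<alpha>)"
  by (induction \<alpha>) (auto simp: positive_word_def reduced_Cons inverse_letter_def hd_map)

lemma positive_word_closed: "\<alpha> \<in> lists L \<Longrightarrow> positive_word \<alpha> \<in> carrier (free_group L)"
  using reduced_positive_word[of \<alpha>] by (auto simp: free_group_def positive_word_def)

lemma positive_word_append:
  "positive_word (\<alpha> @ \<beta>) = positive_word \<alpha> \<otimes>\<^bsub>free_group L\<^esub> positive_word \<beta>"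
proof (induction \<alpha>)
  case (Cons a \<alpha>)
  have 1: "cons_cancel (a, True) (positive_word w) = (a, True) # positive_word w" for w :: "'a list"
    by (cases w) (auto simp: positive_word_def inverse_letter_def)
  have 2: "positive_word (a # w) = (a, True) # positive_word w" for w :: "'a list"
    by (simp add: positive_word_def)
  have "positive_word ((a # \<alpha>) @ \<beta>) = cons_cancel (a, True) (positive_word (\<alpha> @ \<beta>))"
    by (simp add: 1 2)
  also have "\<dots> = positive_word (a # \<alpha>) \<otimes>\<^bsub>free_group L\<^esub> positive_word \<beta>"
    unfolding Cons 2 by (simp add: free_group_def)
  finally show ?case .
qed (simp add: free_group_def positive_word_def)

lemma positive_word_inject [simp]: "positive_word \<alpha> = positive_word \<beta> \<longleftrightarrow> \<alpha> = \<beta>"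
  unfolding positive_word_def by (subst inj_map_eq_map) (auto simp: inj_def)

lemma positive_word_Nil: "positive_word [] = \<one>\<^bsub>free_group L\<^esub>"
  by (simp add: free_group_def positive_word_def)

section \<open>Nonunital algebras and their quotients\<close>

context nonunital_algebra
begin

lemma zero_smult: "x \<in> carrier A \<Longrightarrow> 0 \<odot> x = \<zero>"
  using add_smult[of x 0 0] smult_closed[of x 0] by (metis add.r_cancel_one add_0)

lemma uminus_smult: "x \<in> carrier A \<Longrightarrow> (- 1) \<odot> x = \<ominus> x"
  using add_smult[of x "- 1" 1] by (simp add: one_smult smult_closed zero_smult minus_equality)

lemma minus_eq_zero_iff:
  assumes "x \<in> carrier A" "y \<in> carrier A"
  shows "x \<ominus> y = \<zero> \<longleftrightarrow> x = y"
proof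
  assume "x \<ominus> y = \<zero>"
  then have "\<ominus> (\<ominus> y) = x" using assms by (intro minus_equality) (simp_all add: minus_eq)
  then show "x = y" using assms by simp
qed (simp add: minus_eq r_neg assms)

lemma generated_ideal_subset: "X \<subseteq> carrier A \<Longrightarrow> generated_ideal A X \<subseteq> carrier A"
proof
  fix x assume "X \<subseteq> carrier A" "x \<in> generated_ideal A X"
  from this(2,1) show "x \<in> carrier A"
    by induction (auto simp: smult_closed m_closed)
qed

end

text \<open>A two-sided ideal that is also closed under scalars.\<close>

locale algebra_ideal = nonunital_algebra A
  for A :: "('r::{comm_ring, comm_monoid_mult}, 'a, 'm) module_scheme" (structure) +
  fixes J :: "'a set"
  assumes subset: "J \<subseteq> carrier A"
    and zero_mem: "\<zero> \<in> J"
    and add_mem: "\<lbrakk>x \<in> J; y \<in> J\<rbrakk> \<Longrightarrow> x \<oplus> y \<in> J"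
    and smult_mem: "x \<in> J \<Longrightarrow> r \<odot> x \<in> J"
    and l_mult_mem: "\<lbrakk>a \<in> carrier A; x \<in> J\<rbrakk> \<Longrightarrow> a \<otimes> x \<in> J"
    and r_mult_mem: "\<lbrakk>x \<in> J; a \<in> carrier A\<rbrakk> \<Longrightarrow> x \<otimes> a \<in> J"

sublocale algebra_ideal \<subseteq> abelian_subgroup J A
proof (rule abelian_subgroupI3[OF _ abelian_group_axioms])
  have "\<ominus> x \<in> J" if "x \<in> J" for x
    using that smult_mem[of x "- 1"] subset by (auto simp: uminus_smult subset_iff)
  then show "additive_subgroup J A"
    by (intro additive_subgroup.intro subgroup.intro) (use subset zero_mem add_mem in \<open>auto simp: a_inv_def[symmetric]\<close>)
qed

lemma (in nonunital_algebra) algebra_ideal_generated_ideal: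
  "X \<subseteq> carrier A \<Longrightarrow> algebra_ideal A (generated_ideal A X)"
  by unfold_locales (auto intro: generated_ideal.intros dest: generated_ideal_subset)

context algebra_ideal
begin

abbreviation coset :: "'a \<Rightarrow> 'a set" where
  "coset x \<equiv> J +> x"

lemma coset_eq_iff:
  assumes "x \<in> carrier A" "y \<in> carrier A"
  shows "coset x = coset y \<longleftrightarrow> x \<ominus> y \<in> J"
proof
  assume "coset x = coset y"
  then show "x \<ominus> y \<in> J" using a_repr_independenceD[OF assms(1)] a_rcos_module_imp[OF assms(2)] assms
    by (metis a_rcos_self minus_eq)
next
  assume "x \<ominus> y \<in> J"
  then have "x \<in> coset y" using a_rcos_module_rev[OF assms(2,1)] by (simp add: minus_eq)
  then show "coset x = coset y" using a_repr_independence[OF _ assms(2)] a_subgroup by metis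
qed

lemma coset_eqI:
  assumes "x \<in> carrier A" "y \<in> carrier A" "j \<in> J" "x = j \<oplus> y"
  shows "coset x = coset y"
  using assms subset by (auto simp: coset_eq_iff minus_eq a_assoc r_neg subset_iff)

lemma mem_coset_iff: "x \<in> carrier A \<Longrightarrow> y \<in> coset x \<longleftrightarrow> (\<exists>j\<in>J. y = j \<oplus> x)"
  by (auto simp: a_r_coset_def r_coset_def)

lemma carrier_quotient: "carrier (quotient_algebra A J) = coset ` carrier A"
  by (auto simp: quotient_algebra_def A_RCOSETS_def RCOSETS_def a_r_coset_def)

lemma zero_quotient: "\<zero>\<^bsub>quotient_algebra A J\<^esub> = coset \<zero>"
  using a_coset_add_zero[OF subset] by (simp add: quotient_algebra_def)

lemma add_quotient:
  "\<lbrakk>x \<in> carrier A; y \<in> carrier A\<rbrakk> \<Longrightarrow> coset x \<oplus>\<^bsub>quotient_algebra A J\<^esub> coset y = coset (x \<oplus> y)"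
  by (simp add: quotient_algebra_def a_rcos_sum)

lemma mult_quotient:
  assumes "x \<in> carrier A" "y \<in> carrier A"
  shows "coset x \<otimes>\<^bsub>quotient_algebra A J\<^esub> coset y = coset (x \<otimes> y)"
proof -
  have "coset (x' \<otimes> y') = coset (x \<otimes> y)" if x': "x' \<in> coset x" and y': "y' \<in> coset y" for x' y'
  proof -
    obtain i where i: "i \<in> J" "x' = i \<oplus> x"
      using x' mem_coset_iff[OF assms(1)] by blast
    obtain j where j: "j \<in> J" "y' = j \<oplus> y"
      using y' mem_coset_iff[OF assms(2)] by blast
    have c: "i \<in> carrier A" "j \<in> carrier A" using i j subset by auto
    have "x' \<otimes> y' = (i \<otimes> j \<oplus> x \<otimes> j \<oplus> i \<otimes> y) \<oplus> x \<otimes> y"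
      unfolding i(2) j(2) using c assms by (simp add: l_distr r_distr m_closed a_assoc)
    moreover have "i \<otimes> j \<oplus> x \<otimes> j \<oplus> i \<otimes> y \<in> J"
      using i(1) j(1) c assms by (simp add: add_mem l_mult_mem r_mult_mem)
    moreover have "x' \<in> carrier A" "y' \<in> carrier A"
      using i j c assms by auto
    ultimately show ?thesis using assms by (intro coset_eqI) (simp_all add: m_closed)
  qed
  then have "(\<Union>a\<in>coset x. \<Union>b\<in>coset y. coset (a \<otimes> b)) = (\<Union>a\<in>coset x. \<Union>b\<in>coset y. coset (x \<otimes> y))"
    by (intro SUP_cong refl)
  moreover have "coset x \<noteq> {}" "coset y \<noteq> {}"
    using assms a_rcos_self by blast+
  ultimately show ?thesis by (simp add: quotient_algebra_def rcoset_mult_def)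
qed

lemma smult_quotient:
  assumes "x \<in> carrier A"
  shows "r \<odot>\<^bsub>quotient_algebra A J\<^esub> coset x = coset (r \<odot> x)"
proof -
  have "coset (r \<odot> x') = coset (r \<odot> x)" if "x' \<in> coset x" for x'
  proof -
    obtain j where j: "j \<in> J" "x' = j \<oplus> x"
      using \<open>x' \<in> coset x\<close> by (auto simp: mem_coset_iff[OF assms])
    have "j \<in> carrier A" using j subset by auto
    then show ?thesis using j assms
      by (intro coset_eqI[of _ _ "r \<odot> j"]) (auto simp: smult_add smult_closed smult_mem)
  qed
  then have "(\<Union>a\<in>coset x. coset (r \<odot> a)) = (\<Union>a\<in>coset x. coset (r \<odot> x))"
    by (intro SUP_cong refl)
  moreover have "coset x \<noteq> {}" using assms a_rcos_self by blast
  ultimately show ?thesis by (simp add: quotient_algebra_def)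
qed

lemmas quotient_simps = carrier_quotient zero_quotient add_quotient mult_quotient smult_quotient

lemma nonunital_algebra_quotient: "nonunital_algebra (quotient_algebra A J)"
proof -
  interpret Q: abelian_group "quotient_algebra A J"
  proof (rule abelian_groupI, goal_cases)
    \<comment> \<open>additive inverses\<close>
    case (6 X)
    then obtain x where "X = coset x" "x \<in> carrier A" by (auto simp: carrier_quotient)
    then show ?case
      by (intro bexI[of _ "coset (\<ominus> x)"]) (auto simp: quotient_simps l_neg)
  next
    \<comment> \<open>commutativity\<close>
    case (4 X Y)
    then obtain x y where "X = coset x" "x \<in> carrier A" "Y = coset y" "y \<in> carrier A"
      by (auto simp: carrier_quotient)
    then show ?case by (simp add: quotient_simps a_comm)
  qed (auto simp: quotient_simps a_assoc)
  show ?thesis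
    by unfold_locales
      (auto simp: quotient_simps m_closed m_assoc l_distr r_distr smult_closed smult_add add_smult
        mult_smult one_smult smult_l_assoc smult_r_assoc)
qed

text \<open>The homomorphism theorem.\<close>

lemma quotient_algebra_iso:
  assumes B: "nonunital_algebra B"
    and closed: "\<And>x. x \<in> carrier A \<Longrightarrow> h x \<in> carrier B"
    and add: "\<And>x y. \<lbrakk>x \<in> carrier A; y \<in> carrier A\<rbrakk> \<Longrightarrow> h (x \<oplus> y) = h x \<oplus>\<^bsub>B\<^esub> h y"
    and mult: "\<And>x y. \<lbrakk>x \<in> carrier A; y \<in> carrier A\<rbrakk> \<Longrightarrow> h (x \<otimes> y) = h x \<otimes>\<^bsub>B\<^esub> h y"
    and smult: "\<And>r x. x \<in> carrier A \<Longrightarrow> h (r \<odot> x) = r \<odot>\<^bsub>B\<^esub> h x"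
    and kernel: "\<And>x. x \<in> carrier A \<Longrightarrow> h x = \<zero>\<^bsub>B\<^esub> \<longleftrightarrow> x \<in> J"
    and surj: "carrier B \<subseteq> h ` carrier A"
  shows "\<exists>\<Psi>\<in>algebra_iso (quotient_algebra A J) B. \<forall>x\<in>carrier A. \<Psi> (coset x) = h x"
proof -
  interpret B: nonunital_algebra B by (rule B)
  have minus: "h (x \<ominus> y) = h x \<ominus>\<^bsub>B\<^esub> h y" if "x \<in> carrier A" "y \<in> carrier A" for x y
    using that by (simp add: minus_eq B.minus_eq add smult closed
        uminus_smult[symmetric] B.uminus_smult[symmetric] smult_closed)
  have eq_iff: "h x = h y \<longleftrightarrow> coset x = coset y" if "x \<in> carrier A" "y \<in> carrier A" for x y
    using that by (simp add: coset_eq_iff minus flip: kernel) (simp add: closed B.minus_eq_zero_iff)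
  define \<Psi> where "\<Psi> X = h (SOME x. x \<in> carrier A \<and> X = coset x)" for X
  have \<Psi>: "\<Psi> (coset x) = h x" if "x \<in> carrier A" for x
  proof -
    have "\<exists>y. y \<in> carrier A \<and> coset x = coset y" using that by blast
    then have "(SOME y. y \<in> carrier A \<and> coset x = coset y) \<in> carrier A \<and>
        coset x = coset (SOME y. y \<in> carrier A \<and> coset x = coset y)" by (rule someI_ex)
    then show ?thesis unfolding \<Psi>_def using that eq_iff by metis
  qed
  have "bij_betw \<Psi> (carrier (quotient_algebra A J)) (carrier B)"
    unfolding bij_betw_def carrier_quotient
    by (auto simp: inj_on_def \<Psi> eq_iff closed image_iff) (use surj in blast)
  then have "\<Psi> \<in> algebra_iso (quotient_algebra A J) B"
    by (auto simp: algebra_iso_def quotient_simps \<Psi> add mult smult m_closed smult_closed)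
  then show ?thesis using \<Psi> by blast
qed

end

section \<open>Linear extension and free algebras\<close>

text \<open>The additive extension of a family of additive maps, one for each basis element.\<close>

definition lin_ext :: "('a \<Rightarrow> 'c \<Rightarrow> 'm) \<Rightarrow> ('a \<Rightarrow>\<^sub>0 'c::zero) \<Rightarrow> 'm::comm_monoid_add" where
  "lin_ext f x = (\<Sum>a\<in>Poly_Mapping.keys x. f a (Poly_Mapping.lookup x a))"

lemma lin_ext_superset:
  assumes "finite K" "Poly_Mapping.keys x \<subseteq> K" "\<And>a. f a 0 = 0"
  shows "lin_ext f x = (\<Sum>a\<in>K. f a (Poly_Mapping.lookup x a))"
  unfolding lin_ext_def
  by (rule sum.mono_neutral_left) (use assms in \<open>auto simp: in_keys_iff\<close>)

lemma additive_zero: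
  fixes f :: "'c::comm_monoid_add \<Rightarrow> 'm::ab_group_add"
  assumes "\<And>c d. f (c + d) = f c + f d"
  shows "f 0 = 0"
  using assms[of 0 0] by simp

lemma lin_ext_zero [simp]: "lin_ext f 0 = 0"
  by (simp add: lin_ext_def)

lemma lin_ext_single:
  assumes "f a 0 = 0"
  shows "lin_ext f (Poly_Mapping.single a c) = f a c"
  using assms by (cases "c = 0") (auto simp: lin_ext_def)

lemma lin_ext_add:
  fixes f :: "'a \<Rightarrow> 'c::comm_monoid_add \<Rightarrow> 'm::ab_group_add"
  assumes "\<And>a c d. f a (c + d) = f a c + f a d"
  shows "lin_ext f (x + y) = lin_ext f x + lin_ext f y"
proof -
  let ?K = "Poly_Mapping.keys x \<union> Poly_Mapping.keys y"
  note zero = additive_zero[of "f a" for a, OF assms]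
  have "lin_ext f z = (\<Sum>a\<in>?K. f a (Poly_Mapping.lookup z a))"
    if "Poly_Mapping.keys z \<subseteq> ?K" for z
    using that zero by (intro lin_ext_superset) auto
  then show ?thesis
    using keys_add[of x y] by (simp add: lookup_add assms sum.distrib)
qed

lemma lin_ext_add_fun: "lin_ext (\<lambda>a c. f a c + g a c) x = lin_ext f x + lin_ext g x"
  by (simp add: lin_ext_def sum.distrib)

lemma poly_mapping_sum_single:
  fixes x :: "'a \<Rightarrow>\<^sub>0 'c::comm_monoid_add"
  shows "x = (\<Sum>a\<in>Poly_Mapping.keys x. Poly_Mapping.single a (Poly_Mapping.lookup x a))"
proof (rule poly_mapping_eqI)
  fix k
  have "(\<Sum>a\<in>Poly_Mapping.keys x. Poly_Mapping.lookup x a when a = k) = Poly_Mapping.lookup x k"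
    by (cases "k \<in> Poly_Mapping.keys x") (auto simp: when_def in_keys_iff sum.delta)
  then show "Poly_Mapping.lookup x k =
      Poly_Mapping.lookup (\<Sum>a\<in>Poly_Mapping.keys x. Poly_Mapping.single a (Poly_Mapping.lookup x a)) k"
    by (simp add: lookup_sum lookup_single)
qed

lemma poly_mapping_additive_induct [case_names zero single add]:
  fixes x :: "'a \<Rightarrow>\<^sub>0 'c::comm_monoid_add"
  assumes "P 0"
    and "\<And>a. a \<in> Poly_Mapping.keys x \<Longrightarrow> P (Poly_Mapping.single a (Poly_Mapping.lookup x a))"
    and "\<And>y z. P y \<Longrightarrow> P z \<Longrightarrow> P (y + z)"
  shows "P x"
proof -
  have "P (\<Sum>a\<in>K. Poly_Mapping.single a (Poly_Mapping.lookup x a))"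
    if "finite K" "K \<subseteq> Poly_Mapping.keys x" for K
    using that by induction (auto simp: assms)
  from this[of "Poly_Mapping.keys x"] show ?thesis
    using poly_mapping_sum_single[of x] by simp
qed

lemma lookup_map_zero:
  "f 0 = 0 \<Longrightarrow> Poly_Mapping.lookup (Poly_Mapping.map f x) k = f (Poly_Mapping.lookup x k)"
  by transfer (auto simp: when_def)

lemma keys_map_subset: "Poly_Mapping.keys (Poly_Mapping.map f x) \<subseteq> Poly_Mapping.keys x"
  by transfer auto

abbreviation scale :: "'r::comm_ring \<Rightarrow> ('a \<Rightarrow>\<^sub>0 'r) \<Rightarrow> ('a \<Rightarrow>\<^sub>0 'r)" where
  "scale r \<equiv> Poly_Mapping.map ((*) r)"

lemma scale_zero [simp]: "scale r 0 = 0"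
  by (rule poly_mapping_eqI) (simp add: lookup_map_zero)

lemma scale_single: "scale r (Poly_Mapping.single a c) = Poly_Mapping.single a (r * c)"
  by (rule poly_mapping_eqI) (simp add: lookup_map_zero lookup_single when_def)

lemma scale_add: "scale r (x + y) = scale r x + scale r y"
  by (rule poly_mapping_eqI) (simp add: lookup_map_zero lookup_add distrib_left)

lemma scale_add_left: "scale (r + q) x = scale r x + scale q x"
  by (rule poly_mapping_eqI) (simp add: lookup_map_zero lookup_add distrib_right)

lemma scale_scale: "scale (r * q) x = scale r (scale q x)"
  by (rule poly_mapping_eqI) (simp add: lookup_map_zero mult.assoc)

lemma scale_one: "scale (1 :: 'r::{comm_ring, comm_monoid_mult}) x = x"
  by (rule poly_mapping_eqI) (simp add: lookup_map_zero)

lemma scale_0 [simp]: "scale 0 x = 0"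
  by (rule poly_mapping_eqI) (simp add: lookup_map_zero)

lemma scale_uminus_one: "scale (- 1) x = - (x :: _ \<Rightarrow>\<^sub>0 'r::{comm_ring, comm_monoid_mult})"
  by (rule poly_mapping_eqI) (simp add: lookup_map_zero)

lemma scale_diff: "scale r (x - y) = scale r x - scale r y"
  by (rule poly_mapping_eqI) (simp add: lookup_map_zero lookup_minus right_diff_distrib)

lemma free_mult_eq_lin_ext:
  "x \<star> y = lin_ext (\<lambda>u c. lin_ext (\<lambda>v d. Poly_Mapping.single (u @ v) (c * d)) y) x"
  by (simp add: free_mult_def lin_ext_def)

lemma free_mult_single [simp]:
  "Poly_Mapping.single u c \<star> Poly_Mapping.single v d = Poly_Mapping.single (u @ v) (c * d)"
  by (subst free_mult_eq_lin_ext, subst lin_ext_single) (auto simp: lin_ext_single lin_ext_def)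

lemma free_mult_add_left: "(x + y) \<star> z = x \<star> z + y \<star> z"
  unfolding free_mult_eq_lin_ext
  by (rule lin_ext_add) (simp add: distrib_right single_add lin_ext_add_fun)

lemma free_mult_add_right: "z \<star> (x + y) = z \<star> x + z \<star> y"
  unfolding free_mult_eq_lin_ext
  by (subst lin_ext_add) (auto simp: distrib_left single_add lin_ext_add_fun)

lemma free_mult_zero [simp]: "0 \<star> x = 0" "x \<star> 0 = 0"
  by (auto simp: free_mult_def)

lemma free_mult_minus_left: "(x - y) \<star> z = x \<star> z - y \<star> z"
  using free_mult_add_left[of "x - y" y z] by simp

lemma free_mult_minus_right: "z \<star> (x - y) = z \<star> x - z \<star> y"
  using free_mult_add_right[of z "x - y" y] by simp

lemma free_mult_assoc: "(x \<star> y) \<star> z = x \<star> (y \<star> z)"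
proof (induction x rule: poly_mapping_additive_induct)
  case (single u)
  show ?case
  proof (induction y rule: poly_mapping_additive_induct)
    case (single v)
    show ?case
      by (induction z rule: poly_mapping_additive_induct) (auto simp: mult.assoc free_mult_add_right)
  qed (auto simp: free_mult_add_left free_mult_add_right)
qed (auto simp: free_mult_add_left)

lemma scale_free_mult_left: "scale r x \<star> y = scale r (x \<star> y)"
proof (induction x rule: poly_mapping_additive_induct)
  case (single u)
  show ?case
    by (induction y rule: poly_mapping_additive_induct)
      (auto simp: scale_single scale_add free_mult_add_right mult.assoc)
qed (auto simp: scale_add free_mult_add_left)

lemma scale_free_mult_right: "x \<star> scale r y = scale r (x \<star> y)"
proof (induction x rule: poly_mapping_additive_induct)
  case (single u)
  show ?case
    by (induction y rule: poly_mapping_additive_induct)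
      (auto simp: scale_single scale_add free_mult_add_right mult.left_commute)
qed (auto simp: scale_add free_mult_add_left)

lemma free_mult_sum_left: "(\<Sum>i\<in>I. x i) \<star> y = (\<Sum>i\<in>I. x i \<star> y)"
  by (induction I rule: infinite_finite_induct) (auto simp: free_mult_add_left)

lemma free_mult_sum_right: "y \<star> (\<Sum>i\<in>I. x i) = (\<Sum>i\<in>I. y \<star> x i)"
  by (induction I rule: infinite_finite_induct) (auto simp: free_mult_add_right)

lemma keys_free_mult:
  "Poly_Mapping.keys (x \<star> y) \<subseteq> {u @ v | u v. u \<in> Poly_Mapping.keys x \<and> v \<in> Poly_Mapping.keys y}"
proof -
  have *: "Poly_Mapping.keys (\<Sum>i\<in>I. f i) \<subseteq> (\<Union>i\<in>I. Poly_Mapping.keys (f i))"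
    if "finite I" for I :: "'i set" and f :: "'i \<Rightarrow> 'a list \<Rightarrow>\<^sub>0 'b"
    using that
  proof induction
    case (insert i I)
    then show ?case using keys_add[of "f i" "\<Sum>i\<in>I. f i"] by auto
  qed simp
  show ?thesis
    unfolding free_mult_def
    by (rule order.trans[OF *] UN_least finite_keys)+ (auto split: if_splits)
qed

lemma free_algebra_simps:
  "\<zero>\<^bsub>free_algebra G\<^esub> = 0" "x \<oplus>\<^bsub>free_algebra G\<^esub> y = x + y" "x \<otimes>\<^bsub>free_algebra G\<^esub> y = x \<star> y"
  "r \<odot>\<^bsub>free_algebra G\<^esub> x = scale r x"
  by (auto simp: free_algebra_def)

lemma mem_carrier_free_algebra:
  "x \<in> carrier (free_algebra G) \<longleftrightarrow> (\<forall>w\<in>Poly_Mapping.keys x. w \<noteq> [] \<and> set w \<subseteq> G)"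
  by (auto simp: free_algebra_def)

lemma single_mem_free_algebra:
  "\<lbrakk>set w \<subseteq> G; w \<noteq> []\<rbrakk> \<Longrightarrow> Poly_Mapping.single w c \<in> carrier (free_algebra G)"
  by (simp add: mem_carrier_free_algebra)

lemma free_algebra_add_mem:
  fixes x :: "_ \<Rightarrow>\<^sub>0 'r::{comm_ring, comm_monoid_mult}"
  shows "\<lbrakk>x \<in> carrier (free_algebra G); y \<in> carrier (free_algebra G)\<rbrakk> \<Longrightarrow> x + y \<in> carrier (free_algebra G)"
  using keys_add[of x y] unfolding mem_carrier_free_algebra by blast

lemma free_algebra_minus_mem:
  fixes x :: "_ \<Rightarrow>\<^sub>0 'r::{comm_ring, comm_monoid_mult}"
  assumes "x \<in> carrier (free_algebra G)" "y \<in> carrier (free_algebra G)"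
  shows "x - y \<in> carrier (free_algebra G)"
proof -
  have "Poly_Mapping.keys (- y) = Poly_Mapping.keys y" by (auto simp: in_keys_iff)
  then show ?thesis
    using assms free_algebra_add_mem[of x G "- y"] by (simp add: mem_carrier_free_algebra)
qed

lemma free_algebra_sum_mem:
  fixes x :: "'i \<Rightarrow> _ \<Rightarrow>\<^sub>0 'r::{comm_ring, comm_monoid_mult}"
  shows "(\<And>i. i \<in> I \<Longrightarrow> x i \<in> carrier (free_algebra G)) \<Longrightarrow> (\<Sum>i\<in>I. x i) \<in> carrier (free_algebra G)"
proof (induction I rule: infinite_finite_induct)
  case (insert i I)
  then show ?case by (simp add: free_algebra_add_mem)
qed (auto simp: mem_carrier_free_algebra)

lemma nonunital_algebra_free_algebra:
  "nonunital_algebra (free_algebra G :: ('r::{comm_ring, comm_monoid_mult}, _) module)"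
proof -
  let ?F = "free_algebra G :: ('r, _) module"
  have add: "x + y \<in> carrier ?F" if "x \<in> carrier ?F" "y \<in> carrier ?F" for x y
    using that keys_add[of x y] unfolding mem_carrier_free_algebra by blast
  have mult: "x \<star> y \<in> carrier ?F" if "x \<in> carrier ?F" "y \<in> carrier ?F" for x y
    using that keys_free_mult[of x y] unfolding mem_carrier_free_algebra by fastforce
  have scale: "scale r x \<in> carrier ?F" if "x \<in> carrier ?F" for r x
    using that keys_map_subset[of "(*) r" x] unfolding mem_carrier_free_algebra by blast
  interpret abelian_group ?F
  proof (rule abelian_groupI, goal_cases)
    \<comment> \<open>additive inverses\<close>
    case (6 x)
    then have "- x \<in> carrier ?F" by (auto simp: mem_carrier_free_algebra in_keys_iff)
    then show ?case by (intro bexI[of _ "- x"]) (auto simp: free_algebra_simps)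
  qed (simp_all add: free_algebra_simps add ac_simps, simp add: mem_carrier_free_algebra)
  show ?thesis
    by unfold_locales
      (simp_all add: free_algebra_simps mult scale free_mult_assoc free_mult_add_left
        free_mult_add_right scale_add scale_add_left scale_scale scale_one scale_free_mult_left
        scale_free_mult_right)
qed

section \<open>The inverse semigroup\<close>

lemma gba_minus_le: "A - B \<le> (A :: 'b::generalized_boolean_algebra)"
  using sup_minus[of A B] by (metis sup_ge1)

lemma inf_bot [simp]: "inf bot A = (bot :: 'b::generalized_boolean_algebra)" "inf A bot = (bot :: 'b)"
  by (simp_all add: inf.absorb1 inf.absorb2)

lemma sup_bot [simp]: "sup bot A = (A :: 'b::generalized_boolean_algebra)" "sup A bot = (A :: 'b)"
  by (simp_all add: sup.absorb1 sup.absorb2)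

lemma gba_minus_sup:
  fixes A B C :: "'b::generalized_boolean_algebra"
  shows "A - sup B C \<le> A - B"
proof -
  let ?D = "A - sup B C"
  have "inf ?D B \<le> inf ?D (sup B C)" by (simp add: le_infI2)
  then have bot: "inf ?D B = bot" by (simp add: inf_minus bot.extremum_unique)
  have "?D = inf ?D (sup (A - B) (inf A B))"
    using gba_minus_le[of A "sup B C"] by (simp add: sup_minus inf.absorb1)
  also have "\<dots> = sup (inf ?D (A - B)) (inf A (inf ?D B))"
    by (simp add: inf_sup_distrib1 inf.left_commute)
  also have "\<dots> = inf ?D (A - B)" by (simp add: bot)
  finally show ?thesis by (simp add: inf.absorb_iff1)
qed

lemma inf_bot_mono:
  fixes A B C D :: "'b::generalized_boolean_algebra"
  assumes "inf C D = bot" "A \<le> C" "B \<le> D"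
  shows "inf A B = bot"
  using inf_mono[OF assms(2,3)] assms(1) by (simp add: bot.extremum_unique)

lemma gba_morphism_simps:
  assumes "gba_morphism h"
  shows "h bot = bot" "h (sup A B) = sup (h A) (h B)" "h (inf A B) = inf (h A) (h B)"
    "h (A - B) = h A - h B"
  using assms by (auto simp: gba_morphism_def)

lemma word_cases:
  obtains (right) \<nu> where "\<gamma> = \<beta> @ \<nu>" | (left) \<nu> where "\<beta> = \<gamma> @ \<nu>" | (parallel) "\<beta> \<parallel> \<gamma>"
  unfolding parallel_def prefix_def by blast

lemma parallel_same_append [simp]: "\<alpha> @ \<beta> \<parallel> \<alpha> @ \<gamma> \<longleftrightarrow> \<beta> \<parallel> \<gamma>"
  by (simp add: parallel_def)

lemma parallel_append1: "\<alpha> \<parallel> \<beta> \<Longrightarrow> \<alpha> @ \<nu> \<parallel> \<beta>"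
  using parallel_append[of \<alpha> \<beta> \<nu> "[]"] by simp

lemma parallel_append2: "\<alpha> \<parallel> \<beta> \<Longrightarrow> \<alpha> \<parallel> \<beta> @ \<nu>"
  using parallel_append[of \<alpha> \<beta> "[]" \<nu>] by simp

context gbds
begin

subsection \<open>Words\<close>

lemma \<theta>_word_append: "\<theta>_word (\<alpha> @ \<beta>) A = \<theta>_word \<beta> (\<theta>_word \<alpha> A)"
  by (induction \<alpha> arbitrary: A) auto

lemma gba_morphism_\<theta>_word: "\<alpha> \<in> lists \<L> \<Longrightarrow> gba_morphism (\<theta>_word \<alpha>)"
proof (induction \<alpha>)
  case (Cons a \<alpha>)
  then show ?case using action_morphism[of a] by (auto simp: gba_morphism_def)
qed (simp add: gba_morphism_def)

lemmas \<theta>_word_simps = gba_morphism_simps[OF gba_morphism_\<theta>_word]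

lemma \<theta>_word_mono: "\<lbrakk>\<alpha> \<in> lists \<L>; A \<le> B\<rbrakk> \<Longrightarrow> \<theta>_word \<alpha> A \<le> \<theta>_word \<alpha> B"
  using \<theta>_word_simps(3)[of \<alpha> A B] by (simp add: inf.absorb_iff1)

lemmas \<theta>_simps = gba_morphism_simps[OF action_morphism]

lemma ideal_downward: "\<lbrakk>a \<in> \<L>; A \<in> \<I> a; B \<le> A\<rbrakk> \<Longrightarrow> B \<in> \<I> a"
  using ideal[of a] by (metis gba_ideal_def inf.absorb2)

lemma range_mem_ideal: "a \<in> \<L> \<Longrightarrow> A \<le> \<theta> a B \<Longrightarrow> A \<in> \<I> a"
  using range_subset by blast

lemma \<I>_word_downward: "\<lbrakk>A \<in> \<I>_word \<alpha>; B \<le> A\<rbrakk> \<Longrightarrow> B \<in> \<I>_word \<alpha>"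
  by (cases \<alpha>) (auto intro: order.trans)

lemma \<I>_word_singleton: "a \<in> \<L> \<Longrightarrow> \<I>_word [a] = \<I> a"
  by (auto intro: ideal_downward)

lemma \<I>_word_append:
  assumes "A \<in> \<I>_word \<alpha>" "\<alpha> \<in> lists \<L>" "\<nu> \<in> lists \<L>"
  shows "\<theta>_word \<nu> A \<in> \<I>_word (\<alpha> @ \<nu>)"
proof (cases \<alpha>)
  case Nil
  then show ?thesis using assms range_mem_ideal[OF _ order.refl]
    by (cases \<nu>) (auto intro!: bexI[of _ "\<theta> (hd \<nu>) A"])
next
  case (Cons a \<alpha>')
  then show ?thesis using assms by (auto simp: \<theta>_word_append intro: \<theta>_word_mono)
qed

lemma bot_mem_\<I>_word: "\<alpha> \<in> lists \<L> \<Longrightarrow> bot \<in> \<I>_word \<alpha>"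
proof (cases \<alpha>)
  case (Cons a \<beta>)
  assume "\<alpha> \<in> lists \<L>"
  then have "\<I> a \<noteq> {}" using Cons ideal[of a] by (auto simp: gba_ideal_def)
  then show ?thesis using Cons by auto
qed simp

lemma inf_mem_\<I>_word:
  "A \<in> \<I>_word \<alpha> \<Longrightarrow> inf A B \<in> \<I>_word \<alpha>" "B \<in> \<I>_word \<alpha> \<Longrightarrow> inf A B \<in> \<I>_word \<alpha>"
  by (erule \<I>_word_downward, simp)+

subsection \<open>Products\<close>

text \<open>
  Every element of the semigroup, zero included, is of the form \<^term>\<open>triple \<alpha> A \<beta>\<close>. The product
  rules below hold for all \<open>A\<close> and \<open>B\<close>, so that the zero needs no separate treatment.
\<close>

lemma S_cases [consumes 1]:
  assumes "x \<in> \<S>"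
  obtains \<alpha> A \<beta> where "x = triple \<alpha> A \<beta>" "\<alpha> \<in> lists \<L>" "\<beta> \<in> lists \<L>"
    "A \<in> \<I>_word \<alpha>" "A \<in> \<I>_word \<beta>"
proof (cases x)
  case Zero
  then show ?thesis using that[of "[]" bot "[]"] by (simp add: triple_def)
next
  case (Triple \<alpha> A \<beta>)
  then show ?thesis using assms that[of \<alpha> A \<beta>] by (simp add: triple_def \<S>_def)
qed

lemma triple_mem_S:
  "\<lbrakk>\<alpha> \<in> lists \<L>; \<beta> \<in> lists \<L>; A \<in> \<I>_word \<alpha>; A \<in> \<I>_word \<beta>\<rbrakk> \<Longrightarrow> triple \<alpha> A \<beta> \<in> \<S>"
  by (auto simp: triple_def \<S>_def)

lemma triple_bot [simp]: "triple \<alpha> bot \<beta> = Zero"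
  by (simp add: triple_def)

lemma triple_eq_Zero [simp]: "triple \<alpha> A \<beta> = Zero \<longleftrightarrow> A = bot" "Zero = triple \<alpha> A \<beta> \<longleftrightarrow> A = bot"
  by (auto simp: triple_def)

lemma prod_Zero [simp]: "x \<bullet> Zero = Zero"
  by (cases x) auto

lemma prod_same: "triple \<alpha> A \<beta> \<bullet> triple \<beta> B \<delta> = triple \<alpha> (inf A B) \<delta>"
  by (auto simp: triple_def)

lemma prod_right:
  assumes "\<nu> \<in> lists \<L>"
  shows "triple \<alpha> A \<beta> \<bullet> triple (\<beta> @ \<nu>) B \<delta> = triple (\<alpha> @ \<nu>) (inf (\<theta>_word \<nu> A) B) \<delta>"
  using assms by (auto simp: triple_def \<theta>_word_simps)

lemma prod_left:
  assumes "\<nu> \<in> lists \<L>"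
  shows "triple \<alpha> A (\<gamma> @ \<nu>) \<bullet> triple \<gamma> B \<delta> = triple \<alpha> (inf A (\<theta>_word \<nu> B)) (\<delta> @ \<nu>)"
  using assms by (auto simp: triple_def \<theta>_word_simps)

lemma prod_parallel:
  assumes "\<beta> \<parallel> \<gamma>"
  shows "triple \<alpha> A \<beta> \<bullet> triple \<gamma> B \<delta> = Zero"
  using assms by (auto simp: triple_def parallel_def)

lemmas prod_simps = prod_same prod_right prod_left prod_parallel

lemma star_triple [simp]: "star (triple \<alpha> A \<beta>) = triple \<beta> A \<alpha>"
  by (simp add: triple_def)

lemma star_star [simp]: "star (star x) = x"
  by (cases x) auto

lemma star_closed [simp, intro]: "x \<in> \<S> \<Longrightarrow> star x \<in> \<S>"
  by (erule S_cases) (auto intro: triple_mem_S)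

lemma star_eq_Zero [simp]: "star x = Zero \<longleftrightarrow> x = Zero"
  by (cases x) auto

lemma Zero_mem_S [simp, intro]: "Zero \<in> \<S>"
  by (simp add: \<S>_def)

lemma prod_closed [simp, intro]:
  assumes "x \<in> \<S>" "y \<in> \<S>"
  shows "x \<bullet> y \<in> \<S>"
  using assms(1)
proof (cases rule: S_cases)
  case x: (1 \<alpha> A \<beta>)
  from assms(2) show ?thesis
  proof (cases rule: S_cases)
    case y: (1 \<gamma> B \<delta>)
    show ?thesis
    proof (cases \<gamma> \<beta> rule: word_cases)
      case (right \<nu>)
      with x y show ?thesis
        by (auto simp: prod_simps intro!: triple_mem_S intro: inf_mem_\<I>_word \<I>_word_append)
    next
      case (left \<nu>)
      with x y show ?thesis
        by (auto simp: prod_simps intro!: triple_mem_S intro: inf_mem_\<I>_word \<I>_word_append)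
    next
      case parallel
      with x y show ?thesis by (simp add: prod_simps)
    qed
  qed
qed

lemma prod_assoc:
  assumes "x \<in> \<S>" "y \<in> \<S>" "z \<in> \<S>"
  shows "(x \<bullet> y) \<bullet> z = x \<bullet> (y \<bullet> z)"
proof -
  obtain \<alpha> A \<beta> \<gamma> B \<delta> \<epsilon> C \<zeta> where x: "x = triple \<alpha> A \<beta>" and y: "y = triple \<gamma> B \<delta>"
      and z: "z = triple \<epsilon> C \<zeta>"
      and words: "\<beta> \<in> lists \<L>" "\<gamma> \<in> lists \<L>" "\<delta> \<in> lists \<L>" "\<epsilon> \<in> lists \<L>"
    using assms by (meson S_cases)
  have right: "triple \<alpha> A (\<mu> @ \<nu>) \<bullet> triple (\<mu> @ \<nu> @ \<nu>') B \<beta> = triple (\<alpha> @ \<nu>') (inf (\<theta>_word \<nu>' A) B) \<beta>"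
    and left: "triple \<alpha> A (\<mu> @ \<nu> @ \<nu>') \<bullet> triple (\<mu> @ \<nu>) B \<beta> = triple \<alpha> (inf A (\<theta>_word \<nu>' B)) (\<beta> @ \<nu>')"
    if "\<nu>' \<in> lists \<L>" for \<alpha> A \<mu> \<nu> \<nu>' B \<beta>
    using that prod_right[of \<nu>' \<alpha> A "\<mu> @ \<nu>"] prod_left[of \<nu>' \<alpha> A "\<mu> @ \<nu>"] by simp_all
  note simps = x y z prod_simps right left \<theta>_word_simps \<theta>_word_append inf.assoc parallel_append1 parallel_append2
  show ?thesis
  proof (cases \<gamma> \<beta> rule: word_cases)
    case (right \<nu>)
    then show ?thesis
      using words by (cases \<epsilon> \<delta> rule: word_cases) (auto simp: simps)
  next
    case (left \<nu>)
    show ?thesis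
    proof (cases \<epsilon> \<delta> rule: word_cases)
      case (right \<mu>)
      then show ?thesis
        using words left by (cases \<mu> \<nu> rule: word_cases) (auto simp: simps)
    qed (use words left in \<open>auto simp: simps\<close>)
  next
    case parallel
    then show ?thesis
      using words by (cases \<epsilon> \<delta> rule: word_cases) (auto simp: simps)
  qed
qed

lemma star_prod:
  assumes "x \<in> \<S>" "y \<in> \<S>"
  shows "star (x \<bullet> y) = star y \<bullet> star x"
proof -
  obtain \<alpha> A \<beta> \<gamma> B \<delta> where x: "x = triple \<alpha> A \<beta>" and y: "y = triple \<gamma> B \<delta>"
      and words: "\<beta> \<in> lists \<L>" "\<gamma> \<in> lists \<L>"
    using assms by (meson S_cases)
  show ?thesis
    using words by (cases \<gamma> \<beta> rule: word_cases) (auto simp: x y prod_simps inf.commute parallel_commute)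
qed

lemma prod_star_prod: "x \<in> \<S> \<Longrightarrow> (x \<bullet> star x) \<bullet> x = x"
  by (erule S_cases) (simp add: prod_simps)

lemma prod_star_eq_Zero [simp]: "x \<in> \<S> \<Longrightarrow> x \<bullet> star x = Zero \<longleftrightarrow> x = Zero"
  by (erule S_cases) (simp add: prod_simps)

subsection \<open>Idempotents\<close>

lemma E_eq: "E = {x \<in> \<S>. star x = x}"
proof -
  have "x \<in> E \<longleftrightarrow> x \<in> \<S> \<and> star x = x" for x
    by (cases x) (auto simp: E_def \<S>_def)
  then show ?thesis by blast
qed

lemma E_cases [consumes 1]:
  assumes "x \<in> E"
  obtains \<alpha> A where "x = triple \<alpha> A \<alpha>" "\<alpha> \<in> lists \<L>" "A \<in> \<I>_word \<alpha>"
proof (cases x)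
  case Zero
  then show ?thesis using that[of "[]" bot] by (simp add: triple_def)
next
  case (Triple \<alpha> A \<beta>)
  then show ?thesis using assms that[of \<alpha> A] by (auto simp: triple_def E_def)
qed

lemma triple_mem_E: "\<lbrakk>\<alpha> \<in> lists \<L>; A \<in> \<I>_word \<alpha>\<rbrakk> \<Longrightarrow> triple \<alpha> A \<alpha> \<in> E"
  by (auto simp: E_eq intro: triple_mem_S)

lemma E_subset_S: "x \<in> E \<Longrightarrow> x \<in> \<S>"
  by (simp add: E_eq)

lemma E_star: "x \<in> E \<Longrightarrow> star x = x"
  by (simp add: E_eq)

lemma Zero_mem_E [simp, intro]: "Zero \<in> E"
  by (simp add: E_eq)

lemma E_idem: "x \<in> E \<Longrightarrow> x \<bullet> x = x"
  by (erule E_cases) (simp add: prod_simps)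

lemma E_commute:
  assumes "x \<in> E" "y \<in> E"
  shows "x \<bullet> y = y \<bullet> x"
proof -
  obtain \<alpha> A \<beta> B where x: "x = triple \<alpha> A \<alpha>" and y: "y = triple \<beta> B \<beta>"
      and words: "\<alpha> \<in> lists \<L>" "\<beta> \<in> lists \<L>"
    using assms by (meson E_cases)
  show ?thesis
    using words
    by (cases \<beta> \<alpha> rule: word_cases) (auto simp: x y prod_simps inf.commute parallel_commute)
qed

lemma E_closed [simp, intro]: "\<lbrakk>x \<in> E; y \<in> E\<rbrakk> \<Longrightarrow> x \<bullet> y \<in> E"
  using E_commute[of x y] star_prod[of x y] by (auto simp: E_eq)

lemma prod_star_mem_E [simp, intro]: "x \<in> \<S> \<Longrightarrow> x \<bullet> star x \<in> E"
  by (simp add: E_eq star_prod)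

lemma star_prod_mem_E [simp, intro]: "x \<in> \<S> \<Longrightarrow> star x \<bullet> x \<in> E"
  by (simp add: E_eq star_prod)

lemma conjugate_mem_E: "\<lbrakk>x \<in> \<S>; e \<in> E\<rbrakk> \<Longrightarrow> x \<bullet> e \<bullet> star x \<in> E"
  by (simp add: E_eq star_prod prod_assoc)

lemma E_left_commute: "\<lbrakk>x \<in> E; y \<in> E; z \<in> E\<rbrakk> \<Longrightarrow> x \<bullet> (y \<bullet> z) = y \<bullet> (x \<bullet> z)"
  by (metis E_commute E_subset_S prod_assoc)

lemma E_le_refl: "x \<in> E \<Longrightarrow> x \<preceq> x"
  by (simp add: E_le_def E_idem)

lemma E_le_trans: "\<lbrakk>x \<in> E; y \<in> E; z \<in> E; x \<preceq> y; y \<preceq> z\<rbrakk> \<Longrightarrow> x \<preceq> z"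
  unfolding E_le_def by (metis E_subset_S prod_assoc)

lemma E_prod_le1: "\<lbrakk>x \<in> E; y \<in> E\<rbrakk> \<Longrightarrow> x \<bullet> y \<preceq> x"
  unfolding E_le_def by (metis E_commute E_idem E_subset_S prod_assoc)

lemma E_prod_le2: "\<lbrakk>x \<in> E; y \<in> E\<rbrakk> \<Longrightarrow> x \<bullet> y \<preceq> y"
  unfolding E_le_def by (simp add: E_subset_S prod_assoc E_idem)

lemma E_le_triple_iff:
  assumes "\<alpha> \<in> lists \<L>" "\<gamma> \<in> lists \<L>" "C \<noteq> bot"
  shows "triple \<gamma> C \<gamma> \<preceq> triple \<alpha> A \<alpha> \<longleftrightarrow> (\<exists>\<mu>. \<gamma> = \<alpha> @ \<mu> \<and> C \<le> \<theta>_word \<mu> A)"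
proof (cases \<gamma> \<alpha> rule: word_cases)
  case (right \<nu>)
  then show ?thesis using assms
    by (auto simp: E_le_def prod_simps) (auto simp: triple_def inf.absorb_iff1 split: if_splits)
next
  case (left \<nu>)
  then show ?thesis using assms
    by (auto simp: E_le_def prod_simps) (auto simp: triple_def inf.absorb_iff1 split: if_splits)
next
  case parallel
  then have "\<not> (\<exists>\<mu>. \<gamma> = \<alpha> @ \<mu>)" by (auto simp: parallel_def)
  with parallel show ?thesis using assms by (auto simp: E_le_def prod_simps parallel_commute)
qed

end

section \<open>The grading\<close>

sublocale gbds \<subseteq> FG: group "free_group \<L>"
  by (rule group_free_group)

context gbds
begin

abbreviation \<G> :: "('l \<times> bool) list monoid" where
  "\<G> \<equiv> free_group \<L>"

lemma grade_triple:
  "A \<noteq> bot \<Longrightarrow> grade (triple \<alpha> A \<beta>) =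
     positive_word \<alpha> \<otimes>\<^bsub>\<G>\<^esub> inv\<^bsub>\<G>\<^esub> positive_word \<beta>"
  by (simp add: triple_def)

lemma grade_append:
  assumes "\<alpha> \<in> lists \<L>" "\<beta> \<in> lists \<L>" "\<nu> \<in> lists \<L>"
  shows "positive_word (\<alpha> @ \<nu>) \<otimes>\<^bsub>\<G>\<^esub> inv\<^bsub>\<G>\<^esub> positive_word (\<beta> @ \<nu>) =
    positive_word \<alpha> \<otimes>\<^bsub>\<G>\<^esub> inv\<^bsub>\<G>\<^esub> positive_word \<beta>"
  using assms[THEN positive_word_closed]
  by (simp add: positive_word_append[of _ _ \<L>] FG.inv_mult_group FG.m_assoc)
    (simp flip: FG.m_assoc)

lemma grade_append_eqD:
  assumes "\<gamma> \<in> lists \<L>" "\<nu> \<in> lists \<L>" "\<beta> \<in> lists \<L>" "\<delta> \<in> lists \<L>"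
    and eq: "positive_word (\<gamma> @ \<nu>) \<otimes>\<^bsub>\<G>\<^esub> inv\<^bsub>\<G>\<^esub> positive_word \<beta> =
      positive_word \<gamma> \<otimes>\<^bsub>\<G>\<^esub> inv\<^bsub>\<G>\<^esub> positive_word \<delta>"
  shows "\<beta> = \<delta> @ \<nu>"
proof -
  note closed = assms(1-4)[THEN positive_word_closed]
  have "positive_word \<nu> \<otimes>\<^bsub>\<G>\<^esub> inv\<^bsub>\<G>\<^esub> positive_word \<beta> =
      inv\<^bsub>\<G>\<^esub> positive_word \<delta>"
    using eq closed by (simp add: positive_word_append[of _ _ \<L>] FG.m_assoc)
  then have "positive_word \<nu> = inv\<^bsub>\<G>\<^esub> positive_word \<delta> \<otimes>\<^bsub>\<G>\<^esub> positive_word \<beta>"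
    using closed by (metis FG.inv_closed FG.inv_solve_right FG.inv_inv)
  then have "positive_word (\<delta> @ \<nu>) = positive_word \<beta>"
    using closed by (simp add: positive_word_append[of _ _ \<L>] flip: FG.m_assoc)
  then show ?thesis by simp
qed

lemma grade_closed: "\<lbrakk>x \<in> \<S>; x \<noteq> Zero\<rbrakk> \<Longrightarrow> grade x \<in> carrier (\<G>)"
  by (erule S_cases) (simp add: grade_triple positive_word_closed)

lemma grade_star: "\<lbrakk>x \<in> \<S>; x \<noteq> Zero\<rbrakk> \<Longrightarrow> grade (star x) = inv\<^bsub>\<G>\<^esub> grade x"
  by (erule S_cases) (simp add: grade_triple positive_word_closed FG.inv_mult_group)

lemma grade_E: "\<lbrakk>x \<in> E; x \<noteq> Zero\<rbrakk> \<Longrightarrow> grade x = \<one>\<^bsub>\<G>\<^esub>"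
  by (erule E_cases) (simp add: grade_triple positive_word_closed)

lemma grade_prod:
  assumes "x \<in> \<S>" "y \<in> \<S>" "x \<bullet> y \<noteq> Zero"
  shows "grade (x \<bullet> y) = grade x \<otimes>\<^bsub>\<G>\<^esub> grade y"
proof -
  obtain \<alpha> A \<beta> where x: "x = triple \<alpha> A \<beta>" "\<alpha> \<in> lists \<L>" "\<beta> \<in> lists \<L>"
    using assms(1) by (rule S_cases)
  obtain \<gamma> B \<delta> where y: "y = triple \<gamma> B \<delta>" "\<gamma> \<in> lists \<L>" "\<delta> \<in> lists \<L>"
    using assms(2) by (rule S_cases)
  have AB: "A \<noteq> bot" "B \<noteq> bot" using assms x y by auto
  have *: "(positive_word \<alpha> \<otimes>\<^bsub>\<G>\<^esub> inv\<^bsub>\<G>\<^esub> positive_word \<epsilon>) \<otimes>\<^bsub>\<G>\<^esub>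
      (positive_word \<epsilon> \<otimes>\<^bsub>\<G>\<^esub> inv\<^bsub>\<G>\<^esub> positive_word \<delta>) =
      positive_word \<alpha> \<otimes>\<^bsub>\<G>\<^esub> inv\<^bsub>\<G>\<^esub> positive_word \<delta>"
    if "\<alpha> \<in> lists \<L>" "\<epsilon> \<in> lists \<L>" "\<delta> \<in> lists \<L>" for \<alpha> \<epsilon> \<delta>
    using that[THEN positive_word_closed]
    by (simp add: FG.m_assoc) (simp flip: FG.m_assoc)
  show ?thesis
  proof (cases \<gamma> \<beta> rule: word_cases)
    case (right \<nu>)
    then have "grade (x \<bullet> y) =
        positive_word (\<alpha> @ \<nu>) \<otimes>\<^bsub>\<G>\<^esub> inv\<^bsub>\<G>\<^esub> positive_word \<delta>"
      using assms x y by (auto simp: prod_simps grade_triple)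
    also have "\<dots> = grade x \<otimes>\<^bsub>\<G>\<^esub> grade y"
      using right x y AB *[of "\<alpha> @ \<nu>" "\<beta> @ \<nu>" \<delta>] by (simp add: grade_triple grade_append)
    finally show ?thesis .
  next
    case (left \<nu>)
    then have "grade (x \<bullet> y) =
        positive_word \<alpha> \<otimes>\<^bsub>\<G>\<^esub> inv\<^bsub>\<G>\<^esub> positive_word (\<delta> @ \<nu>)"
      using assms x y by (auto simp: prod_simps grade_triple)
    also have "\<dots> = grade x \<otimes>\<^bsub>\<G>\<^esub> grade y"
      using left x y AB *[of \<alpha> "\<gamma> @ \<nu>" "\<delta> @ \<nu>"] by (simp add: grade_triple grade_append)
    finally show ?thesis .
  qed (use assms x y in \<open>simp add: prod_simps\<close>)
qed

text \<open>
  For two elements of the same grade, either the pair of words of one arises from that of the other by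
  appending a common suffix, or the words are incomparable on both sides.
\<close>

lemma same_grade_cases [consumes 3, case_names right left parallel]:
  assumes "u \<in> \<S> - {Zero}" "t \<in> \<S> - {Zero}" "grade u = grade t"
  obtains (right) \<alpha> A \<beta> \<nu> B where "u = triple \<alpha> A \<beta>" "t = triple (\<alpha> @ \<nu>) B (\<beta> @ \<nu>)" "\<nu> \<in> lists \<L>"
  | (left) \<alpha> A \<beta> \<nu> B where "t = triple \<alpha> A \<beta>" "u = triple (\<alpha> @ \<nu>) B (\<beta> @ \<nu>)" "\<nu> \<in> lists \<L>"
  | (parallel) \<alpha> A \<beta> \<gamma> B \<delta> where "u = triple \<alpha> A \<beta>" "t = triple \<gamma> B \<delta>" "\<alpha> \<parallel> \<gamma>" "\<beta> \<parallel> \<delta>"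
proof -
  obtain \<alpha> A \<beta> where u: "u = triple \<alpha> A \<beta>" "\<alpha> \<in> lists \<L>" "\<beta> \<in> lists \<L>"
    using DiffD1[OF assms(1)] by (rule S_cases)
  obtain \<gamma> B \<delta> where t: "t = triple \<gamma> B \<delta>" "\<gamma> \<in> lists \<L>" "\<delta> \<in> lists \<L>"
    using DiffD1[OF assms(2)] by (rule S_cases)
  have AB: "A \<noteq> bot" "B \<noteq> bot" using assms u t by auto
  have eq: "positive_word \<alpha> \<otimes>\<^bsub>\<G>\<^esub> inv\<^bsub>\<G>\<^esub> positive_word \<beta> =
      positive_word \<gamma> \<otimes>\<^bsub>\<G>\<^esub> inv\<^bsub>\<G>\<^esub> positive_word \<delta>"
    using assms(3) u t AB by (simp add: grade_triple)
  then have eq': "positive_word \<beta> \<otimes>\<^bsub>\<G>\<^esub> inv\<^bsub>\<G>\<^esub> positive_word \<alpha> =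
      positive_word \<delta> \<otimes>\<^bsub>\<G>\<^esub> inv\<^bsub>\<G>\<^esub> positive_word \<gamma>"
    using u t positive_word_closed by (metis FG.inv_closed FG.inv_inv FG.inv_mult_group)
  show thesis
  proof (cases \<gamma> \<alpha> rule: word_cases)
    case (right \<nu>)
    then have "\<delta> = \<beta> @ \<nu>" using grade_append_eqD[of \<alpha> \<nu> \<delta> \<beta>] u t eq by simp
    then show thesis using that(1)[of \<alpha> A \<beta> \<nu> B] right u t by simp
  next
    case (left \<nu>)
    then have "\<beta> = \<delta> @ \<nu>" using grade_append_eqD[of \<gamma> \<nu> \<beta> \<delta>] u t eq by simp
    then show thesis using that(2)[of \<gamma> B \<delta> \<nu> A] left u t by simp
  next
    case 1: parallel
    show thesis
    proof (cases \<delta> \<beta> rule: word_cases)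
      case (right \<nu>)
      then have "\<gamma> = \<alpha> @ \<nu>" using grade_append_eqD[of \<beta> \<nu> \<gamma> \<alpha>] u t eq' by simp
      then show thesis using 1 by (simp add: parallel_def)
    next
      case (left \<nu>)
      then have "\<alpha> = \<gamma> @ \<nu>" using grade_append_eqD[of \<delta> \<nu> \<alpha> \<gamma>] u t eq' by simp
      then show thesis using 1 by (simp add: parallel_def)
    next
      case parallel
      then show thesis using that(3) 1 u t by blast
    qed
  qed
qed

text \<open>
  The conjugate depends on \<open>u\<close> only through \<open>uu\<^sup>*\<close>. This is why the partial action of a grade can be
  computed with any element of that grade.
\<close>

lemma same_grade_conjugate:
  assumes "u \<in> \<S> - {Zero}" "t \<in> \<S> - {Zero}" "grade u = grade t"
  shows "u \<bullet> (star t \<bullet> t) \<bullet> star u = (u \<bullet> star u) \<bullet> (t \<bullet> star t)"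
  using assms by (cases rule: same_grade_cases) (auto simp: prod_simps inf.commute inf.left_commute)

lemma same_grade_compatible:
  assumes "u \<in> \<S> - {Zero}" "t \<in> \<S> - {Zero}" "grade u = grade t"
  shows "(u \<bullet> star u) \<bullet> t = (t \<bullet> star t) \<bullet> u"
  using assms
  by (cases rule: same_grade_cases) (auto simp: prod_simps inf.commute parallel_commute)

lemma same_grade_eqI:
  assumes "u \<in> \<S> - {Zero}" "t \<in> \<S> - {Zero}" "grade u = grade t" "star u \<bullet> u = star t \<bullet> t"
  shows "u = t"
  using assms
  by (cases rule: same_grade_cases)
    (auto simp: prod_simps, auto simp: triple_def parallel_def split: if_splits)

lemma E_grade_iff:
  "x \<in> E_grade g \<longleftrightarrow> x = Zero \<or> (\<exists>t\<in>\<S> - {Zero}. grade t = g \<and> x = t \<bullet> star t)"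
  by (auto simp: E_grade_def)

lemma E_grade_subset: "E_grade g \<subseteq> E"
  by (auto simp: E_grade_iff)

lemma prod_star_mem_E_grade: "\<lbrakk>t \<in> \<S>; t \<noteq> Zero\<rbrakk> \<Longrightarrow> t \<bullet> star t \<in> E_grade (grade t)"
  by (auto simp: E_grade_iff)

lemma E_grade_inv_iff:
  assumes "g \<in> carrier (\<G>)"
  shows "x \<in> E_grade (inv\<^bsub>\<G>\<^esub> g) \<longleftrightarrow>
    x = Zero \<or> (\<exists>t\<in>\<S> - {Zero}. grade t = g \<and> x = star t \<bullet> t)"
proof -
  have "(\<exists>t\<in>\<S> - {Zero}. grade t = inv\<^bsub>\<G>\<^esub> g \<and> x = t \<bullet> star t) \<longleftrightarrow>
      (\<exists>t\<in>\<S> - {Zero}. grade t = g \<and> x = star t \<bullet> t)" (is "?l \<longleftrightarrow> ?r")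
  proof
    assume ?l
    then obtain t where "t \<in> \<S> - {Zero}" "grade t = inv\<^bsub>\<G>\<^esub> g" "x = t \<bullet> star t" by blast
    then show ?r using assms by (intro bexI[of _ "star t"]) (auto simp: grade_star)
  next
    assume ?r
    then obtain t where "t \<in> \<S> - {Zero}" "grade t = g" "x = star t \<bullet> t" by blast
    then show ?l by (intro bexI[of _ "star t"]) (auto simp: grade_star)
  qed
  then show ?thesis by (simp add: E_grade_iff)
qed

lemma E_grade_prod:
  assumes "x \<in> E_grade g" "y \<in> E"
  shows "x \<bullet> y \<in> E_grade g"
proof (cases "x \<bullet> y = Zero")
  case False
  then obtain t where t: "t \<in> \<S>" "t \<noteq> Zero" "grade t = g" "x = t \<bullet> star t"
    using assms by (auto simp: E_grade_iff)
  note S = t(1) E_subset_S[OF assms(2)]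
  have "(y \<bullet> t) \<bullet> star (y \<bullet> t) = y \<bullet> (x \<bullet> y)"
    using S t(4) assms(2) by (simp add: star_prod E_star prod_assoc)
  also have "\<dots> = x \<bullet> y"
    using E_left_commute[of y x y] assms E_grade_subset[of g] by (auto simp: E_idem)
  finally have eq: "(y \<bullet> t) \<bullet> star (y \<bullet> t) = x \<bullet> y" .
  then have "y \<bullet> t \<noteq> Zero" using False by auto
  moreover have "y \<noteq> Zero" using False by auto
  ultimately have "grade (y \<bullet> t) = g"
    using S t assms(2) grade_closed[of t] by (simp add: grade_prod grade_E)
  then show ?thesis
    using eq \<open>y \<bullet> t \<noteq> Zero\<close> S by (auto simp: E_grade_iff intro!: bexI[of _ "y \<bullet> t"])
qed (simp add: E_grade_iff)

lemma E_iso_eq: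
  assumes "t \<in> \<S>" "t \<noteq> Zero"
  shows "E_iso (grade t) (star t \<bullet> t) = t \<bullet> star t"
proof -
  have "star t \<bullet> t \<noteq> Zero" using assms prod_star_eq_Zero[of "star t"] by simp
  moreover have "(THE y. \<exists>u\<in>\<S> - {Zero}. grade u = grade t \<and> star u \<bullet> u = star t \<bullet> t \<and> u \<bullet> star u = y)
      = t \<bullet> star t"
    using assms by (intro the_equality) (use same_grade_eqI in blast)+
  ultimately show ?thesis by (simp add: E_iso_def)
qed

lemma E_iso_Zero [simp]: "E_iso g Zero = Zero"
  by (simp add: E_iso_def)

section \<open>Tight filters\<close>

lemma tight_filter_prod_iff:
  assumes "\<xi> \<in> tight_filters" "x \<in> E" "y \<in> E"
  shows "x \<bullet> y \<in> \<xi> \<longleftrightarrow> x \<in> \<xi> \<and> y \<in> \<xi>"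
  using assms E_prod_le1[of x y] E_prod_le2[of x y] unfolding tight_filters_def by blast

lemma tight_filter_upward:
  "\<lbrakk>\<xi> \<in> tight_filters; x \<in> \<xi>; y \<in> E; x \<preceq> y\<rbrakk> \<Longrightarrow> y \<in> \<xi>"
  by (simp add: tight_filters_def)

lemma tight_filter_Zero: "\<xi> \<in> tight_filters \<Longrightarrow> Zero \<notin> \<xi>"
  by (simp add: tight_filters_def)

lemma tight_filter_cover: "\<lbrakk>\<xi> \<in> tight_filters; x \<in> \<xi>; finite_cover x Z\<rbrakk> \<Longrightarrow> \<exists>z\<in>Z. z \<in> \<xi>"
  unfolding tight_filters_def by blast

text \<open>Ultrafilters are tight, and by Zorn's lemma they exist in abundance.\<close>

lemma ex_tight_filter:
  assumes e: "e \<in> E" "e \<noteq> Zero"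
  shows "\<exists>\<xi>\<in>tight_filters. e \<in> \<xi>"
proof -
  define \<F> where "\<F> = {\<xi>. \<xi> \<subseteq> E \<and> e \<in> \<xi> \<and> Zero \<notin> \<xi> \<and> (\<forall>x\<in>\<xi>. \<forall>y\<in>\<xi>. x \<bullet> y \<in> \<xi>)}"
  have "{e} \<in> \<F>" using e by (simp add: \<F>_def E_idem)
  moreover have "\<Union>\<C> \<in> \<F>" if "\<C> \<noteq> {}" "subset.chain \<F> \<C>" for \<C>
  proof -
    have "x \<bullet> y \<in> \<Union>\<C>" if "x \<in> \<Union>\<C>" "y \<in> \<Union>\<C>" for x y
    proof -
      obtain X Y where *: "X \<in> \<C>" "Y \<in> \<C>" "x \<in> X" "y \<in> Y" using \<open>x \<in> \<Union>\<C>\<close> \<open>y \<in> \<Union>\<C>\<close> by blast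
      then have "X \<subseteq> Y \<or> Y \<subseteq> X" using \<open>subset.chain \<F> \<C>\<close> by (auto simp: subset.chain_def)
      moreover have "X \<in> \<F>" "Y \<in> \<F>" using * \<open>subset.chain \<F> \<C>\<close> by (auto simp: subset.chain_def)
      ultimately have "x \<bullet> y \<in> X \<or> x \<bullet> y \<in> Y" using *(3,4) by (auto simp: \<F>_def)
      then show ?thesis using *(1,2) by blast
    qed
    moreover have "\<Union>\<C> \<subseteq> E" "e \<in> \<Union>\<C>" "Zero \<notin> \<Union>\<C>"
      using that by (fastforce simp: \<F>_def subset.chain_def)+
    ultimately show ?thesis by (simp add: \<F>_def)
  qed
  ultimately obtain \<xi> where \<xi>: "\<xi> \<in> \<F>" and max: "\<forall>\<eta>\<in>\<F>. \<xi> \<subseteq> \<eta> \<longrightarrow> \<eta> = \<xi>"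
    using subset_Zorn_nonempty[of \<F>] by blast
  have sub: "\<xi> \<subseteq> E" and e\<xi>: "e \<in> \<xi>" and Zero: "Zero \<notin> \<xi>"
    and closed: "\<And>x y. x \<in> \<xi> \<Longrightarrow> y \<in> \<xi> \<Longrightarrow> x \<bullet> y \<in> \<xi>"
    using \<xi> by (auto simp: \<F>_def)
  \<comment> \<open>A maximal element contains every idempotent that meets all its members.\<close>
  have ultra: "y \<in> \<xi>" if y: "y \<in> E" and meets: "\<And>m. m \<in> \<xi> \<Longrightarrow> m \<bullet> y \<noteq> Zero" for y
  proof -
    let ?\<eta> = "\<xi> \<union> {m \<bullet> y |m. m \<in> \<xi>} \<union> {y}"
    have 1: "(m \<bullet> y) \<bullet> (m' \<bullet> y) = (m \<bullet> m') \<bullet> y" "m \<bullet> (m' \<bullet> y) = (m \<bullet> m') \<bullet> y"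
        "(m \<bullet> y) \<bullet> m' = (m \<bullet> m') \<bullet> y" "(m \<bullet> y) \<bullet> y = m \<bullet> y" "y \<bullet> (m \<bullet> y) = m \<bullet> y" "y \<bullet> m = m \<bullet> y"
      if "m \<in> \<xi>" "m' \<in> \<xi>" for m m'
    proof -
      have E: "m \<in> E" "m' \<in> E" using that sub by auto
      show ym: "y \<bullet> (m \<bullet> y) = m \<bullet> y"
        using E_left_commute[of y m y] E y by (simp add: E_idem)
      have "y \<bullet> (m' \<bullet> y) = m' \<bullet> y"
        using E_left_commute[of y m' y] E y by (simp add: E_idem)
      then show "(m \<bullet> y) \<bullet> (m' \<bullet> y) = (m \<bullet> m') \<bullet> y"
        using E y by (simp add: prod_assoc E_subset_S)
      show "m \<bullet> (m' \<bullet> y) = (m \<bullet> m') \<bullet> y"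
        using E y by (simp add: prod_assoc E_subset_S)
      show "(m \<bullet> y) \<bullet> m' = (m \<bullet> m') \<bullet> y"
        using E y E_commute[of y m'] by (simp add: prod_assoc E_subset_S)
      show "(m \<bullet> y) \<bullet> y = m \<bullet> y"
        using E y by (simp add: prod_assoc E_subset_S E_idem)
      show "y \<bullet> m = m \<bullet> y"
        using E y by (simp add: E_commute)
    qed
    have "?\<eta> \<in> \<F>"
      unfolding \<F>_def
    proof (intro CollectI conjI ballI)
      show "?\<eta> \<subseteq> E" using sub y by auto
      show "e \<in> ?\<eta>" using e\<xi> by simp
      show "Zero \<notin> ?\<eta>" using Zero meets e\<xi> by fastforce
      fix u v assume "u \<in> ?\<eta>" "v \<in> ?\<eta>"
      then consider "u \<in> \<xi>" "v \<in> \<xi>"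
        | m where "u \<in> \<xi>" "m \<in> \<xi>" "v = m \<bullet> y" | "u \<in> \<xi>" "v = y"
        | m where "m \<in> \<xi>" "u = m \<bullet> y" "v \<in> \<xi>"
        | m m' where "m \<in> \<xi>" "u = m \<bullet> y" "m' \<in> \<xi>" "v = m' \<bullet> y" | m where "m \<in> \<xi>" "u = m \<bullet> y" "v = y"
        | "u = y" "v \<in> \<xi>" | m where "u = y" "m \<in> \<xi>" "v = m \<bullet> y" | "u = y" "v = y"
        by blast
      then have "u \<bullet> v \<in> \<xi> \<or> (\<exists>m\<in>\<xi>. u \<bullet> v = m \<bullet> y) \<or> u \<bullet> v = y"
        by cases (use 1 closed E_idem[OF y] in metis)+
      then show "u \<bullet> v \<in> ?\<eta>" by blast
    qed
    moreover have "\<xi> \<subseteq> ?\<eta>" by auto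
    ultimately have "?\<eta> = \<xi>" by (rule max[rule_format])
    moreover have "y \<in> ?\<eta>" by simp
    ultimately show "y \<in> \<xi>" by (simp only:)
  qed
  have upward: "y \<in> \<xi>" if "x \<in> \<xi>" "y \<in> E" "x \<preceq> y" for x y
  proof (rule ultra)
    fix m assume "m \<in> \<xi>"
    then have "m \<bullet> x \<in> \<xi>" using closed that by simp
    then have "m \<bullet> x \<noteq> Zero" using Zero by auto
    moreover have "m \<bullet> x = m \<bullet> y \<bullet> x"
      using that \<open>m \<in> \<xi>\<close> sub E_commute[of x y] by (auto simp: prod_assoc E_subset_S E_le_def subset_iff)
    ultimately show "m \<bullet> y \<noteq> Zero" by auto
  qed fact
  have cover: "Z \<inter> \<xi> \<noteq> {}" if "x \<in> \<xi>" "finite_cover x Z" for x Z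
  proof
    assume disjoint: "Z \<inter> \<xi> = {}"
    have "\<exists>m\<in>\<xi>. m \<preceq> x \<and> (\<forall>z\<in>Y. m \<bullet> z = Zero)" if "finite Y" "Y \<subseteq> Z" for Y
      using that
    proof induction
      case empty
      then show ?case using \<open>x \<in> \<xi>\<close> sub E_le_refl by auto
    next
      case (insert z Y)
      then obtain m where m: "m \<in> \<xi>" "m \<preceq> x" "\<forall>z\<in>Y. m \<bullet> z = Zero" by auto
      have Z: "insert z Y \<subseteq> E" using insert.prems \<open>finite_cover x Z\<close> by (auto simp: finite_cover_def)
      obtain n where n: "n \<in> \<xi>" "n \<bullet> z = Zero"
        using ultra[of z] disjoint insert.prems Z by blast
      have E: "m \<in> E" "n \<in> E" "x \<in> E" using m n sub \<open>x \<in> \<xi>\<close> by auto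
      have "m \<bullet> n \<preceq> x" using E_le_trans[OF _ _ _ E_prod_le1 m(2)] E by auto
      moreover have "m \<bullet> n \<bullet> z = Zero" using E Z n by (simp add: prod_assoc E_subset_S)
      moreover have "m \<bullet> n \<bullet> y = Zero" if "y \<in> Y" for y
        using E Z m that E_left_commute[of m n y] by (simp add: prod_assoc E_subset_S subset_iff)
      ultimately show ?case using closed[OF m(1) n(1)] by auto
    qed
    from this[of Z] obtain m where "m \<in> \<xi>" "m \<preceq> x" "\<forall>z\<in>Z. m \<bullet> z = Zero"
      using \<open>finite_cover x Z\<close> by (auto simp: finite_cover_def)
    moreover have "m \<in> E" "m \<noteq> Zero" using \<open>m \<in> \<xi>\<close> sub Zero by auto
    ultimately show False using \<open>finite_cover x Z\<close> by (auto simp: finite_cover_def)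
  qed
  have "\<xi> \<in> tight_filters"
    using sub e\<xi> Zero upward closed cover by (auto simp: tight_filters_def)
  then show ?thesis using e\<xi> by blast
qed

text \<open>
  The partial action on filters: a filter that contains \<open>uu\<^sup>*\<close> is pulled back along \<open>u\<close> to one that
  contains \<open>u\<^sup>*u\<close>.
\<close>

definition pull :: "('l, 'b) triple \<Rightarrow> ('l, 'b) triple set \<Rightarrow> ('l, 'b) triple set" where
  "pull u \<xi> = {x \<in> E. u \<bullet> x \<bullet> star u \<in> \<xi>}"

lemma pull_tight:
  assumes u: "u \<in> \<S>" and \<xi>: "\<xi> \<in> tight_filters" and dom: "u \<bullet> star u \<in> \<xi>"
  shows "pull u \<xi> \<in> tight_filters"
proof -
  note [simp] = E_subset_S conjugate_mem_E[OF u]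
  define q where "q x = u \<bullet> x \<bullet> star u" for x
  have q_mem: "q x \<in> E" if "x \<in> E" for x using that by (simp add: q_def)
  have q_prod: "q (x \<bullet> y) = q x \<bullet> q y" if "x \<in> E" "y \<in> E" for x y
  proof -
    have "q x \<bullet> q y = u \<bullet> (x \<bullet> ((star u \<bullet> u) \<bullet> (y \<bullet> star u)))"
      using u that by (simp add: q_def prod_assoc)
    also have "(star u \<bullet> u) \<bullet> (y \<bullet> star u) = ((star u \<bullet> u) \<bullet> y) \<bullet> star u"
      using u that by (simp add: prod_assoc)
    also have "(star u \<bullet> u) \<bullet> y = y \<bullet> (star u \<bullet> u)"
      using u that by (simp add: E_commute)
    also have "(y \<bullet> (star u \<bullet> u)) \<bullet> star u = y \<bullet> star u"
      using u that prod_star_prod[of "star u"] by (simp add: prod_assoc)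
    finally show ?thesis using u that by (simp add: q_def prod_assoc)
  qed
  have q_le: "q x \<preceq> q y" if "x \<in> E" "y \<in> E" "x \<preceq> y" for x y
    using that by (simp add: E_le_def flip: q_prod)
  have cover: "finite_cover (q x) (q ` Z)" if Z: "finite_cover x Z" and x: "x \<in> E" for x Z
    unfolding finite_cover_def
  proof (intro conjI ballI impI)
    show "finite (q ` Z)" "q ` Z \<subseteq> E" using Z q_mem by (auto simp: finite_cover_def)
    show "z \<preceq> q x" if "z \<in> q ` Z" for z
      using that Z x q_le by (auto simp: finite_cover_def)
    fix y assume y: "y \<in> E" "y \<noteq> Zero \<and> y \<preceq> q x"
    \<comment> \<open>Conjugation by \<open>u\<^sup>*\<close> brings \<open>y\<close> below \<open>x\<close>, and \<open>q\<close> brings it back.\<close>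
    define y' where "y' = star u \<bullet> y \<bullet> u"
    have y'E: "y' \<in> E" using conjugate_mem_E[of "star u" y] u y by (simp add: y'_def)
    have "y \<preceq> u \<bullet> star u"
    proof -
      have "y = y \<bullet> q x" using y by (simp add: E_le_def)
      moreover have "q x \<bullet> (u \<bullet> star u) = q x"
        using u x prod_star_prod[of "star u"] by (simp add: q_def prod_assoc)
      ultimately show ?thesis
        unfolding E_le_def using u y(1) x q_mem[OF x] by (metis E_subset_S prod_assoc prod_star_mem_E)
    qed
    then have qy': "q y' = y"
    proof -
      have "q y' = (u \<bullet> star u) \<bullet> (y \<bullet> (u \<bullet> star u))"
        using u y by (simp add: q_def y'_def prod_assoc)
      then show ?thesis
        using u y(1) \<open>y \<preceq> u \<bullet> star u\<close> E_commute[of y "u \<bullet> star u"] by (simp add: E_le_def)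
    qed
    then have "y' \<noteq> Zero" using y by (auto simp: q_def)
    moreover have "y' \<preceq> x"
    proof -
      have "y \<bullet> u = y \<bullet> (u \<bullet> x)"
      proof -
        have "y \<bullet> u = y \<bullet> q x \<bullet> u" using y by (simp add: E_le_def)
        also have "\<dots> = y \<bullet> (u \<bullet> (x \<bullet> (star u \<bullet> u)))"
          using u y(1) x by (simp add: q_def prod_assoc)
        also have "\<dots> = y \<bullet> ((u \<bullet> (star u \<bullet> u)) \<bullet> x)"
          using u y(1) x by (simp add: E_commute[of x "star u \<bullet> u"] prod_assoc)
        also have "u \<bullet> (star u \<bullet> u) = u"
          using u prod_star_prod[of u] by (simp add: prod_assoc)
        finally show ?thesis .
      qed
      from this[symmetric] show ?thesis using u y(1) x by (simp add: E_le_def y'_def prod_assoc)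
    qed
    ultimately obtain z where z: "z \<in> Z" "y' \<bullet> z \<noteq> Zero"
      using Z y'E by (auto simp: finite_cover_def)
    then have zE: "z \<in> E" using Z by (auto simp: finite_cover_def)
    have "star u \<bullet> q (y' \<bullet> z) \<bullet> u = y' \<bullet> z"
    proof -
      have le: "(star u \<bullet> u) \<bullet> y' = y'"
        using u y(1) prod_star_prod[of "star u"] by (simp add: y'_def flip: prod_assoc)
      have "star u \<bullet> q (y' \<bullet> z) \<bullet> u = (star u \<bullet> u) \<bullet> ((y' \<bullet> z) \<bullet> (star u \<bullet> u))"
        using u y'E zE by (simp add: q_def prod_assoc)
      also have "\<dots> = (star u \<bullet> u) \<bullet> ((star u \<bullet> u) \<bullet> (y' \<bullet> z))"
        using u y'E zE by (simp add: E_commute[of "y' \<bullet> z"])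
      also have "\<dots> = ((star u \<bullet> u) \<bullet> ((star u \<bullet> u) \<bullet> y')) \<bullet> z"
        using u y'E zE by (simp add: prod_assoc)
      finally show ?thesis by (simp add: le)
    qed
    then have "q (y' \<bullet> z) \<noteq> Zero" using z by auto
    then show "\<exists>z\<in>q ` Z. y \<bullet> z \<noteq> Zero"
      using z(1) zE y'E q_prod[of y' z] qy' by auto
  qed
  have pull: "pull u \<xi> = {x \<in> E. q x \<in> \<xi>}" by (simp add: pull_def q_def)
  show ?thesis
    unfolding tight_filters_def
  proof (intro CollectI conjI ballI allI impI)
    show "pull u \<xi> \<subseteq> E" by (auto simp: pull)
    have "u \<bullet> (star u \<bullet> u) = u"
      using u prod_star_prod[of u] by (simp add: prod_assoc)
    then have "q (star u \<bullet> u) = u \<bullet> star u" by (simp add: q_def)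
    then show "pull u \<xi> \<noteq> {}" using dom u by (auto simp: pull intro!: exI[of _ "star u \<bullet> u"])
    show "Zero \<notin> pull u \<xi>" using tight_filter_Zero[OF \<xi>] by (simp add: pull q_def)
    show "y \<in> pull u \<xi>" if "x \<in> pull u \<xi>" "y \<in> E" "x \<preceq> y" for x y
      using that tight_filter_upward[OF \<xi>, of "q x" "q y"] q_le[of x y] q_mem by (auto simp: pull)
    show "x \<bullet> y \<in> pull u \<xi>" if "x \<in> pull u \<xi>" "y \<in> pull u \<xi>" for x y
      using that \<xi> by (auto simp: pull q_prod tight_filter_prod_iff q_mem)
    show "Z \<inter> pull u \<xi> \<noteq> {}" if x: "x \<in> pull u \<xi>" and Z: "finite_cover x Z" for x Z
    proof -
      have "x \<in> E" "q x \<in> \<xi>" using x by (auto simp: pull)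
      then obtain z where "z \<in> Z" "q z \<in> \<xi>"
        using tight_filter_cover[OF \<xi> _ cover[OF Z]] by auto
      moreover have "z \<in> E" using \<open>z \<in> Z\<close> Z by (auto simp: finite_cover_def)
      ultimately show ?thesis by (auto simp: pull)
    qed
  qed
qed

end

section \<open>The coefficient algebra and the partial action\<close>

text \<open>Pointwise multiplication of a function by a scalar.\<close>

definition fscale :: "'r::comm_ring \<Rightarrow> ('x \<Rightarrow> 'r) \<Rightarrow> 'x \<Rightarrow> 'r" where
  "fscale r f = (\<lambda>x. r * f x)"

lemma fscale_apply [simp]: "fscale r f x = r * f x"
  by (simp add: fscale_def)

lemma fscale_zero [simp]: "fscale r 0 = 0" "fscale 0 f = 0"
  by (rule ext; simp)+

lemma fscale_add: "fscale r (f + h) = fscale r f + fscale r h"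
  by (rule ext) (simp add: distrib_left)

lemma fscale_add_left: "fscale (r + q) f = fscale r f + fscale q f"
  by (rule ext) (simp add: distrib_right)

lemma fscale_fscale: "fscale r (fscale q f) = fscale (r * q) f"
  by (rule ext) (simp add: mult.assoc)

lemma fscale_one [simp]: "fscale (1 :: 'r::{comm_ring, comm_monoid_mult}) f = f"
  by (rule ext) simp

lemma fscale_mult_left: "fscale r f * h = fscale r (f * h)"
  by (rule ext) (simp add: mult.assoc)

lemma fscale_mult_right: "f * fscale r h = fscale r (f * h)"
  by (rule ext) (simp add: mult.left_commute)

lemmas fun_apply_simps = plus_fun_apply zero_fun_apply times_fun_apply fscale_apply

(* Terms are kept in point-free form below. *)
declare fun_apply_simps [simp del]

context gbds
begin

lemma indicator_Zero [simp]: "indicator Zero = 0"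
  by (rule ext) (auto simp: indicator_def tight_filter_Zero fun_apply_simps)

lemma indicator_prod: "\<lbrakk>x \<in> E; y \<in> E\<rbrakk> \<Longrightarrow> indicator (x \<bullet> y) = indicator x * indicator y"
  by (rule ext) (auto simp: indicator_def tight_filter_prod_iff fun_apply_simps)

subsection \<open>Spans of indicators\<close>

lemma indicator_span_zero: "0 \<in> indicator_span Y"
  unfolding indicator_span_def by (auto intro!: exI[of _ "{}"])

lemma indicator_span_iff:
  "f \<in> indicator_span Y \<longleftrightarrow>
    (\<exists>F c. finite F \<and> F \<subseteq> Y \<and> f = (\<Sum>x\<in>F. fscale (c x) (indicator x)))"
  by (auto simp: indicator_span_def fscale_def)

lemma indicator_span_add:
  assumes "f \<in> indicator_span Y" "h \<in> indicator_span Y"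
  shows "f + h \<in> indicator_span Y"
proof -
  obtain F c where f: "finite F" "F \<subseteq> Y" "f = (\<Sum>x\<in>F. fscale (c x) (indicator x))"
    using assms(1) unfolding indicator_span_iff by blast
  obtain F' c' where h: "finite F'" "F' \<subseteq> Y" "h = (\<Sum>x\<in>F'. fscale (c' x) (indicator x))"
    using assms(2) unfolding indicator_span_iff by blast
  define d where "d x = (if x \<in> F then c x else 0)" for x
  define d' where "d' x = (if x \<in> F' then c' x else 0)" for x
  have "f = (\<Sum>x\<in>F \<union> F'. fscale (d x) (indicator x))"
    unfolding f(3) using f(1) h(1) by (intro sum.mono_neutral_cong_left) (auto simp: d_def)
  moreover have "h = (\<Sum>x\<in>F \<union> F'. fscale (d' x) (indicator x))"
    unfolding h(3) using f(1) h(1) by (intro sum.mono_neutral_cong_left) (auto simp: d'_def)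
  ultimately have "f + h = (\<Sum>x\<in>F \<union> F'. fscale (d x + d' x) (indicator x))"
    by (simp only: fscale_add_left sum.distrib)
  then show ?thesis
    unfolding indicator_span_iff using f(1,2) h(1,2)
    by (intro exI[of _ "F \<union> F'"] exI[of _ "\<lambda>x. d x + d' x"]) simp
qed

lemma scaled_indicator_mem_span: "x \<in> Y \<Longrightarrow> fscale c (indicator x) \<in> indicator_span Y"
  unfolding indicator_span_iff by (intro exI[of _ "{x}"] exI[of _ "\<lambda>_. c"]) auto

lemma indicator_mem_span: "x \<in> Y \<Longrightarrow> indicator x \<in> indicator_span Y"
  using scaled_indicator_mem_span[of x Y 1] by simp

lemma indicator_span_induct [consumes 1, case_names zero add]:
  assumes "f \<in> indicator_span Y"
    and "P 0"
    and step: "\<And>c x f. \<lbrakk>x \<in> Y; f \<in> indicator_span Y; P f\<rbrakk> \<Longrightarrow> P (fscale c (indicator x) + f)"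
  shows "P f"
proof -
  obtain F c where f: "f = (\<Sum>x\<in>F. fscale (c x) (indicator x))" "finite F" "F \<subseteq> Y"
    using assms(1) unfolding indicator_span_iff by blast
  have "P (\<Sum>x\<in>F. fscale (c x) (indicator x)) \<and> (\<Sum>x\<in>F. fscale (c x) (indicator x)) \<in> indicator_span Y"
    using f(2,3)
  proof induction
    case empty
    then show ?case using \<open>P 0\<close> by (simp add: indicator_span_zero)
  next
    case (insert x F)
    then show ?case
      using step indicator_span_add[OF scaled_indicator_mem_span] by auto
  qed
  then show ?thesis using f by simp
qed

lemma indicator_span_smult:
  "f \<in> indicator_span Y \<Longrightarrow> fscale r f \<in> indicator_span Y"
proof (induction rule: indicator_span_induct)
  case zero
  then show ?case by (simp add: indicator_span_zero)
next
  case (add c x f)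
  then show ?case
    using indicator_span_add[OF scaled_indicator_mem_span[of x Y "r * c"] add(3)]
    by (simp add: fscale_add fscale_fscale)
qed

lemma indicator_span_mono: "Y \<subseteq> Z \<Longrightarrow> indicator_span Y \<subseteq> indicator_span Z"
  unfolding indicator_span_def by blast

lemma indicator_span_mult:
  assumes "f \<in> indicator_span (E_grade g)" "h \<in> indicator_span E"
  shows "f * h \<in> indicator_span (E_grade g)"
  using assms(1)
proof (induction rule: indicator_span_induct)
  case zero
  then show ?case by (simp add: indicator_span_zero)
next
  case (add c x f)
  have "fscale c (indicator x) * h \<in> indicator_span (E_grade g)"
    using assms(2)
  proof (induction rule: indicator_span_induct)
    case zero
    then show ?case by (simp add: indicator_span_zero)
  next
    case (add d y h)
    have "fscale (c * d) (indicator (x \<bullet> y)) \<in> indicator_span (E_grade g)"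
      using E_grade_prod[OF \<open>x \<in> E_grade g\<close> \<open>y \<in> E\<close>] by (rule scaled_indicator_mem_span)
    then have "fscale (c * d) (indicator (x \<bullet> y)) + fscale c (indicator x) * h \<in> indicator_span (E_grade g)"
      using add by (intro indicator_span_add)
    moreover have "x \<in> E" using \<open>x \<in> E_grade g\<close> E_grade_subset by blast
    ultimately show ?case
      using \<open>y \<in> E\<close>
      by (simp add: indicator_prod distrib_left fscale_mult_left fscale_mult_right fscale_fscale
          mult.commute[of d c])
  qed
  then show ?case using add by (simp add: distrib_right indicator_span_add)
qed

subsection \<open>The partial action\<close>

text \<open>The tight filters that contain a nonzero member of \<^term>\<open>E_grade g\<close>.\<close>

definition tight_domain :: "('l \<times> bool) list \<Rightarrow> ('l, 'b) triple set set" where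
  "tight_domain g = {\<xi> \<in> tight_filters. \<exists>t\<in>\<S> - {Zero}. grade t = g \<and> t \<bullet> star t \<in> \<xi>}"

text \<open>
  The isomorphism between the ideals of \<open>g\<^sup>-\<^sup>1\<close> and \<open>g\<close>, as a total operation on functions. Its value
  at a filter in \<^term>\<open>tight_domain g\<close> is found by pulling the filter back along some element of grade
  \<open>g\<close>; by \<open>same_grade_conjugate\<close> the choice of that element does not matter.
\<close>

definition transport ::
    "('l \<times> bool) list \<Rightarrow> (('l, 'b) triple set \<Rightarrow> 'r::{comm_ring, comm_monoid_mult})
      \<Rightarrow> ('l, 'b) triple set \<Rightarrow> 'r" where
  "transport g f \<xi> =
     (if \<xi> \<in> tight_domain g
      then f (pull (SOME t. t \<in> \<S> - {Zero} \<and> grade t = g \<and> t \<bullet> star t \<in> \<xi>) \<xi>) else 0)"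

lemma transport_zero [simp]: "transport g 0 = 0"
  by (rule ext) (simp add: transport_def fun_apply_simps)

lemma transport_add: "transport g (f + h) = transport g f + transport g h"
  by (rule ext) (simp add: transport_def fun_apply_simps)

lemma transport_mult: "transport g (f * h) = transport g f * transport g h"
  by (rule ext) (simp add: transport_def fun_apply_simps)

lemma transport_smult: "transport g (fscale r f) = fscale r (transport g f)"
  by (rule ext) (simp add: transport_def fun_apply_simps)

lemma transport_indicator:
  assumes t: "t \<in> \<S>" "t \<noteq> Zero"
  shows "transport (grade t) (indicator (star t \<bullet> t)) =
    (indicator (t \<bullet> star t) :: _ \<Rightarrow> 'r::{comm_ring, comm_monoid_mult})"
proof
  fix \<xi>
  show "transport (grade t) (indicator (star t \<bullet> t)) \<xi> = (indicator (t \<bullet> star t) \<xi> :: 'r)"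
  proof (cases "\<xi> \<in> tight_domain (grade t)")
    case True
    define u where "u = (SOME u. u \<in> \<S> - {Zero} \<and> grade u = grade t \<and> u \<bullet> star u \<in> \<xi>)"
    have u: "u \<in> \<S> - {Zero}" "grade u = grade t" "u \<bullet> star u \<in> \<xi>"
      using someI_ex[of "\<lambda>u. u \<in> \<S> - {Zero} \<and> grade u = grade t \<and> u \<bullet> star u \<in> \<xi>"] True
      unfolding u_def tight_domain_def by blast+
    have \<xi>: "\<xi> \<in> tight_filters" using True by (simp add: tight_domain_def)
    have "pull u \<xi> \<in> tight_filters" using pull_tight u \<xi> by blast
    moreover have "star t \<bullet> t \<in> pull u \<xi> \<longleftrightarrow> t \<bullet> star t \<in> \<xi>"
    proof -
      have "u \<bullet> (star t \<bullet> t) \<bullet> star u = (u \<bullet> star u) \<bullet> (t \<bullet> star t)"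
        using same_grade_conjugate[of u t] t u by simp
      then show ?thesis
        using t u \<xi> by (simp add: pull_def tight_filter_prod_iff star_prod_mem_E prod_star_mem_E)
    qed
    moreover have "transport (grade t) f \<xi> = f (pull u \<xi>)" for f :: "_ \<Rightarrow> 'r"
      using True unfolding transport_def u_def by (rule if_P)
    ultimately show ?thesis
      using \<xi> by (simp add: indicator_def)
  next
    case False
    then show ?thesis using t by (auto simp: transport_def indicator_def tight_domain_def)
  qed
qed

lemma transport_indicator_grade:
  assumes "t \<in> \<S>" "t \<noteq> Zero" "grade t = g"
  shows "transport g (indicator (star t \<bullet> t)) = indicator (t \<bullet> star t)"
    and "transport (inv\<^bsub>\<G>\<^esub> g) (indicator (t \<bullet> star t)) = indicator (star t \<bullet> t)"
  using transport_indicator[OF assms(1,2)] transport_indicator[of "star t"] assms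
  by (simp_all add: grade_star)

lemma D_simps:
  "carrier (D g) = indicator_span (E_grade g)"
  "f \<oplus>\<^bsub>D g\<^esub> h = f + h" "f \<otimes>\<^bsub>D g\<^esub> h = f * h" "r \<odot>\<^bsub>D g\<^esub> f = fscale r f"
  by (simp_all add: D_def fscale_def)

lemma transport_mem_span:
  fixes f :: "_ \<Rightarrow> 'r::{comm_ring, comm_monoid_mult}"
  assumes g: "g \<in> carrier (\<G>)" and "f \<in> indicator_span (E_grade (inv\<^bsub>\<G>\<^esub> g))"
  shows "transport g f \<in> indicator_span (E_grade g)"
  using assms(2)
proof (induction rule: indicator_span_induct)
  case (add c x f)
  have "transport g (indicator x :: _ \<Rightarrow> 'r) \<in> indicator_span (E_grade g)"
  proof (cases "x = Zero")
    case False
    then obtain t where "t \<in> \<S>" "t \<noteq> Zero" "grade t = g" "x = star t \<bullet> t"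
      using add(1) g by (auto simp: E_grade_inv_iff)
    then show ?thesis
      using prod_star_mem_E_grade[of t] by (auto simp: transport_indicator_grade intro: indicator_mem_span)
  qed (simp add: indicator_span_zero)
  then show ?case
    using add(3) by (simp add: transport_add transport_smult indicator_span_add indicator_span_smult)
qed (simp add: indicator_span_zero)

lemma transport_inverse:
  fixes f :: "_ \<Rightarrow> 'r::{comm_ring, comm_monoid_mult}"
  assumes g: "g \<in> carrier (\<G>)" and "f \<in> indicator_span (E_grade (inv\<^bsub>\<G>\<^esub> g))"
  shows "transport (inv\<^bsub>\<G>\<^esub> g) (transport g f) = f"
  using assms(2)
proof (induction rule: indicator_span_induct)
  case (add c x f)
  have "transport (inv\<^bsub>\<G>\<^esub> g) (transport g (indicator x)) = (indicator x :: _ \<Rightarrow> 'r)"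
  proof (cases "x = Zero")
    case False
    then obtain t where t: "t \<in> \<S>" "t \<noteq> Zero" "grade t = g" "x = star t \<bullet> t"
      using add(1) g by (auto simp: E_grade_inv_iff)
    then show ?thesis
      by (simp add: transport_indicator_grade)
  qed simp
  then show ?case using add(3) by (simp add: transport_add transport_smult)
qed simp

text \<open>The isomorphism fixed by a definite description exists, and it is \<^const>\<open>transport\<close>.\<close>

lemma D_iso_eq:
  assumes g: "g \<in> carrier (\<G>)"
  shows "D_iso g = restrict (transport g)
    (indicator_span (E_grade (inv\<^bsub>\<G>\<^esub> g)) :: (_ \<Rightarrow> 'r::{comm_ring, comm_monoid_mult}) set)"
    (is "_ = restrict _ ?X")
  unfolding D_iso_def
proof (rule the_equality)
  let ?h = "restrict (transport g) ?X"
  let ?Y = "indicator_span (E_grade g) :: (_ \<Rightarrow> 'r) set"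
  have ind: "?h (indicator x) = indicator (E_iso g x)" if x: "x \<in> E_grade (inv\<^bsub>\<G>\<^esub> g)" for x
  proof (cases "x = Zero")
    case False
    then obtain t where t: "t \<in> \<S>" "t \<noteq> Zero" "grade t = g" "x = star t \<bullet> t"
      using x g by (auto simp: E_grade_inv_iff)
    have "?h (indicator x) = transport g (indicator x)"
      by (simp add: indicator_mem_span x)
    also have "\<dots> = indicator (E_iso g x)"
      using t E_iso_eq[OF t(1,2)] by (simp add: transport_indicator_grade(1)[OF t(1-3)])
    finally show ?thesis .
  qed (simp add: indicator_span_zero)
  have "bij_betw ?h ?X ?Y"
  proof (rule bij_betw_byWitness[where f' = "transport (inv\<^bsub>\<G>\<^esub> g)"])
    show "\<forall>f\<in>?X. transport (inv\<^bsub>\<G>\<^esub> g) (?h f) = f"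
      by (simp add: transport_inverse g)
    have mem: "transport (inv\<^bsub>\<G>\<^esub> g) f \<in> ?X" if "f \<in> ?Y" for f
      using transport_mem_span[of "inv\<^bsub>\<G>\<^esub> g" f] g that by simp
    show "\<forall>f\<in>?Y. ?h (transport (inv\<^bsub>\<G>\<^esub> g) f) = f"
      using transport_inverse[of "inv\<^bsub>\<G>\<^esub> g", where ?'r = 'r] g mem by simp
    show "?h ` ?X \<subseteq> ?Y" using transport_mem_span[OF g] by auto
    show "transport (inv\<^bsub>\<G>\<^esub> g) ` ?Y \<subseteq> ?X" using mem by blast
  qed
  moreover have "f * h \<in> ?X" if "f \<in> ?X" "h \<in> ?X" for f h
    using indicator_span_mult[OF that(1)] that(2) indicator_span_mono[OF E_grade_subset] by blast
  ultimately have "?h \<in> algebra_iso (D (inv\<^bsub>\<G>\<^esub> g)) (D g)"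
    by (simp add: algebra_iso_def D_simps indicator_span_add indicator_span_smult
        transport_add transport_mult transport_smult)
  then show "?h \<in> algebra_iso (D (inv\<^bsub>\<G>\<^esub> g)) (D g) \<and>
      ?h \<in> extensional (carrier (D (inv\<^bsub>\<G>\<^esub> g))) \<and>
      (\<forall>x\<in>E_grade (inv\<^bsub>\<G>\<^esub> g). ?h (indicator x) = indicator (E_iso g x))"
    using ind by (auto simp: D_simps(1))
next
  fix h :: "(('l, 'b) triple set \<Rightarrow> 'r) \<Rightarrow> (('l, 'b) triple set \<Rightarrow> 'r)"
  assume h: "h \<in> algebra_iso (D (inv\<^bsub>\<G>\<^esub> g)) (D g) \<and>
      h \<in> extensional (carrier (D (inv\<^bsub>\<G>\<^esub> g))) \<and>
      (\<forall>x\<in>E_grade (inv\<^bsub>\<G>\<^esub> g). h (indicator x) = indicator (E_iso g x))"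
  have h_add: "h (f + f') = h f + h f'" and h_smult: "h (fscale r f) = fscale r (h f)"
    if "f \<in> ?X" "f' \<in> ?X" for f f' r
    using h that by (auto simp: algebra_iso_def D_simps)
  have ind: "h (indicator x) = transport g (indicator x)" if x: "x \<in> E_grade (inv\<^bsub>\<G>\<^esub> g)" for x
  proof (cases "x = Zero")
    case True
    have "h 0 = 0"
      using h_smult[of 0 0 0] by (simp add: indicator_span_zero)
    then show ?thesis using True by simp
  next
    case False
    then obtain t where t: "t \<in> \<S>" "t \<noteq> Zero" "grade t = g" "x = star t \<bullet> t"
      using x g by (auto simp: E_grade_inv_iff)
    have "h (indicator x) = indicator (E_iso g x)" using h x by blast
    also have "\<dots> = transport g (indicator x)"
      using t E_iso_eq[OF t(1,2)] by (simp add: transport_indicator_grade(1)[OF t(1-3)])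
    finally show ?thesis .
  qed
  have "h f = transport g f" if "f \<in> ?X" for f
    using that
  proof (induction rule: indicator_span_induct)
    case zero
    then show ?case
      using h_smult[of 0 0 0] by (simp add: indicator_span_zero)
  next
    case (add c x f)
    then show ?case
      using ind
      by (simp add: h_add h_smult scaled_indicator_mem_span indicator_mem_span transport_add transport_smult)
  qed
  then show "h = restrict (transport g) ?X"
    using h by (auto simp: D_simps(1) extensional_def fun_eq_iff)
qed

end

section \<open>The partial skew group ring\<close>

text \<open>Scalar multiplication on formal sums of functions.\<close>

definition lscale ::
    "'r::comm_ring \<Rightarrow> ('g \<Rightarrow>\<^sub>0 ('x \<Rightarrow> 'r)) \<Rightarrow> ('g \<Rightarrow>\<^sub>0 ('x \<Rightarrow> 'r))" where
  "lscale r = Poly_Mapping.map (fscale r)"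

lemma lookup_lscale [simp]: "Poly_Mapping.lookup (lscale r x) g = fscale r (Poly_Mapping.lookup x g)"
  by (simp add: lscale_def lookup_map_zero)

lemma lscale_zero [simp]: "lscale r 0 = 0"
  by (rule poly_mapping_eqI) simp

lemma lscale_add: "lscale r (x + y) = lscale r x + lscale r y"
  by (rule poly_mapping_eqI) (simp add: lookup_add fscale_add)

lemma lscale_add_left: "lscale (r + q) x = lscale r x + lscale q x"
  by (rule poly_mapping_eqI) (simp add: lookup_add fscale_add_left)

lemma lscale_lscale: "lscale r (lscale q x) = lscale (r * q) x"
  by (rule poly_mapping_eqI) (simp add: fscale_fscale)

lemma lscale_one [simp]: "lscale (1 :: 'r::{comm_ring, comm_monoid_mult}) x = x"
  by (rule poly_mapping_eqI) simp

lemma lscale_single: "lscale r (Poly_Mapping.single g f) = Poly_Mapping.single g (fscale r f)"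
  by (rule poly_mapping_eqI) (simp add: lookup_single when_def)

lemma lscale_0 [simp]: "lscale 0 x = 0"
  by (rule poly_mapping_eqI) simp

context gbds
begin

subsection \<open>The multiplication\<close>

lemma carrier_skew_group_ring:
  "x \<in> carrier skew_group_ring \<longleftrightarrow>
    (\<forall>g\<in>Poly_Mapping.keys x. g \<in> carrier (\<G>) \<and>
      Poly_Mapping.lookup x g \<in> indicator_span (E_grade g))"
  by (simp add: skew_group_ring_def D_simps)

text \<open>
  The multiplication with the isomorphisms of the partial action replaced by their total versions.
  It is biadditive without side conditions and agrees with \<^const>\<open>skew_mult\<close> on the carrier.
\<close>

definition skew_ext ::
    "(('l \<times> bool) list \<Rightarrow>\<^sub>0 (('l, 'b) triple set \<Rightarrow> 'r::{comm_ring, comm_monoid_mult}))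
      \<Rightarrow> (('l \<times> bool) list \<Rightarrow>\<^sub>0 (('l, 'b) triple set \<Rightarrow> 'r))
      \<Rightarrow> (('l \<times> bool) list \<Rightarrow>\<^sub>0 (('l, 'b) triple set \<Rightarrow> 'r))" where
  "skew_ext x y = lin_ext (\<lambda>g f. lin_ext (\<lambda>k h.
     Poly_Mapping.single (g \<otimes>\<^bsub>\<G>\<^esub> k)
       (transport g (transport (inv\<^bsub>\<G>\<^esub> g) f * h))) y) x"

lemma skew_mult_eq_skew_ext:
  assumes "x \<in> carrier skew_group_ring" "y \<in> carrier skew_group_ring"
  shows "skew_mult x y = skew_ext x y"
  unfolding skew_mult_def skew_ext_def lin_ext_def
proof (intro sum.cong refl)
  fix g k assume "g \<in> Poly_Mapping.keys x" "k \<in> Poly_Mapping.keys y"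
  then have g: "g \<in> carrier (\<G>)" "Poly_Mapping.lookup x g \<in> indicator_span (E_grade g)"
    and k: "Poly_Mapping.lookup y k \<in> indicator_span (E_grade k)"
    using assms by (auto simp: carrier_skew_group_ring)
  let ?f = "transport (inv\<^bsub>\<G>\<^esub> g) (Poly_Mapping.lookup x g)"
  have "?f \<in> indicator_span (E_grade (inv\<^bsub>\<G>\<^esub> g))"
    using g by (intro transport_mem_span) auto
  then have "?f * Poly_Mapping.lookup y k \<in> indicator_span (E_grade (inv\<^bsub>\<G>\<^esub> g))"
    using k indicator_span_mono[OF E_grade_subset] by (intro indicator_span_mult) auto
  then show "Poly_Mapping.single (g \<otimes>\<^bsub>\<G>\<^esub> k) (D_iso g (D_iso (inv\<^bsub>\<G>\<^esub> g)
        (Poly_Mapping.lookup x g) * Poly_Mapping.lookup y k)) =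
      Poly_Mapping.single (g \<otimes>\<^bsub>\<G>\<^esub> k) (transport g (?f * Poly_Mapping.lookup y k))"
    using g by (simp add: D_iso_eq)
qed

lemma skew_ext_zero [simp]: "skew_ext 0 y = 0" "skew_ext x 0 = 0"
  by (simp_all add: skew_ext_def lin_ext_def)

lemma skew_ext_add_left: "skew_ext (x + y) z = skew_ext x z + skew_ext y z"
  unfolding skew_ext_def
  by (rule lin_ext_add) (simp add: distrib_right transport_add single_add lin_ext_add_fun)

lemma skew_ext_add_right: "skew_ext z (x + y) = skew_ext z x + skew_ext z y"
  unfolding skew_ext_def
  by (subst lin_ext_add) (auto simp: distrib_left transport_add single_add lin_ext_add_fun)

lemma skew_ext_single:
  "skew_ext (Poly_Mapping.single g f) (Poly_Mapping.single k h) =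
    Poly_Mapping.single (g \<otimes>\<^bsub>\<G>\<^esub> k) (transport g (transport (inv\<^bsub>\<G>\<^esub> g) f * h))"
  unfolding skew_ext_def
  by (subst lin_ext_single, simp add: lin_ext_def, subst lin_ext_single) simp_all

lemma lscale_skew_ext_left: "skew_ext (lscale r x) y = lscale r (skew_ext x y)"
proof (induction x rule: poly_mapping_additive_induct)
  case (single g)
  show ?case
    by (induction y rule: poly_mapping_additive_induct)
      (auto simp: lscale_single skew_ext_single transport_smult fscale_mult_left
        lscale_add skew_ext_add_right)
qed (auto simp: lscale_add skew_ext_add_left)

lemma lscale_skew_ext_right: "skew_ext x (lscale r y) = lscale r (skew_ext x y)"
proof (induction x rule: poly_mapping_additive_induct)
  case (single g)
  show ?case
    by (induction y rule: poly_mapping_additive_induct)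
      (auto simp: lscale_single skew_ext_single transport_smult fscale_mult_right
        lscale_add skew_ext_add_right)
qed (auto simp: lscale_add skew_ext_add_left)

lemma skew_group_ring_simps:
  "\<zero>\<^bsub>skew_group_ring\<^esub> = 0" "x \<oplus>\<^bsub>skew_group_ring\<^esub> y = x + y"
  "x \<otimes>\<^bsub>skew_group_ring\<^esub> y = skew_mult x y" "r \<odot>\<^bsub>skew_group_ring\<^esub> x = lscale r x"
  by (simp_all add: skew_group_ring_def lscale_def fscale_def[abs_def])

subsection \<open>The spanning set given by the inverse semigroup\<close>

text \<open>
  The image \<open>tt\<^sup>* \<delta>\<close> of a semigroup element \<open>t\<close>, with \<open>\<delta>\<close> at the grade of \<open>t\<close>. The grade of the zero
  is unspecified, hence the case distinction.
\<close>

definition basis ::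
    "('l, 'b) triple \<Rightarrow> ('l \<times> bool) list \<Rightarrow>\<^sub>0 (('l, 'b) triple set \<Rightarrow> 'r::{comm_ring, comm_monoid_mult})" where
  "basis t = (if t = Zero then 0 else Poly_Mapping.single (grade t) (indicator (t \<bullet> star t)))"

lemma basis_Zero [simp]: "basis Zero = 0"
  by (simp add: basis_def)

lemma basis_mult:
  assumes t: "t \<in> \<S>" and u: "u \<in> \<S>"
  shows "skew_ext (basis t) (basis u) =
    (basis (t \<bullet> u) :: _ \<Rightarrow>\<^sub>0 (_ \<Rightarrow> 'r::{comm_ring, comm_monoid_mult}))"
proof (cases "t = Zero \<or> u = Zero")
  case False
  then have tz: "t \<noteq> Zero" by simp
  let ?g = "grade t" and ?r = "t \<bullet> (u \<bullet> star u)"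
  have S: "?r \<in> \<S>" using t u by auto
  have E: "star t \<bullet> t \<in> E" "u \<bullet> star u \<in> E" using t u by auto
  have eq1: "star ?r \<bullet> ?r = (star t \<bullet> t) \<bullet> (u \<bullet> star u)"
  proof -
    have "star ?r \<bullet> ?r = (u \<bullet> star u) \<bullet> ((star t \<bullet> t) \<bullet> (u \<bullet> star u))"
      using t u by (simp add: star_prod prod_assoc)
    also have "\<dots> = (star t \<bullet> t) \<bullet> ((u \<bullet> star u) \<bullet> (u \<bullet> star u))"
      using E by (rule E_left_commute[rotated]) (use E in auto)
    finally show ?thesis using E by (simp only: E_idem)
  qed
  have eq2: "?r \<bullet> star ?r = (t \<bullet> u) \<bullet> star (t \<bullet> u)"
  proof -
    have "?r \<bullet> star ?r = t \<bullet> ((u \<bullet> star u) \<bullet> (u \<bullet> star u)) \<bullet> star t"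
      using t u by (simp add: star_prod prod_assoc)
    also have "(u \<bullet> star u) \<bullet> (u \<bullet> star u) = u \<bullet> star u" using E by (simp only: E_idem)
    finally show ?thesis using t u by (simp add: star_prod prod_assoc)
  qed
  have "skew_ext (basis t) (basis u) = Poly_Mapping.single (?g \<otimes>\<^bsub>\<G>\<^esub> grade u)
      (transport ?g (transport (inv\<^bsub>\<G>\<^esub> ?g) (indicator (t \<bullet> star t)) *
        (indicator (u \<bullet> star u) :: _ \<Rightarrow> 'r)))"
    using False by (simp add: basis_def skew_ext_single)
  also have "transport (inv\<^bsub>\<G>\<^esub> ?g) (indicator (t \<bullet> star t)) * (indicator (u \<bullet> star u) :: _ \<Rightarrow> 'r)
      = indicator (star ?r \<bullet> ?r)"
    by (simp only: eq1 transport_indicator_grade(2)[OF t tz refl] indicator_prod[OF E])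
  also have "transport ?g (indicator (star ?r \<bullet> ?r)) = (indicator ((t \<bullet> u) \<bullet> star (t \<bullet> u)) :: _ \<Rightarrow> 'r)"
  proof (cases "?r = Zero")
    case True
    then have "(t \<bullet> u) \<bullet> star (t \<bullet> u) = Zero" by (simp flip: eq2)
    then show ?thesis using True by simp
  next
    case r: False
    have "u \<bullet> star u \<noteq> Zero" using False u by simp
    then have "grade ?r = ?g"
      using r t u False E by (simp add: grade_prod grade_E grade_closed)
    then show ?thesis by (simp only: transport_indicator_grade(1)[OF S r] eq2)
  qed
  finally have "skew_ext (basis t) (basis u) = Poly_Mapping.single (?g \<otimes>\<^bsub>\<G>\<^esub> grade u)
      (indicator ((t \<bullet> u) \<bullet> star (t \<bullet> u)) :: _ \<Rightarrow> 'r)" .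
  then show ?thesis
    using t u grade_prod[of t u] by (cases "t \<bullet> u = Zero") (simp_all add: basis_def)
qed auto

lemma skew_group_ring_zero_mem: "0 \<in> carrier skew_group_ring"
  by (simp add: carrier_skew_group_ring)

lemma skew_group_ring_add_mem:
  "\<lbrakk>x \<in> carrier skew_group_ring; y \<in> carrier skew_group_ring\<rbrakk> \<Longrightarrow> x + y \<in> carrier skew_group_ring"
proof -
  assume *: "x \<in> carrier skew_group_ring" "y \<in> carrier skew_group_ring"
  have "Poly_Mapping.lookup z g \<in> indicator_span (E_grade g)" if "z \<in> {x, y}" for z g
    using that * indicator_span_zero[of "E_grade g"]
    by (cases "g \<in> Poly_Mapping.keys z") (auto simp: carrier_skew_group_ring in_keys_iff)
  then show ?thesis
    using * keys_add[of x y]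
    by (auto simp: carrier_skew_group_ring lookup_add indicator_span_add subset_iff Un_iff)
qed

lemma skew_group_ring_lscale_mem:
  "x \<in> carrier skew_group_ring \<Longrightarrow> lscale r x \<in> carrier skew_group_ring"
  unfolding carrier_skew_group_ring lookup_lscale
  using keys_map_subset[of "fscale r" x] by (auto simp: indicator_span_smult lscale_def)

lemma basis_mem: "t \<in> \<S> \<Longrightarrow> basis t \<in> carrier skew_group_ring"
  by (auto simp: basis_def carrier_skew_group_ring grade_closed prod_star_mem_E_grade
      indicator_mem_span lookup_single split: if_splits)

lemma skew_group_ring_induct [consumes 1, case_names zero basis add]:
  fixes x :: "('l \<times> bool) list \<Rightarrow>\<^sub>0 (('l, 'b) triple set \<Rightarrow> 'r::{comm_ring, comm_monoid_mult})"
  assumes x: "x \<in> carrier skew_group_ring"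
    and P0: "P 0"
    and basis: "\<And>c t. t \<in> \<S> \<Longrightarrow> P (lscale c (basis t))"
    and add: "\<And>y z. P y \<Longrightarrow> P z \<Longrightarrow> P (y + z)"
  shows "P x"
proof (induction x rule: poly_mapping_additive_induct)
  case (single g)
  then have "Poly_Mapping.lookup x g \<in> indicator_span (E_grade g)"
    using x by (simp add: carrier_skew_group_ring)
  then show ?case
  proof (induction rule: indicator_span_induct)
    case (add c e f)
    have "P (Poly_Mapping.single g (fscale c (indicator e)))"
    proof (cases "e = Zero")
      case False
      then obtain t where "t \<in> \<S>" "t \<noteq> Zero" "grade t = g" "e = t \<bullet> star t"
        using add(1) by (auto simp: E_grade_iff)
      then show ?thesis using basis[of t c] by (simp add: basis_def lscale_single)
    qed (simp add: P0)
    then show ?case using assms(4) add(3) by (simp add: single_add)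
  qed (simp add: P0)
qed (auto intro: assms)

lemma skew_ext_mem:
  assumes "x \<in> carrier skew_group_ring" "y \<in> carrier skew_group_ring"
  shows "skew_ext x y \<in> carrier skew_group_ring"
  using assms(1)
proof (induction rule: skew_group_ring_induct)
  case (basis c t)
  show ?case
    using assms(2)
  proof (induction rule: skew_group_ring_induct)
    case (basis d u)
    then show ?case using \<open>t \<in> \<S>\<close>
      by (simp add: lscale_skew_ext_left lscale_skew_ext_right basis_mult
          skew_group_ring_lscale_mem basis_mem)
  qed (auto simp: skew_ext_add_right skew_group_ring_add_mem skew_group_ring_zero_mem)
qed (auto simp: skew_ext_add_left skew_group_ring_add_mem skew_group_ring_zero_mem)

lemma skew_ext_assoc:
  assumes "x \<in> carrier skew_group_ring" "y \<in> carrier skew_group_ring" "z \<in> carrier skew_group_ring"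
  shows "skew_ext (skew_ext x y) z = skew_ext x (skew_ext y z)"
  using assms(1)
proof (induction rule: skew_group_ring_induct)
  case (basis c t)
  show ?case
    using assms(2)
  proof (induction rule: skew_group_ring_induct)
    case (basis d u)
    show ?case
      using assms(3)
    proof (induction rule: skew_group_ring_induct)
      case (basis e v)
      show ?case
        using basis \<open>t \<in> \<S>\<close> \<open>u \<in> \<S>\<close>
        by (simp add: lscale_skew_ext_left lscale_skew_ext_right basis_mult prod_assoc)
    qed (auto simp: skew_ext_add_right)
  qed (auto simp: skew_ext_add_left skew_ext_add_right)
qed (auto simp: skew_ext_add_left)

theorem nonunital_algebra_skew_group_ring:
  "nonunital_algebra (skew_group_ring :: ('r::{comm_ring, comm_monoid_mult}, _) module)"
proof -
  let ?LS = "skew_group_ring :: ('r, _) module"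
  interpret abelian_group ?LS
  proof (rule abelian_groupI, goal_cases)
    \<comment> \<open>additive inverses\<close>
    case (6 x)
    have "lscale (- 1) x + lscale 1 x = lscale (- 1 + 1) x" by (simp only: lscale_add_left)
    then have "lscale (- 1) x + x = 0"
      by (simp add: poly_mapping_eq_iff fun_eq_iff)
    then show ?case using 6
      by (intro bexI[of _ "lscale (- 1) x"]) (simp_all add: skew_group_ring_simps skew_group_ring_lscale_mem)
  qed (simp_all add: skew_group_ring_simps skew_group_ring_add_mem skew_group_ring_zero_mem ac_simps)
  show ?thesis
    by unfold_locales
      (simp_all add: skew_group_ring_simps skew_mult_eq_skew_ext skew_ext_mem skew_ext_assoc
        skew_group_ring_add_mem skew_group_ring_lscale_mem skew_ext_add_left skew_ext_add_right
        lscale_add lscale_add_left lscale_lscale lscale_skew_ext_left lscale_skew_ext_right)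
qed

end

section \<open>The homomorphism from the free algebra\<close>

context gbds
begin

text \<open>The values of the generators in the inverse semigroup.\<close>

fun generator_triple :: "('l, 'b) generator \<Rightarrow> ('l, 'b) triple" where
  "generator_triple (Gen_p A) = triple [] A []"
| "generator_triple (Gen_s a A) = triple [a] A []"
| "generator_triple (Gen_s_star a A) = triple [] A [a]"

text \<open>The value of a nonempty word over the generators in the inverse semigroup; the empty word is a dummy case.\<close>

fun word_triple :: "('l, 'b) generator list \<Rightarrow> ('l, 'b) triple" where
  "word_triple [] = Zero"
| "word_triple [x] = generator_triple x"
| "word_triple (x # y # w) = generator_triple x \<bullet> word_triple (y # w)"

lemma word_triple_Cons: "w \<noteq> [] \<Longrightarrow> word_triple (x # w) = generator_triple x \<bullet> word_triple w"
  by (cases w) auto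

lemma generator_triple_mem: "x \<in> generators \<Longrightarrow> generator_triple x \<in> \<S>"
  by (auto simp: generators_def \<I>_word_singleton simp del: \<I>_word.simps(2) intro!: triple_mem_S)

lemma word_triple_mem: "set w \<subseteq> generators \<Longrightarrow> word_triple w \<in> \<S>"
  by (induction w rule: word_triple.induct) (auto simp: generator_triple_mem)

lemma word_triple_append:
  "\<lbrakk>set u \<subseteq> generators; set v \<subseteq> generators; u \<noteq> []; v \<noteq> []\<rbrakk> \<Longrightarrow>
    word_triple (u @ v) = word_triple u \<bullet> word_triple v"
proof (induction u)
  case (Cons x u)
  then show ?case
    by (cases "u = []") (auto simp: word_triple_Cons generator_triple_mem word_triple_mem prod_assoc)
qed simp

text \<open>The homomorphism from the free algebra that sends a word to the image of its value.\<close>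

definition rep ::
    "(('l, 'b) generator list \<Rightarrow>\<^sub>0 'r::{comm_ring, comm_monoid_mult})
      \<Rightarrow> ('l \<times> bool) list \<Rightarrow>\<^sub>0 (('l, 'b) triple set \<Rightarrow> 'r)" where
  "rep = lin_ext (\<lambda>w c. lscale c (basis (word_triple w)))"

lemma rep_zero [simp]: "rep 0 = 0"
  by (simp add: rep_def)

lemma rep_add: "rep (x + y) = rep x + rep y"
  unfolding rep_def by (rule lin_ext_add) (rule lscale_add_left)

lemma rep_minus: "rep (x - y) = rep x - rep y"
  using rep_add[of "x - y" y] by simp

lemma rep_sum: "rep (\<Sum>i\<in>I. x i) = (\<Sum>i\<in>I. rep (x i))"
  by (induction I rule: infinite_finite_induct) (auto simp: rep_add)

lemma rep_single: "rep (Poly_Mapping.single w c) = lscale c (basis (word_triple w))"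
  unfolding rep_def by (rule lin_ext_single) simp

lemma rep_scale: "rep (scale r x) = lscale r (rep x)"
  by (induction x rule: poly_mapping_additive_induct)
    (auto simp: scale_add rep_add lscale_add scale_single rep_single lscale_lscale)

lemma rep_mult:
  assumes "x \<in> carrier (free_algebra generators)" "y \<in> carrier (free_algebra generators)"
  shows "rep (x \<star> y) = skew_ext (rep x) (rep y)"
proof (induction x rule: poly_mapping_additive_induct)
  case u: (single u)
  show ?case
  proof (induction y rule: poly_mapping_additive_induct)
    case v: (single v)
    have "u \<noteq> []" "set u \<subseteq> generators" "v \<noteq> []" "set v \<subseteq> generators"
      using u v assms by (auto simp: mem_carrier_free_algebra)
    then show ?case
      by (simp add: rep_single word_triple_append word_triple_mem basis_mult lscale_lscale
          lscale_skew_ext_left lscale_skew_ext_right mult.commute[of "Poly_Mapping.lookup y v"])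
  qed (auto simp: free_mult_add_right rep_add skew_ext_add_right)
qed (auto simp: free_mult_add_left rep_add skew_ext_add_left)

lemma rep_mem:
  assumes "x \<in> carrier (free_algebra generators)"
  shows "rep x \<in> carrier skew_group_ring"
proof (induction x rule: poly_mapping_additive_induct)
  case (single w)
  then have "set w \<subseteq> generators" using assms by (auto simp: mem_carrier_free_algebra)
  then show ?case
    by (simp add: rep_single word_triple_mem basis_mem skew_group_ring_lscale_mem)
qed (auto simp: rep_add skew_group_ring_zero_mem skew_group_ring_add_mem)

subsection \<open>The relations hold in the partial skew group ring\<close>

lemma basis_E: "e \<in> E \<Longrightarrow> basis e = Poly_Mapping.single \<one>\<^bsub>\<G>\<^esub> (indicator e)"
  by (auto simp: basis_def grade_E E_star E_idem)

lemma finite_cover_sup: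
  "finite_cover (triple [] (sup A A') []) {triple [] A [], triple [] A' []}"
  unfolding finite_cover_def
proof (intro conjI ballI impI)
  show "{triple [] A [], triple [] A' []} \<subseteq> E" by (auto intro: triple_mem_E)
  show "z \<preceq> triple [] (sup A A') []" if "z \<in> {triple [] A [], triple [] A' []}" for z
    using that by (auto simp: E_le_def prod_same inf.absorb1)
  fix y assume y: "y \<in> E" "y \<noteq> Zero \<and> y \<preceq> triple [] (sup A A') []"
  obtain \<gamma> C where y': "y = triple \<gamma> C \<gamma>" "\<gamma> \<in> lists \<L>" using y(1) by (rule E_cases)
  then have C: "C \<noteq> bot" "C \<le> \<theta>_word \<gamma> (sup A A')"
    using y E_le_triple_iff[of "[]" \<gamma> C] by auto
  have prod: "y \<bullet> triple [] B [] = triple \<gamma> (inf C (\<theta>_word \<gamma> B)) \<gamma>" for B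
    using prod_left[of \<gamma> \<gamma> C "[]" B "[]"] y' by simp
  have "C = sup (inf C (\<theta>_word \<gamma> A)) (inf C (\<theta>_word \<gamma> A'))"
    using C y' by (simp add: \<theta>_word_simps inf.absorb1 flip: inf_sup_distrib1)
  then have "inf C (\<theta>_word \<gamma> A) \<noteq> bot \<or> inf C (\<theta>_word \<gamma> A') \<noteq> bot" using C by auto
  then show "\<exists>z\<in>{triple [] A [], triple [] A' []}. y \<bullet> z \<noteq> Zero" by (simp add: prod)
qed simp

lemma indicator_sup:
  "indicator (triple [] (sup A A') []) =
    (indicator (triple [] A []) + indicator (triple [] A' []) - indicator (triple [] (inf A A') [])
      :: _ \<Rightarrow> 'r::{comm_ring, comm_monoid_mult})"
proof
  fix \<xi>
  have E: "triple [] B [] \<in> E" for B by (intro triple_mem_E) auto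
  have inf: "triple [] (inf A A') [] = triple [] A [] \<bullet> triple [] A' []" by (simp add: prod_same)
  have sup: "triple [] (sup A A') [] \<in> \<xi> \<longleftrightarrow> triple [] A [] \<in> \<xi> \<or> triple [] A' [] \<in> \<xi>"
    if \<xi>: "\<xi> \<in> tight_filters"
  proof
    show "triple [] A [] \<in> \<xi> \<or> triple [] A' [] \<in> \<xi>" if "triple [] (sup A A') [] \<in> \<xi>"
      using tight_filter_cover[OF \<xi> that finite_cover_sup] by auto
    have "triple [] A [] \<preceq> triple [] (sup A A') []" "triple [] A' [] \<preceq> triple [] (sup A A') []"
      by (auto simp: E_le_def prod_same inf.absorb1)
    then show "triple [] (sup A A') [] \<in> \<xi>" if "triple [] A [] \<in> \<xi> \<or> triple [] A' [] \<in> \<xi>"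
      using that tight_filter_upward[OF \<xi> _ E] by blast
  qed
  show "indicator (triple [] (sup A A') []) \<xi> =
    (indicator (triple [] A []) + indicator (triple [] A' []) - indicator (triple [] (inf A A') [])
      :: _ \<Rightarrow> 'r) \<xi>"
    using sup by (auto simp: indicator_def inf tight_filter_prod_iff E fun_apply_simps)
qed

lemma \<Delta>_finite: "A \<in> regular \<Longrightarrow> finite (\<Delta> A)"
proof (cases "A = bot")
  case True
  then have "\<Delta> A = {}" by (auto simp: \<Delta>_def \<theta>_simps)
  then show ?thesis by simp
qed (auto simp: regular_def)

lemma triple_mem_E_\<Delta>: "a \<in> \<Delta> A \<Longrightarrow> triple [a] (\<theta> a A) [a] \<in> E"
  using range_mem_ideal[OF _ order.refl]
  by (auto simp: \<Delta>_def \<I>_word_singleton simp del: \<I>_word.simps(2) intro!: triple_mem_E)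

lemma triple_le_\<Delta>: "a \<in> \<Delta> A \<Longrightarrow> triple [a] (\<theta> a A) [a] \<preceq> triple [] A []"
  using E_le_triple_iff[of "[]" "[a]" "\<theta> a A" A] by (auto simp: \<Delta>_def)

lemma finite_cover_regular:
  assumes A: "A \<in> regular"
  shows "finite_cover (triple [] A []) ((\<lambda>a. triple [a] (\<theta> a A) [a]) ` \<Delta> A)"
  unfolding finite_cover_def
proof (intro conjI ballI impI)
  show "finite ((\<lambda>a. triple [a] (\<theta> a A) [a]) ` \<Delta> A)" using \<Delta>_finite[OF A] by simp
  show "(\<lambda>a. triple [a] (\<theta> a A) [a]) ` \<Delta> A \<subseteq> E" using triple_mem_E_\<Delta> by blast
  show "z \<preceq> triple [] A []" if "z \<in> (\<lambda>a. triple [a] (\<theta> a A) [a]) ` \<Delta> A" for z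
    using that triple_le_\<Delta> by blast
  fix y assume y: "y \<in> E" "y \<noteq> Zero \<and> y \<preceq> triple [] A []"
  obtain \<gamma> C where y': "y = triple \<gamma> C \<gamma>" "\<gamma> \<in> lists \<L>" using y(1) by (rule E_cases)
  then have C: "C \<noteq> bot" "C \<le> \<theta>_word \<gamma> A"
    using y E_le_triple_iff[of "[]" \<gamma> C] by auto
  have "\<exists>a\<in>\<Delta> A. y \<bullet> triple [a] (\<theta> a A) [a] \<noteq> Zero"
  proof (cases \<gamma>)
    case Nil
    then have "C \<le> A" using C by simp
    then obtain a where a: "a \<in> \<Delta> C" using A C unfolding regular_def by blast
    then have a': "a \<in> \<L>" "\<theta> a C \<noteq> bot" by (auto simp: \<Delta>_def)
    have "\<theta> a C \<le> \<theta> a A" using \<open>C \<le> A\<close> \<theta>_word_mono[of "[a]" C A] a' by simp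
    then have "a \<in> \<Delta> A" using a' by (auto simp: \<Delta>_def) (metis bot.extremum_uniqueI)
    moreover have "y \<bullet> triple [a] (\<theta> a A) [a] = triple [a] (inf (\<theta> a C) (\<theta> a A)) [a]"
      using prod_right[of "[a]" "[]" C "[]"] a' Nil y' by simp
    ultimately show ?thesis
      using a' \<open>\<theta> a C \<le> \<theta> a A\<close> by (intro bexI[of _ a]) (auto simp: inf.absorb1)
  next
    case (Cons a \<gamma>')
    have *: "a \<in> \<L>" "\<gamma>' \<in> lists \<L>" using Cons y' by auto
    have le: "C \<le> \<theta>_word \<gamma>' (\<theta> a A)" using C Cons by simp
    have "\<theta> a A \<noteq> bot"
    proof
      assume "\<theta> a A = bot"
      then have "C \<le> bot" using le * by (simp add: \<theta>_word_simps)
      then show False using C by (simp add: bot.extremum_unique)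
    qed
    then have "a \<in> \<Delta> A" using * by (simp add: \<Delta>_def)
    moreover have "y \<bullet> triple [a] (\<theta> a A) [a] = triple \<gamma> C \<gamma>"
      using prod_left[of \<gamma>' \<gamma> C "[a]" "\<theta> a A" "[a]"] * Cons y' le by (simp add: inf.absorb1)
    ultimately show ?thesis using C by (intro bexI[of _ a]) auto
  qed
  then show "\<exists>z\<in>(\<lambda>a. triple [a] (\<theta> a A) [a]) ` \<Delta> A. y \<bullet> z \<noteq> Zero" by blast
qed

lemma indicator_regular:
  assumes A: "A \<in> regular"
  shows "indicator (triple [] A []) =
    (\<Sum>a\<in>\<Delta> A. indicator (triple [a] (\<theta> a A) [a]) :: _ \<Rightarrow> 'r::{comm_ring, comm_monoid_mult})"
proof
  fix \<xi>
  let ?e = "\<lambda>a. triple [a] (\<theta> a A) [a]"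
  have sum_apply: "(\<Sum>a\<in>K. f a) \<xi> = (\<Sum>a\<in>K. f a \<xi>)"
    for K :: "'l set" and f :: "'l \<Rightarrow> ('l, 'b) triple set \<Rightarrow> 'r"
    by (induction K rule: infinite_finite_induct) (auto simp: fun_apply_simps)
  have E: "triple [] A [] \<in> E" by (intro triple_mem_E) auto
  have "indicator (triple [] A []) \<xi> = (\<Sum>a\<in>\<Delta> A. indicator (?e a) \<xi> :: 'r)"
  proof (cases "\<xi> \<in> tight_filters \<and> triple [] A [] \<in> \<xi>")
    case True
    then obtain a where a: "a \<in> \<Delta> A" "?e a \<in> \<xi>"
      using tight_filter_cover[OF _ _ finite_cover_regular[OF A]] by blast
    have "?e b \<notin> \<xi>" if "b \<in> \<Delta> A" "b \<noteq> a" for b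
    proof
      assume "?e b \<in> \<xi>"
      then have "?e b \<bullet> ?e a \<in> \<xi>"
        using a that True triple_mem_E_\<Delta> by (simp add: tight_filter_prod_iff)
      moreover have "?e b \<bullet> ?e a = Zero" using that by (intro prod_parallel) (auto simp: parallel_def)
      ultimately show False using True tight_filter_Zero by auto
    qed
    then have "(\<Sum>b\<in>\<Delta> A. indicator (?e b) \<xi> :: 'r) = (\<Sum>b\<in>\<Delta> A. if b = a then 1 else 0)"
      using True a by (intro sum.cong) (auto simp: indicator_def)
    then show ?thesis using True a \<Delta>_finite[OF A] by (simp add: indicator_def)
  next
    case False
    then have "indicator (?e a) \<xi> = (0 :: 'r)" if "a \<in> \<Delta> A" for a
      using tight_filter_upward[OF _ _ E triple_le_\<Delta>[OF that]] by (auto simp: indicator_def)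
    then show ?thesis using False by (auto simp: indicator_def)
  qed
  then show "indicator (triple [] A []) \<xi> = (\<Sum>a\<in>\<Delta> A. indicator (?e a) :: _ \<Rightarrow> 'r) \<xi>"
    by (simp add: sum_apply)
qed

lemma rep_relations:
  fixes x y :: "_ \<Rightarrow>\<^sub>0 'r::{comm_ring, comm_monoid_mult}"
  shows "(x, y) \<in> relations \<Longrightarrow> rep x = rep y"
proof (induction rule: relations.induct)
  case p_bot
  then show ?case by (simp add: rep_single)
next
  case (p_inf A A')
  then show ?case by (simp add: rep_single prod_same)
next
  case (p_sup A A')
  have E: "triple [] B [] \<in> E" for B by (intro triple_mem_E) auto
  show ?case
    by (simp add: rep_add rep_minus rep_single basis_E[OF E] indicator_sup single_diff single_add)
next
  case (p_s a B A)
  then show ?case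
    using prod_right[of "[a]" "[]" A "[]" B "[]"] by (simp add: rep_single prod_same inf.commute)
next
  case (s_star_p a B A)
  then show ?case
    using prod_left[of "[a]" "[]" B "[]" A "[]"] by (simp add: rep_single prod_same inf.commute)
next
  case (s_star_s a B a' B')
  then show ?case
    by (auto simp: rep_single prod_same prod_parallel parallel_def)
next
  case (s_p a B B')
  then show ?case by (simp add: rep_single prod_same)
next
  case (p_s_star a B B')
  then show ?case by (simp add: rep_single prod_same inf.commute)
next
  case (p_regular A)
  have E: "triple [] A [] \<in> E" by (intro triple_mem_E) auto
  have "rep (p A :: _ \<Rightarrow>\<^sub>0 'r) = Poly_Mapping.single \<one>\<^bsub>\<G>\<^esub> (indicator (triple [] A []))"
    by (simp add: rep_single basis_E[OF E])
  also have "\<dots> = (\<Sum>a\<in>\<Delta> A. Poly_Mapping.single \<one>\<^bsub>\<G>\<^esub> (indicator (triple [a] (\<theta> a A) [a])))"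
  proof -
    have "Poly_Mapping.single g (\<Sum>a\<in>K. f a) = (\<Sum>a\<in>K. Poly_Mapping.single g (f a))"
      for g and K :: "'l set" and f :: "'l \<Rightarrow> ('l, 'b) triple set \<Rightarrow> 'r"
      by (induction K rule: infinite_finite_induct) (auto simp: single_add)
    then show ?thesis by (simp add: indicator_regular[OF p_regular])
  qed
  also have "\<dots> = (\<Sum>a\<in>\<Delta> A. rep (s a (\<theta> a A) \<star> s_star a (\<theta> a A)))"
    by (intro sum.cong refl) (simp add: rep_single prod_same basis_E triple_mem_E_\<Delta>)
  finally show ?case by (simp add: rep_sum)
qed

lemma generators_intro:
  "Gen_p A \<in> generators" "\<lbrakk>a \<in> \<L>; A \<in> \<I> a\<rbrakk> \<Longrightarrow> Gen_s a A \<in> generators"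
  "\<lbrakk>a \<in> \<L>; A \<in> \<I> a\<rbrakk> \<Longrightarrow> Gen_s_star a A \<in> generators"
  by (auto simp: generators_def)

lemma relations_mem:
  "(x, y) \<in> relations \<Longrightarrow>
    x \<in> carrier (free_algebra generators) \<and> y \<in> carrier (free_algebra generators)"
proof (induction rule: relations.induct)
  case p_bot
  then show ?case by (simp add: mem_carrier_free_algebra generators_intro)
next
  case (p_sup A A')
  show ?case
    by (auto intro!: free_algebra_minus_mem free_algebra_add_mem single_mem_free_algebra generators_intro)
next
  case (p_regular A)
  have "Gen_s a (\<theta> a A) \<in> generators" "Gen_s_star a (\<theta> a A) \<in> generators" if "a \<in> \<Delta> A" for a
    using that by (auto simp: \<Delta>_def intro!: generators_intro range_mem_ideal)
  then show ?case
    by (auto intro!: free_algebra_sum_mem single_mem_free_algebra simp: generators_intro(1))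
qed (auto intro!: single_mem_free_algebra generators_intro simp: mem_carrier_free_algebra intro: ideal_downward)

abbreviation rel_ideal :: "(('l, 'b) generator list \<Rightarrow>\<^sub>0 'r::{comm_ring, comm_monoid_mult}) set" where
  "rel_ideal \<equiv> relation_ideal generators relations"

lemma algebra_ideal_relations:
  "algebra_ideal (free_algebra generators) rel_ideal"
  unfolding relation_ideal_def
  by (rule nonunital_algebra.algebra_ideal_generated_ideal[OF nonunital_algebra_free_algebra])
    (use relations_mem free_algebra_minus_mem in blast)

lemma rep_relation_ideal: "x \<in> rel_ideal \<Longrightarrow> rep x = 0"
proof -
  interpret algebra_ideal "free_algebra generators :: ('a, _) module" rel_ideal
    by (rule algebra_ideal_relations)
  assume "x \<in> rel_ideal"
  then have "x \<in> generated_ideal (free_algebra generators) {x - y | x y. (x, y) \<in> relations}"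
    by (simp add: relation_ideal_def)
  then have "rep x = 0 \<and> x \<in> carrier (free_algebra generators)"
  proof induction
    case (base x)
    then show ?case using rep_relations relations_mem free_algebra_minus_mem
      by (fastforce simp: rep_minus)
  next
    case (l_mult a x)
    then show ?case using m_closed[of a x] by (simp add: free_algebra_simps rep_mult)
  next
    case (r_mult x a)
    then show ?case using m_closed[of x a] by (simp add: free_algebra_simps rep_mult)
  next
    case (smult x r)
    then show ?case using smult_closed[of x r] by (simp add: free_algebra_simps rep_scale)
  next
    case (add x y)
    then show ?case using free_algebra_add_mem[of x generators y] by (simp add: free_algebra_simps rep_add)
  qed (use zero_closed in \<open>simp_all add: free_algebra_simps\<close>)
  then show "rep x = 0" ..
qed

end

section \<open>Normal forms modulo the relations\<close>

context gbds
begin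

text \<open>Congruence modulo the ideal generated by the relations.\<close>

definition rel_cong ::
    "(('l, 'b) generator list \<Rightarrow>\<^sub>0 'r::{comm_ring, comm_monoid_mult}) \<Rightarrow> (('l, 'b) generator list \<Rightarrow>\<^sub>0 'r) \<Rightarrow> bool"
    (infix "\<approx>" 50) where
  "x \<approx> y \<longleftrightarrow> x - y \<in> rel_ideal"

lemma relation_ideal_closed:
  fixes x y :: "('l, 'b) generator list \<Rightarrow>\<^sub>0 'r::{comm_ring, comm_monoid_mult}"
  shows "0 \<in> (rel_ideal :: (_ \<Rightarrow>\<^sub>0 'r) set)"
    and "\<lbrakk>x \<in> rel_ideal; y \<in> rel_ideal\<rbrakk> \<Longrightarrow>
      x + y \<in> rel_ideal"
    and "x \<in> rel_ideal \<Longrightarrow> scale r x \<in> rel_ideal"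
    and "\<lbrakk>x \<in> carrier (free_algebra generators); y \<in> rel_ideal\<rbrakk> \<Longrightarrow>
      x \<star> y \<in> rel_ideal"
    and "\<lbrakk>x \<in> rel_ideal; y \<in> carrier (free_algebra generators)\<rbrakk> \<Longrightarrow>
      x \<star> y \<in> rel_ideal"
    and "x \<in> rel_ideal \<Longrightarrow> - x \<in> rel_ideal"
    and "\<lbrakk>x \<in> rel_ideal; y \<in> rel_ideal\<rbrakk> \<Longrightarrow>
      x - y \<in> rel_ideal"
proof -
  interpret algebra_ideal "free_algebra generators :: ('r, _) module" rel_ideal
    by (rule algebra_ideal_relations)
  show "0 \<in> (rel_ideal :: (_ \<Rightarrow>\<^sub>0 'r) set)"
    using zero_mem by (simp add: free_algebra_simps)
  show add: "x + y \<in> rel_ideal"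
    if "x \<in> rel_ideal" "y \<in> rel_ideal"
    for x y :: "_ \<Rightarrow>\<^sub>0 'r"
    using add_mem[OF that] by (simp add: free_algebra_simps)
  show scale: "scale r x \<in> rel_ideal"
    if "x \<in> rel_ideal" for r and x :: "_ \<Rightarrow>\<^sub>0 'r"
    using smult_mem[OF that] by (simp add: free_algebra_simps)
  show "x \<star> y \<in> rel_ideal"
    if "x \<in> carrier (free_algebra generators)" "y \<in> rel_ideal"
    using l_mult_mem[OF that] by (simp add: free_algebra_simps)
  show "x \<star> y \<in> rel_ideal"
    if "x \<in> rel_ideal" "y \<in> carrier (free_algebra generators)"
    using r_mult_mem[OF that] by (simp add: free_algebra_simps)
  have "scale (- 1) z = - z" for z :: "('l, 'b) generator list \<Rightarrow>\<^sub>0 'r"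
    by (rule poly_mapping_eqI) (simp add: lookup_map_zero)
  then show neg: "- x \<in> rel_ideal"
    if "x \<in> rel_ideal" for x :: "_ \<Rightarrow>\<^sub>0 'r"
    using scale[OF that, of "- 1"] by simp
  show "x - y \<in> rel_ideal"
    if "x \<in> rel_ideal" "y \<in> rel_ideal"
    using add[OF that(1) neg[OF that(2)]] by simp
qed

lemma rel_cong_refl [simp]: "x \<approx> x"
  by (simp add: rel_cong_def relation_ideal_closed)

lemma rel_cong_sym: "x \<approx> y \<Longrightarrow> y \<approx> x"
  using relation_ideal_closed(6)[of "x - y"] by (simp add: rel_cong_def)

lemma rel_cong_trans [trans]: "x \<approx> y \<Longrightarrow> y \<approx> z \<Longrightarrow> x \<approx> z"
  using relation_ideal_closed(2)[of "x - y" "y - z"] by (simp add: rel_cong_def)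

lemma rel_cong_zero: "x \<approx> 0 \<longleftrightarrow> x \<in> rel_ideal"
  by (simp add: rel_cong_def)

lemma rel_cong_add: "x \<approx> x' \<Longrightarrow> y \<approx> y' \<Longrightarrow> x + y \<approx> x' + y'"
  using relation_ideal_closed(2)[of "x - x'" "y - y'"] by (simp add: rel_cong_def algebra_simps)

lemma rel_cong_minus: "x \<approx> x' \<Longrightarrow> y \<approx> y' \<Longrightarrow> x - y \<approx> x' - y'"
  using relation_ideal_closed(7)[of "x - x'" "y - y'"] by (simp add: rel_cong_def algebra_simps)

lemma rel_cong_scale: "x \<approx> y \<Longrightarrow> scale r x \<approx> scale r y"
  using relation_ideal_closed(3)[of "x - y" r] by (simp add: rel_cong_def scale_diff)

lemma rel_cong_sum: "(\<And>i. i \<in> I \<Longrightarrow> x i \<approx> y i) \<Longrightarrow> (\<Sum>i\<in>I. x i) \<approx> (\<Sum>i\<in>I. y i)"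
  by (induction I rule: infinite_finite_induct) (auto intro: rel_cong_add)

lemma rel_cong_mult_left: "\<lbrakk>x \<approx> y; z \<in> carrier (free_algebra generators)\<rbrakk> \<Longrightarrow> z \<star> x \<approx> z \<star> y"
  using relation_ideal_closed(4)[of z "x - y"] by (simp add: rel_cong_def free_mult_minus_right)

lemma rel_cong_mult_right: "\<lbrakk>x \<approx> y; z \<in> carrier (free_algebra generators)\<rbrakk> \<Longrightarrow> x \<star> z \<approx> y \<star> z"
  using relation_ideal_closed(5)[of "x - y" z] by (simp add: rel_cong_def free_mult_minus_left)

lemma rel_cong_relation: "(x, y) \<in> relations \<Longrightarrow> x \<approx> y"
  unfolding rel_cong_def relation_ideal_def by (rule generated_ideal.base) blast

subsection \<open>Words\<close>

text \<open>
  Congruence of words depends on the coefficient ring, which does not occur in the type of a word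
  and is therefore an explicit argument.
\<close>

definition word_cong_on ::
    "'r::{comm_ring, comm_monoid_mult} itself \<Rightarrow> ('l, 'b) generator list \<Rightarrow> ('l, 'b) generator list \<Rightarrow> bool" where
  "word_cong_on R v w \<longleftrightarrow> Poly_Mapping.single v (1 :: 'r) \<approx> Poly_Mapping.single w 1"

definition null_word_on ::
    "'r::{comm_ring, comm_monoid_mult} itself \<Rightarrow> ('l, 'b) generator list \<Rightarrow> bool" where
  "null_word_on R w \<longleftrightarrow> Poly_Mapping.single w (1 :: 'r) \<approx> 0"

end

text \<open>A system together with a coefficient ring, given by its type.\<close>

locale gbds_coeff = gbds \<L> \<theta> \<I>
  for \<L> :: "'l set" and \<theta> :: "'l \<Rightarrow> 'b::generalized_boolean_algebra \<Rightarrow> 'b" and \<I> :: "'l \<Rightarrow> 'b set" +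
  fixes R :: "'r::{comm_ring, comm_monoid_mult} itself"
begin

abbreviation monomial :: "('l, 'b) generator list \<Rightarrow> ('l, 'b) generator list \<Rightarrow>\<^sub>0 'r" where
  "monomial w \<equiv> Poly_Mapping.single w 1"

abbreviation null_word :: "('l, 'b) generator list \<Rightarrow> bool" where
  "null_word \<equiv> null_word_on R"

abbreviation word_cong :: "('l, 'b) generator list \<Rightarrow> ('l, 'b) generator list \<Rightarrow> bool"  (infix "\<doteq>" 50) where
  "v \<doteq> w \<equiv> word_cong_on R v w"

lemma null_word_iff [simp]: "null_word w \<longleftrightarrow> monomial w \<approx> 0"
  by (simp add: null_word_on_def)

lemma word_cong_def: "v \<doteq> w \<longleftrightarrow> monomial v \<approx> monomial w"
  by (simp add: word_cong_on_def)

lemma word_cong_sym: "v \<doteq> w \<Longrightarrow> w \<doteq> v"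
  by (simp add: word_cong_def rel_cong_sym)

lemma word_cong_trans [trans]: "u \<doteq> v \<Longrightarrow> v \<doteq> w \<Longrightarrow> u \<doteq> w"
  unfolding word_cong_def by (rule rel_cong_trans)

lemma monomial_left: "\<lbrakk>monomial w \<approx> x; set u \<subseteq> generators; u \<noteq> []\<rbrakk> \<Longrightarrow> monomial (u @ w) \<approx> monomial u \<star> x"
  using rel_cong_mult_left[of "monomial w" x "monomial u"] single_mem_free_algebra[of u generators 1] by simp

lemma monomial_right: "\<lbrakk>monomial w \<approx> x; set v \<subseteq> generators; v \<noteq> []\<rbrakk> \<Longrightarrow> monomial (w @ v) \<approx> x \<star> monomial v"
  using rel_cong_mult_right[of "monomial w" x "monomial v"] single_mem_free_algebra[of v generators 1] by simp

lemma word_cong_left: "\<lbrakk>v \<doteq> w; set u \<subseteq> generators\<rbrakk> \<Longrightarrow> u @ v \<doteq> u @ w"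
  using monomial_left[of v "monomial w" u] by (cases "u = []") (auto simp: word_cong_def)

lemma word_cong_right: "\<lbrakk>v \<doteq> w; set u \<subseteq> generators\<rbrakk> \<Longrightarrow> v @ u \<doteq> w @ u"
  using monomial_right[of v "monomial w" u] by (cases "u = []") (auto simp: word_cong_def)

lemma word_cong_Cons: "\<lbrakk>v \<doteq> w; x \<in> generators\<rbrakk> \<Longrightarrow> x # v \<doteq> x # w"
  using word_cong_left[of v w "[x]"] by simp

lemma null_left: "\<lbrakk>null_word w; set u \<subseteq> generators\<rbrakk> \<Longrightarrow> null_word (u @ w)"
  using monomial_left[of w 0 u] by (cases "u = []") auto

lemma null_right: "\<lbrakk>null_word w; set u \<subseteq> generators\<rbrakk> \<Longrightarrow> null_word (w @ u)"
  using monomial_right[of w 0 u] by (cases "u = []") auto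

lemma cong_null: "null_word [Gen_p bot]"
  using rel_cong_relation[OF relations.p_bot] by simp

lemma cong_p_p: "[Gen_p A, Gen_p B] \<doteq> [Gen_p (inf A B)]"
  using rel_cong_sym[OF rel_cong_relation[OF relations.p_inf[of A B]]] by (simp add: word_cong_def)

lemma cong_p_s: "\<lbrakk>a \<in> \<L>; B \<in> \<I> a\<rbrakk> \<Longrightarrow> [Gen_p A, Gen_s a B] \<doteq> [Gen_s a B, Gen_p (\<theta> a A)]"
  using rel_cong_relation[OF relations.p_s[of a B A]] by (simp add: word_cong_def)

lemma cong_s_star_p:
  "\<lbrakk>a \<in> \<L>; B \<in> \<I> a\<rbrakk> \<Longrightarrow> [Gen_s_star a B, Gen_p A] \<doteq> [Gen_p (\<theta> a A), Gen_s_star a B]"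
  using rel_cong_relation[OF relations.s_star_p[of a B A]] by (simp add: word_cong_def)

lemma cong_s_star_s:
  "\<lbrakk>a \<in> \<L>; B \<in> \<I> a; B' \<in> \<I> a\<rbrakk> \<Longrightarrow> [Gen_s_star a B, Gen_s a B'] \<doteq> [Gen_p (inf B B')]"
  using rel_cong_relation[OF relations.s_star_s[of a B a B']] by (simp add: word_cong_def)

lemma null_s_star_s:
  "\<lbrakk>a \<in> \<L>; B \<in> \<I> a; a' \<in> \<L>; B' \<in> \<I> a'; a \<noteq> a'\<rbrakk> \<Longrightarrow> null_word [Gen_s_star a B, Gen_s a' B']"
  using rel_cong_relation[OF relations.s_star_s[of a B a' B']] by simp

lemma cong_s_p: "\<lbrakk>a \<in> \<L>; B \<in> \<I> a\<rbrakk> \<Longrightarrow> [Gen_s a B, Gen_p C] \<doteq> [Gen_s a (inf B C)]"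
  using rel_cong_relation[OF relations.s_p[of a B C]] by (simp add: word_cong_def)

lemma cong_p_s_star: "\<lbrakk>a \<in> \<L>; B \<in> \<I> a\<rbrakk> \<Longrightarrow> [Gen_p C, Gen_s_star a B] \<doteq> [Gen_s_star a (inf B C)]"
  using rel_cong_relation[OF relations.p_s_star[of a B C]] by (simp add: word_cong_def)

text \<open>
  \<open>bound \<alpha> A a\<close> is some element of \<open>\<I> a\<close> witnessing that \<open>A\<close> is in the ideal of \<open>a \<alpha>\<close>.
  \<open>s_word \<alpha> A\<close> stands for the partial isometry of the word \<open>\<alpha>\<close> restricted to \<open>A\<close>, and
  \<open>s_star_word \<alpha> A\<close> for its adjoint.
\<close>

definition bound :: "'l list \<Rightarrow> 'b \<Rightarrow> 'l \<Rightarrow> 'b" where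
  "bound \<alpha> A a = (SOME B. B \<in> \<I> a \<and> A \<le> \<theta>_word \<alpha> B)"

primrec s_word :: "'l list \<Rightarrow> 'b \<Rightarrow> ('l, 'b) generator list" where
  "s_word [] A = [Gen_p A]"
| "s_word (a # \<alpha>) A = Gen_s a (bound \<alpha> A a) # s_word \<alpha> A"

primrec s_star_word :: "'l list \<Rightarrow> 'b \<Rightarrow> ('l, 'b) generator list" where
  "s_star_word [] A = [Gen_p A]"
| "s_star_word (a # \<alpha>) A = s_star_word \<alpha> A @ [Gen_s_star a (bound \<alpha> A a)]"

lemma bound:
  assumes "A \<in> \<I>_word (a # \<alpha>)"
  shows "bound \<alpha> A a \<in> \<I> a" "A \<le> \<theta>_word \<alpha> (bound \<alpha> A a)"
proof -
  have "\<exists>B. B \<in> \<I> a \<and> A \<le> \<theta>_word \<alpha> B" using assms by auto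
  then have "bound \<alpha> A a \<in> \<I> a \<and> A \<le> \<theta>_word \<alpha> (bound \<alpha> A a)"
    unfolding bound_def by (rule someI_ex)
  then show "bound \<alpha> A a \<in> \<I> a" "A \<le> \<theta>_word \<alpha> (bound \<alpha> A a)" by auto
qed

lemma \<I>_word_tail: "\<lbrakk>A \<in> \<I>_word (a # \<alpha>); \<alpha> \<in> lists \<L>\<rbrakk> \<Longrightarrow> A \<in> \<I>_word \<alpha>"
  by (cases \<alpha>) (auto intro: range_mem_ideal[OF _ order.refl])

lemma set_s_word: "\<lbrakk>\<alpha> \<in> lists \<L>; A \<in> \<I>_word \<alpha>\<rbrakk> \<Longrightarrow> set (s_word \<alpha> A) \<subseteq> generators"
proof (induction \<alpha>)
  case (Cons a \<alpha>)
  then show ?case using bound[of A a \<alpha>] \<I>_word_tail[of A a \<alpha>]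
    by (auto simp: generators_intro simp del: \<I>_word.simps)
qed (simp add: generators_intro)

lemma set_s_star_word: "\<lbrakk>\<alpha> \<in> lists \<L>; A \<in> \<I>_word \<alpha>\<rbrakk> \<Longrightarrow> set (s_star_word \<alpha> A) \<subseteq> generators"
proof (induction \<alpha>)
  case (Cons a \<alpha>)
  then show ?case using bound[of A a \<alpha>] \<I>_word_tail[of A a \<alpha>]
    by (auto simp: generators_intro simp del: \<I>_word.simps)
qed (simp add: generators_intro)

text \<open>
  A projection \<open>p\<^sub>C\<close> in front of \<open>s_word \<alpha> A\<close> can be moved to the right end, where it becomes
  \<open>p\<^bsub>\<theta>\<^sub>\<alpha>(C)\<^esub>\<close>. It disappears if \<open>A\<close> is below \<open>\<theta>\<^sub>\<alpha>(C)\<close>, and this makes the choice of the witnesses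
  irrelevant (\<open>s_word_Cons\<close>).
\<close>

lemma p_s_word_absorb:
  "\<lbrakk>\<alpha> \<in> lists \<L>; A \<in> \<I>_word \<alpha>; A \<le> \<theta>_word \<alpha> C\<rbrakk> \<Longrightarrow> Gen_p C # s_word \<alpha> A \<doteq> s_word \<alpha> A"
proof (induction \<alpha> arbitrary: C)
  case Nil
  then show ?case using cong_p_p[of C A] by (simp add: inf.absorb2)
next
  case (Cons a \<alpha>)
  let ?B = "bound \<alpha> A a"
  have a: "a \<in> \<L>" "\<alpha> \<in> lists \<L>" "?B \<in> \<I> a" "A \<in> \<I>_word \<alpha>"
    using Cons.prems bound(1) \<I>_word_tail by auto
  have "Gen_p C # s_word (a # \<alpha>) A \<doteq> Gen_s a ?B # Gen_p (\<theta> a C) # s_word \<alpha> A"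
    using word_cong_right[OF cong_p_s[OF a(1,3), of C] set_s_word[OF a(2,4)]] by simp
  also have "\<dots> \<doteq> s_word (a # \<alpha>) A"
    using word_cong_Cons[OF Cons.IH] a Cons.prems by (simp add: generators_intro)
  finally show ?case .
qed

lemma s_word_Cons:
  assumes a: "a \<in> \<L>" and \<alpha>: "\<alpha> \<in> lists \<L>" and B: "B \<in> \<I> a" "A \<le> \<theta>_word \<alpha> B"
  shows "Gen_s a B # s_word \<alpha> A \<doteq> s_word (a # \<alpha>) A"
proof -
  have A: "A \<in> \<I>_word (a # \<alpha>)" using B by auto
  note tail = \<I>_word_tail[OF A \<alpha>]
  have *: "Gen_s a B # s_word \<alpha> A \<doteq> Gen_s a (inf B C) # s_word \<alpha> A"
    if "B \<in> \<I> a" "A \<le> \<theta>_word \<alpha> C" for B C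
  proof -
    have "Gen_s a B # s_word \<alpha> A \<doteq> Gen_s a B # Gen_p C # s_word \<alpha> A"
      using word_cong_Cons[OF word_cong_sym[OF p_s_word_absorb[OF \<alpha> tail that(2)]]] a that
      by (simp add: generators_intro)
    also have "\<dots> \<doteq> Gen_s a (inf B C) # s_word \<alpha> A"
      using word_cong_right[OF cong_s_p[OF a that(1), of C] set_s_word[OF \<alpha> tail]] by simp
    finally show ?thesis .
  qed
  have "Gen_s a B # s_word \<alpha> A \<doteq> Gen_s a (inf B (bound \<alpha> A a)) # s_word \<alpha> A"
    using * B bound[OF A] by blast
  also have "\<dots> \<doteq> s_word (a # \<alpha>) A"
    using word_cong_sym[OF *[of "bound \<alpha> A a" B]] B bound[OF A] by (simp add: inf.commute)
  finally show ?thesis .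
qed

lemma s_word_p: "\<lbrakk>\<alpha> \<in> lists \<L>; A \<in> \<I>_word \<alpha>\<rbrakk> \<Longrightarrow> s_word \<alpha> A @ [Gen_p C] \<doteq> s_word \<alpha> (inf A C)"
proof (induction \<alpha>)
  case Nil
  then show ?case using cong_p_p[of A C] by simp
next
  case (Cons a \<alpha>)
  have a: "a \<in> \<L>" "\<alpha> \<in> lists \<L>" "A \<in> \<I>_word \<alpha>" using Cons.prems \<I>_word_tail by auto
  note B = bound[OF Cons.prems(2)]
  have "s_word (a # \<alpha>) A @ [Gen_p C] \<doteq> Gen_s a (bound \<alpha> A a) # s_word \<alpha> (inf A C)"
    using word_cong_Cons[OF Cons.IH] a B by (simp add: generators_intro)
  also have "\<dots> \<doteq> s_word (a # \<alpha>) (inf A C)"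
    using s_word_Cons[OF a(1,2) B(1)] B(2) by (simp add: le_infI1)
  finally show ?case .
qed

lemma p_s_word:
  "\<lbrakk>\<alpha> \<in> lists \<L>; A \<in> \<I>_word \<alpha>\<rbrakk> \<Longrightarrow> Gen_p C # s_word \<alpha> A \<doteq> s_word \<alpha> (inf A (\<theta>_word \<alpha> C))"
proof (induction \<alpha> arbitrary: C)
  case Nil
  then show ?case using cong_p_p[of C A] by (simp add: inf.commute)
next
  case (Cons a \<alpha>)
  let ?B = "bound \<alpha> A a"
  have a: "a \<in> \<L>" "\<alpha> \<in> lists \<L>" "A \<in> \<I>_word \<alpha>" using Cons.prems \<I>_word_tail by auto
  note B = bound[OF Cons.prems(2)]
  have "Gen_p C # s_word (a # \<alpha>) A \<doteq> Gen_s a ?B # Gen_p (\<theta> a C) # s_word \<alpha> A"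
    using word_cong_right[OF cong_p_s[OF a(1) B(1), of C] set_s_word[OF a(2,3)]] by simp
  also have "\<dots> \<doteq> Gen_s a ?B # s_word \<alpha> (inf A (\<theta>_word \<alpha> (\<theta> a C)))"
    using word_cong_Cons[OF Cons.IH] a B by (simp add: generators_intro)
  also have "\<dots> \<doteq> s_word (a # \<alpha>) (inf A (\<theta>_word (a # \<alpha>) C))"
    using s_word_Cons[OF a(1,2) B(1)] B(2) by (simp add: le_infI1)
  finally show ?case .
qed

lemma null_s_word: "\<alpha> \<in> lists \<L> \<Longrightarrow> null_word (s_word \<alpha> bot)"
proof (induction \<alpha>)
  case Nil
  then show ?case using cong_null by simp
next
  case (Cons a \<alpha>)
  have "Gen_s a (bound \<alpha> bot a) \<in> generators"
    using Cons.prems bound(1)[OF bot_mem_\<I>_word[OF Cons.prems]] by (simp add: generators_intro)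
  then show ?case using null_left[of "s_word \<alpha> bot" "[Gen_s a (bound \<alpha> bot a)]"] Cons by simp
qed

lemma s_star_word_p_absorb:
  "\<lbrakk>\<alpha> \<in> lists \<L>; A \<in> \<I>_word \<alpha>; A \<le> \<theta>_word \<alpha> C\<rbrakk> \<Longrightarrow> s_star_word \<alpha> A @ [Gen_p C] \<doteq> s_star_word \<alpha> A"
proof (induction \<alpha> arbitrary: C)
  case Nil
  then show ?case using cong_p_p[of A C] by (simp add: inf.absorb1)
next
  case (Cons a \<alpha>)
  let ?B = "bound \<alpha> A a"
  have a: "a \<in> \<L>" "\<alpha> \<in> lists \<L>" "?B \<in> \<I> a" "A \<in> \<I>_word \<alpha>"
    using Cons.prems bound(1) \<I>_word_tail by auto
  have "s_star_word (a # \<alpha>) A @ [Gen_p C] \<doteq> (s_star_word \<alpha> A @ [Gen_p (\<theta> a C)]) @ [Gen_s_star a ?B]"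
    using word_cong_left[OF cong_s_star_p[OF a(1,3), of C] set_s_star_word[OF a(2,4)]] by simp
  also have "\<dots> \<doteq> s_star_word \<alpha> A @ [Gen_s_star a ?B]"
    by (rule word_cong_right[OF Cons.IH]) (use a Cons.prems in \<open>auto simp: generators_intro\<close>)
  finally show ?case by simp
qed

lemma s_star_word_Cons:
  assumes a: "a \<in> \<L>" and \<alpha>: "\<alpha> \<in> lists \<L>" and B: "B \<in> \<I> a" "A \<le> \<theta>_word \<alpha> B"
  shows "s_star_word \<alpha> A @ [Gen_s_star a B] \<doteq> s_star_word (a # \<alpha>) A"
proof -
  have A: "A \<in> \<I>_word (a # \<alpha>)" using B by auto
  note tail = \<I>_word_tail[OF A \<alpha>]
  have *: "s_star_word \<alpha> A @ [Gen_s_star a B] \<doteq> s_star_word \<alpha> A @ [Gen_s_star a (inf B C)]"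
    if "B \<in> \<I> a" "A \<le> \<theta>_word \<alpha> C" for B C
  proof -
    have "s_star_word \<alpha> A @ [Gen_s_star a B] \<doteq> (s_star_word \<alpha> A @ [Gen_p C]) @ [Gen_s_star a B]"
      by (rule word_cong_right[OF word_cong_sym[OF s_star_word_p_absorb[OF \<alpha> tail that(2)]]])
        (use a that in \<open>simp add: generators_intro\<close>)
    also have "\<dots> \<doteq> s_star_word \<alpha> A @ [Gen_s_star a (inf B C)]"
      using word_cong_left[OF cong_p_s_star[OF a that(1), of C] set_s_star_word[OF \<alpha> tail]] by simp
    finally show ?thesis .
  qed
  have "s_star_word \<alpha> A @ [Gen_s_star a B] \<doteq> s_star_word \<alpha> A @ [Gen_s_star a (inf B (bound \<alpha> A a))]"
    using * B bound[OF A] by blast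
  also have "\<dots> \<doteq> s_star_word (a # \<alpha>) A"
    using word_cong_sym[OF *[of "bound \<alpha> A a" B]] B bound[OF A] by (simp add: inf.commute)
  finally show ?thesis .
qed

lemma p_s_star_word:
  "\<lbrakk>\<alpha> \<in> lists \<L>; A \<in> \<I>_word \<alpha>\<rbrakk> \<Longrightarrow> Gen_p C # s_star_word \<alpha> A \<doteq> s_star_word \<alpha> (inf A C)"
proof (induction \<alpha>)
  case Nil
  then show ?case using cong_p_p[of C A] by (simp add: inf.commute)
next
  case (Cons a \<alpha>)
  have a: "a \<in> \<L>" "\<alpha> \<in> lists \<L>" "A \<in> \<I>_word \<alpha>" using Cons.prems \<I>_word_tail by auto
  note B = bound[OF Cons.prems(2)]
  have "(Gen_p C # s_star_word \<alpha> A) @ [Gen_s_star a (bound \<alpha> A a)]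
      \<doteq> s_star_word \<alpha> (inf A C) @ [Gen_s_star a (bound \<alpha> A a)]"
    by (rule word_cong_right[OF Cons.IH]) (use a B in \<open>auto simp: generators_intro\<close>)
  also have "\<dots> \<doteq> s_star_word (a # \<alpha>) (inf A C)"
    using s_star_word_Cons[OF a(1,2) B(1)] B(2) by (simp add: le_infI1)
  finally show ?case by simp
qed

lemma s_star_word_snoc:
  "\<lbrakk>\<beta> \<in> lists \<L>; a \<in> \<L>; F \<in> \<I>_word \<beta>; C \<le> \<theta> a F\<rbrakk> \<Longrightarrow>
    Gen_s_star a C # s_star_word \<beta> F \<doteq> s_star_word (\<beta> @ [a]) C"
proof (induction \<beta>)
  case Nil
  then have C: "C \<in> \<I> a" by (blast intro: range_mem_ideal)
  have "[Gen_s_star a C, Gen_p F] \<doteq> [Gen_p (\<theta> a F), Gen_s_star a C]"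
    using cong_s_star_p[OF Nil(2) C] .
  also have "\<dots> \<doteq> [Gen_s_star a C]"
    using cong_p_s_star[OF Nil(2) C, of "\<theta> a F"] Nil by (simp add: inf.absorb1)
  also have "\<dots> \<doteq> [Gen_p C, Gen_s_star a C]"
    using word_cong_sym[OF cong_p_s_star[OF Nil(2) C, of C]] by simp
  also have "\<dots> \<doteq> s_star_word [a] C"
    using s_star_word_Cons[OF Nil(2), of "[]" C C] C by simp
  finally show ?case by simp
next
  case (Cons b \<beta>)
  have b: "b \<in> \<L>" "\<beta> \<in> lists \<L>" "F \<in> \<I>_word \<beta>" using Cons.prems \<I>_word_tail by auto
  note B = bound[OF Cons.prems(3)]
  have "C \<le> \<theta>_word [a] (\<theta>_word \<beta> (bound \<beta> F b))"
    using Cons.prems \<theta>_word_mono[of "[a]", OF _ B(2)] by (auto intro: order.trans)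
  then have le: "C \<le> \<theta>_word (\<beta> @ [a]) (bound \<beta> F b)" by (simp only: \<theta>_word_append)
  have "(Gen_s_star a C # s_star_word \<beta> F) @ [Gen_s_star b (bound \<beta> F b)]
      \<doteq> s_star_word (\<beta> @ [a]) C @ [Gen_s_star b (bound \<beta> F b)]"
    by (rule word_cong_right[OF Cons.IH]) (use b B Cons.prems in \<open>auto simp: generators_intro\<close>)
  also have "\<dots> \<doteq> s_star_word (b # \<beta> @ [a]) C"
    using s_star_word_Cons[OF b(1) _ B(1) le] b Cons.prems by simp
  finally show ?case by simp
qed

subsection \<open>Normal forms\<close>

text \<open>The element of the free algebra representing \<open>(\<alpha>, A, \<beta>)\<close>.\<close>

fun normal_form :: "('l, 'b) triple \<Rightarrow> ('l, 'b) generator list \<Rightarrow>\<^sub>0 'r" where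
  "normal_form Zero = 0"
| "normal_form (Triple \<alpha> A \<beta>) = monomial (s_word \<alpha> A @ s_star_word \<beta> A)"

lemma normal_form_triple:
  assumes "\<alpha> \<in> lists \<L>" "\<beta> \<in> lists \<L>" "A \<in> \<I>_word \<beta>"
  shows "monomial (s_word \<alpha> A @ s_star_word \<beta> A) \<approx> normal_form (triple \<alpha> A \<beta>)"
proof (cases "A = bot")
  case True
  then show ?thesis using null_right[OF null_s_word set_s_star_word] assms by (simp add: triple_def)
qed (simp add: triple_def)

lemma s_word_s_star_word_le:
  assumes "\<alpha> \<in> lists \<L>" "\<beta> \<in> lists \<L>" "A \<in> \<I>_word \<alpha>" "A' \<in> \<I>_word \<beta>" "A \<le> A'"
  shows "s_word \<alpha> A @ s_star_word \<beta> A' \<doteq> s_word \<alpha> A @ s_star_word \<beta> A"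
proof -
  have "s_word \<alpha> A @ s_star_word \<beta> A' \<doteq> (s_word \<alpha> A @ [Gen_p A]) @ s_star_word \<beta> A'"
    using s_word_p[of \<alpha> A A] assms set_s_star_word[of \<beta> A']
    by (intro word_cong_right word_cong_sym[of "s_word \<alpha> A @ [Gen_p A]"]) auto
  also have "\<dots> \<doteq> s_word \<alpha> A @ s_star_word \<beta> A"
    using word_cong_left[OF p_s_star_word[of \<beta> A' A] set_s_word[of \<alpha> A]] assms
    by (simp add: inf.absorb2)
  finally show ?thesis .
qed

text \<open>Multiplication by a generator from the left takes normal forms to normal forms, as in the semigroup.\<close>

lemma generator_mult_triple:
  assumes x: "x \<in> generators" and \<alpha>: "\<alpha> \<in> lists \<L>" "A \<in> \<I>_word \<alpha>" and \<beta>: "\<beta> \<in> lists \<L>" "A \<in> \<I>_word \<beta>"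
  shows "monomial (x # s_word \<alpha> A @ s_star_word \<beta> A) \<approx> normal_form (generator_triple x \<bullet> triple \<alpha> A \<beta>)"
proof (cases x)
  case (Gen_p C)
  let ?A = "inf A (\<theta>_word \<alpha> C)"
  have "x # s_word \<alpha> A @ s_star_word \<beta> A \<doteq> s_word \<alpha> ?A @ s_star_word \<beta> A"
    using word_cong_right[OF p_s_word[OF \<alpha>, of C] set_s_star_word[OF \<beta>]] Gen_p by simp
  also have "\<dots> \<doteq> s_word \<alpha> ?A @ s_star_word \<beta> ?A"
    using \<alpha> \<beta> by (intro s_word_s_star_word_le) (auto intro: inf_mem_\<I>_word)
  finally have "monomial (x # s_word \<alpha> A @ s_star_word \<beta> A) \<approx> monomial (s_word \<alpha> ?A @ s_star_word \<beta> ?A)"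
    by (simp add: word_cong_def)
  also have "\<dots> \<approx> normal_form (triple \<alpha> ?A \<beta>)"
    using \<alpha> \<beta> by (intro normal_form_triple) (auto intro: inf_mem_\<I>_word)
  finally show ?thesis
    using prod_right[OF \<alpha>(1), of "[]" C "[]" A \<beta>] Gen_p by (simp add: inf.commute)
next
  case (Gen_s a C)
  then have a: "a \<in> \<L>" "C \<in> \<I> a" using x by (auto simp: generators_def)
  let ?A = "inf A (\<theta>_word \<alpha> C)"
  have A: "?A \<in> \<I>_word (a # \<alpha>)" using a by (auto intro!: bexI[of _ C])
  have "x # s_word \<alpha> A @ s_star_word \<beta> A \<doteq> Gen_s a C # Gen_p C # s_word \<alpha> A @ s_star_word \<beta> A"
    using word_cong_right[OF word_cong_sym[OF cong_s_p[OF a, of C]], of "s_word \<alpha> A @ s_star_word \<beta> A"]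
      Gen_s set_s_word[OF \<alpha>] set_s_star_word[OF \<beta>] by simp
  also have "\<dots> \<doteq> Gen_s a C # s_word \<alpha> ?A @ s_star_word \<beta> A"
    using word_cong_Cons[OF word_cong_right[OF p_s_word[OF \<alpha>, of C] set_s_star_word[OF \<beta>]]] a
    by (simp add: generators_intro)
  also have "\<dots> \<doteq> s_word (a # \<alpha>) ?A @ s_star_word \<beta> A"
    using word_cong_right[OF s_word_Cons[OF a(1) \<alpha>(1) a(2), of ?A] set_s_star_word[OF \<beta>]] by simp
  also have "\<dots> \<doteq> s_word (a # \<alpha>) ?A @ s_star_word \<beta> ?A"
    using \<alpha> \<beta> a A by (intro s_word_s_star_word_le) auto
  finally have "monomial (x # s_word \<alpha> A @ s_star_word \<beta> A) \<approx> monomial (s_word (a # \<alpha>) ?A @ s_star_word \<beta> ?A)"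
    by (simp add: word_cong_def)
  also have "\<dots> \<approx> normal_form (triple (a # \<alpha>) ?A \<beta>)"
    using \<alpha> \<beta> a by (intro normal_form_triple) (auto intro: inf_mem_\<I>_word)
  finally show ?thesis
    using prod_right[OF \<alpha>(1), of "[a]" C "[]" A \<beta>] Gen_s by (simp add: inf.commute)
next
  case (Gen_s_star a C)
  then have a: "a \<in> \<L>" "C \<in> \<I> a" using x by (auto simp: generators_def)
  show ?thesis
  proof (cases \<alpha>)
    case Nil
    let ?C = "inf C (\<theta> a A)"
    have C: "?C \<in> \<I>_word (\<beta> @ [a])"
      using \<I>_word_append[OF \<beta>(2,1), of "[a]"] a \<I>_word_downward[of "\<theta> a A" "\<beta> @ [a]" ?C] by simp
    have "x # s_word \<alpha> A @ s_star_word \<beta> A \<doteq> Gen_p (\<theta> a A) # Gen_s_star a C # s_star_word \<beta> A"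
      using word_cong_right[OF cong_s_star_p[OF a, of A] set_s_star_word[OF \<beta>]] Gen_s_star Nil by simp
    also have "\<dots> \<doteq> Gen_s_star a ?C # s_star_word \<beta> A"
      using word_cong_right[OF cong_p_s_star[OF a, of "\<theta> a A"] set_s_star_word[OF \<beta>]] by simp
    also have "\<dots> \<doteq> s_star_word (\<beta> @ [a]) ?C"
      using a \<beta> by (intro s_star_word_snoc) auto
    also have "\<dots> \<doteq> s_word [] ?C @ s_star_word (\<beta> @ [a]) ?C"
      using word_cong_sym[OF p_s_star_word[OF _ C, of ?C]] \<beta> a by simp
    finally have "monomial (x # s_word \<alpha> A @ s_star_word \<beta> A) \<approx> monomial (s_word [] ?C @ s_star_word (\<beta> @ [a]) ?C)"
      by (simp only: word_cong_def)
    also have "\<dots> \<approx> normal_form (triple [] ?C (\<beta> @ [a]))"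
      using \<beta> a C by (intro normal_form_triple) auto
    finally show ?thesis
      using prod_left[of "[a]" "[]" C "[]" A \<beta>] Gen_s_star Nil a by simp
  next
    case (Cons b \<alpha>')
    let ?B = "bound \<alpha>' A b"
    have b: "b \<in> \<L>" "\<alpha>' \<in> lists \<L>" "A \<in> \<I>_word \<alpha>'" using \<alpha> Cons \<I>_word_tail by auto
    note B = bound[OF \<alpha>(2)[unfolded Cons]]
    have rest: "set (s_word \<alpha>' A @ s_star_word \<beta> A) \<subseteq> generators"
      using set_s_word[OF b(2,3)] set_s_star_word[OF \<beta>] by simp
    show ?thesis
    proof (cases "a = b")
      case False
      then have "null_word (x # s_word \<alpha> A @ s_star_word \<beta> A)"
        using null_right[OF null_s_star_s[OF a b(1) B(1)] rest] Gen_s_star Cons by simp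
      moreover have "generator_triple x \<bullet> triple \<alpha> A \<beta> = Zero"
        using prod_parallel[of "[a]" \<alpha> "[]" C A \<beta>] False Gen_s_star Cons by (simp add: parallel_def)
      ultimately show ?thesis by simp
    next
      case True
      let ?A = "inf A (\<theta>_word \<alpha>' C)"
      have eq: "inf A (\<theta>_word \<alpha>' (inf C ?B)) = ?A"
        using b B(2) by (simp add: \<theta>_word_simps inf.absorb1 le_infI1 flip: inf.assoc)
      have "x # s_word \<alpha> A @ s_star_word \<beta> A \<doteq> Gen_p (inf C ?B) # s_word \<alpha>' A @ s_star_word \<beta> A"
        using word_cong_right[OF cong_s_star_s[OF a, of ?B] rest] B True Gen_s_star Cons by simp
      also have "\<dots> \<doteq> s_word \<alpha>' ?A @ s_star_word \<beta> A"
        using word_cong_right[OF p_s_word[OF b(2,3), of "inf C ?B"] set_s_star_word[OF \<beta>]] eq by simp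
      also have "\<dots> \<doteq> s_word \<alpha>' ?A @ s_star_word \<beta> ?A"
        using b \<beta> by (intro s_word_s_star_word_le) (auto intro: inf_mem_\<I>_word)
      finally have "monomial (x # s_word \<alpha> A @ s_star_word \<beta> A) \<approx> monomial (s_word \<alpha>' ?A @ s_star_word \<beta> ?A)"
        by (simp add: word_cong_def)
      also have "\<dots> \<approx> normal_form (triple \<alpha>' ?A \<beta>)"
        using b \<beta> by (intro normal_form_triple) (auto intro: inf_mem_\<I>_word)
      finally show ?thesis
        using prod_right[OF b(2), of "[]" C "[a]" A \<beta>] Gen_s_star Cons True by (simp add: inf.commute)
    qed
  qed
qed

lemma generator_normal_form:
  assumes "x \<in> generators"
  shows "monomial [x] \<approx> normal_form (generator_triple x)"
proof (cases x)
  case (Gen_p A)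
  have "monomial [x] \<approx> monomial (s_word [] A @ s_star_word [] A)"
    using word_cong_sym[OF cong_p_p[of A A]] Gen_p by (simp add: word_cong_def)
  also have "\<dots> \<approx> normal_form (triple [] A [])"
    by (intro normal_form_triple) auto
  finally show ?thesis using Gen_p by simp
next
  case (Gen_s a A)
  then have a: "a \<in> \<L>" "A \<in> \<I> a" using assms by (auto simp: generators_def)
  have "[x] \<doteq> [Gen_s a A, Gen_p A]"
    using word_cong_sym[OF cong_s_p[OF a, of A]] Gen_s by simp
  also have "\<dots> \<doteq> [Gen_s a A, Gen_p A, Gen_p A]"
    using word_cong_Cons[OF word_cong_sym[OF cong_p_p[of A A]]] a by (simp add: generators_intro)
  also have "\<dots> \<doteq> s_word [a] A @ s_star_word [] A"
    using word_cong_right[OF s_word_Cons[OF a(1) _ a(2), of "[]" A], of "[Gen_p A]"]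
    by (simp add: generators_intro)
  finally have "monomial [x] \<approx> monomial (s_word [a] A @ s_star_word [] A)" by (simp only: word_cong_def)
  also have "\<dots> \<approx> normal_form (triple [a] A [])"
    using a by (intro normal_form_triple) auto
  finally show ?thesis using Gen_s by simp
next
  case (Gen_s_star a A)
  then have a: "a \<in> \<L>" "A \<in> \<I> a" using assms by (auto simp: generators_def)
  have "[x] \<doteq> [Gen_p A, Gen_s_star a A]"
    using word_cong_sym[OF cong_p_s_star[OF a, of A]] Gen_s_star by simp
  also have "\<dots> \<doteq> [Gen_p A, Gen_p A, Gen_s_star a A]"
    using word_cong_right[OF word_cong_sym[OF cong_p_p[of A A]], of "[Gen_s_star a A]"] a
    by (simp add: generators_intro)
  also have "\<dots> \<doteq> s_word [] A @ s_star_word [a] A"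
    using word_cong_left[OF s_star_word_Cons[OF a(1) _ a(2), of "[]" A], of "[Gen_p A]"]
    by (simp add: generators_intro)
  finally have "monomial [x] \<approx> monomial (s_word [] A @ s_star_word [a] A)" by (simp only: word_cong_def)
  also have "\<dots> \<approx> normal_form (triple [] A [a])"
    using a by (intro normal_form_triple) (auto simp: \<I>_word_singleton)
  finally show ?thesis using Gen_s_star by simp
qed

lemma generator_mult_normal_form:
  assumes x: "x \<in> generators" and t: "t \<in> \<S>"
  shows "monomial [x] \<star> normal_form t \<approx> normal_form (generator_triple x \<bullet> t)"
  using t
proof (cases rule: S_cases)
  case (1 \<alpha> A \<beta>)
  show ?thesis
  proof (cases "A = bot")
    case True
    then show ?thesis using 1 by simp
  next
    case False
    then show ?thesis
      using generator_mult_triple[OF x 1(2,4,3,5)] 1 by (simp add: triple_def)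
  qed
qed

lemma normal_form_mem: "t \<in> \<S> \<Longrightarrow> normal_form t \<in> carrier (free_algebra generators)"
proof (cases t)
  case (Triple \<alpha> A \<beta>)
  assume "t \<in> \<S>"
  then have "\<alpha> \<in> lists \<L>" "\<beta> \<in> lists \<L>" "A \<in> \<I>_word \<alpha>" "A \<in> \<I>_word \<beta>"
    using Triple by (auto simp: \<S>_def)
  moreover have "s_word \<alpha> A \<noteq> []" by (cases \<alpha>) auto
  ultimately show ?thesis
    using Triple set_s_word[of \<alpha> A] set_s_star_word[of \<beta> A] by (simp add: single_mem_free_algebra)
qed (simp add: mem_carrier_free_algebra)

lemma word_mult_normal_form:
  "\<lbrakk>set w \<subseteq> generators; w \<noteq> []; t \<in> \<S>\<rbrakk> \<Longrightarrow> monomial w \<star> normal_form t \<approx> normal_form (word_triple w \<bullet> t)"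
proof (induction w)
  case (Cons x w)
  show ?case
  proof (cases "w = []")
    case True
    then show ?thesis using Cons generator_mult_normal_form by simp
  next
    case False
    have "monomial (x # w) \<star> normal_form t = monomial [x] \<star> (monomial w \<star> normal_form t)"
      by (simp flip: free_mult_assoc)
    also have "\<dots> \<approx> monomial [x] \<star> normal_form (word_triple w \<bullet> t)"
      using Cons False by (intro rel_cong_mult_left single_mem_free_algebra) auto
    also have "\<dots> \<approx> normal_form (generator_triple x \<bullet> (word_triple w \<bullet> t))"
      using Cons.prems by (intro generator_mult_normal_form) (auto intro!: word_triple_mem)
    also have "\<dots> = normal_form (word_triple (x # w) \<bullet> t)"
      using Cons.prems False
      by (simp add: word_triple_Cons prod_assoc generator_triple_mem word_triple_mem)
    finally show ?thesis .
  qed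
qed simp

lemma word_normal_form:
  "\<lbrakk>set w \<subseteq> generators; w \<noteq> []\<rbrakk> \<Longrightarrow> monomial w \<approx> normal_form (word_triple w)"
proof (cases w rule: rev_cases)
  case (snoc v x)
  assume w: "set w \<subseteq> generators"
  then have x: "monomial [x] \<approx> normal_form (generator_triple x)"
    using snoc by (simp add: generator_normal_form)
  show ?thesis
  proof (cases "v = []")
    case False
    have "monomial w \<approx> monomial v \<star> normal_form (generator_triple x)"
      using monomial_left[OF x, of v] w snoc False by simp
    also have "\<dots> \<approx> normal_form (word_triple v \<bullet> generator_triple x)"
      using w snoc False by (intro word_mult_normal_form) (auto intro: generator_triple_mem)
    also have "word_triple v \<bullet> generator_triple x = word_triple w"
      using word_triple_append[of v "[x]"] w snoc False by simp
    finally show ?thesis .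
  qed (use x snoc in simp)
qed simp

lemma word_triple_s_word:
  "\<lbrakk>\<alpha> \<in> lists \<L>; A \<in> \<I>_word \<alpha>\<rbrakk> \<Longrightarrow> word_triple (s_word \<alpha> A) = triple \<alpha> A []"
proof (induction \<alpha>)
  case (Cons a \<alpha>)
  have "s_word \<alpha> A \<noteq> []" by (cases \<alpha>) auto
  moreover have "A \<in> \<I>_word \<alpha>" "\<alpha> \<in> lists \<L>" using Cons.prems \<I>_word_tail by auto
  ultimately have "word_triple (s_word (a # \<alpha>) A) = triple [a] (bound \<alpha> A a) [] \<bullet> triple \<alpha> A []"
    using Cons.IH by (simp add: word_triple_Cons)
  also have "\<dots> = triple (a # \<alpha>) A []"
    using prod_right[of \<alpha> "[a]" "bound \<alpha> A a" "[]" A "[]"] Cons.prems bound[of A a \<alpha>]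
    by (simp add: inf.absorb2 del: \<I>_word.simps)
  finally show ?case .
qed simp

lemma word_triple_s_star_word:
  "\<lbrakk>\<alpha> \<in> lists \<L>; A \<in> \<I>_word \<alpha>\<rbrakk> \<Longrightarrow> word_triple (s_star_word \<alpha> A) = triple [] A \<alpha>"
proof (induction \<alpha>)
  case (Cons a \<alpha>)
  have 1: "s_star_word \<alpha> A \<noteq> []" by (cases \<alpha>) auto
  have 2: "A \<in> \<I>_word \<alpha>" "\<alpha> \<in> lists \<L>" "a \<in> \<L>" using Cons.prems \<I>_word_tail by auto
  note B = bound[OF Cons.prems(2)]
  have "word_triple (s_star_word (a # \<alpha>) A) = triple [] A \<alpha> \<bullet> triple [] (bound \<alpha> A a) [a]"
    using Cons.IH 1 2 B set_s_star_word[of \<alpha> A]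
    by (simp add: word_triple_append generators_intro)
  also have "\<dots> = triple [] A (a # \<alpha>)"
    using prod_left[of \<alpha> "[]" A "[]" "bound \<alpha> A a" "[a]"] 2 B by (simp add: inf.absorb1)
  finally show ?case .
qed simp

lemma word_triple_normal_form:
  assumes "\<alpha> \<in> lists \<L>" "\<beta> \<in> lists \<L>" "A \<in> \<I>_word \<alpha>" "A \<in> \<I>_word \<beta>"
  shows "word_triple (s_word \<alpha> A @ s_star_word \<beta> A) = triple \<alpha> A \<beta>"
proof -
  have ne: "s_word \<alpha> A \<noteq> []" "s_star_word \<beta> A \<noteq> []" by (cases \<alpha>; simp) (cases \<beta>; simp)
  then have "word_triple (s_word \<alpha> A @ s_star_word \<beta> A) = triple \<alpha> A [] \<bullet> triple [] A \<beta>"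
    using assms set_s_word[of \<alpha> A] set_s_star_word[of \<beta> A]
    by (simp add: word_triple_append word_triple_s_word word_triple_s_star_word)
  then show ?thesis by (simp add: prod_same)
qed

lemma normal_form_mult:
  assumes t: "t \<in> \<S>" and u: "u \<in> \<S>"
  shows "normal_form t \<star> normal_form u \<approx> normal_form (t \<bullet> u)"
proof (cases t)
  case (Triple \<alpha> A \<beta>)
  then have *: "\<alpha> \<in> lists \<L>" "\<beta> \<in> lists \<L>" "A \<in> \<I>_word \<alpha>" "A \<in> \<I>_word \<beta>" "A \<noteq> bot"
    using t by (auto simp: \<S>_def)
  have "s_word \<alpha> A \<noteq> []" by (cases \<alpha>) auto
  moreover have "word_triple (s_word \<alpha> A @ s_star_word \<beta> A) = t"
    using word_triple_normal_form[of \<alpha> \<beta> A] * Triple by (simp add: triple_def)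
  ultimately show ?thesis
    using word_mult_normal_form[of "s_word \<alpha> A @ s_star_word \<beta> A" u] u * Triple
      set_s_word[of \<alpha> A] set_s_star_word[of \<beta> A] by simp
qed simp

end

section \<open>Covers and the presented algebra\<close>

context gbds_coeff
begin

subsection \<open>Joins of normal forms\<close>

lemma normal_form_sandwich:
  assumes "\<alpha> \<in> lists \<L>" "C \<in> \<I>_word \<alpha>" "x \<approx> y"
  shows "normal_form (triple \<alpha> C []) \<star> x \<star> normal_form (triple [] C \<alpha>) \<approx>
    normal_form (triple \<alpha> C []) \<star> y \<star> normal_form (triple [] C \<alpha>)"
  using assms
  by (intro rel_cong_mult_right rel_cong_mult_left normal_form_mem triple_mem_S) auto

lemma normal_form_sandwich_word:
  assumes \<alpha>: "\<alpha> \<in> lists \<L>" "C \<in> \<I>_word \<alpha>" and w: "set w \<subseteq> generators" "w \<noteq> []"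
  shows "normal_form (triple \<alpha> C []) \<star> monomial w \<star> normal_form (triple [] C \<alpha>) \<approx>
    normal_form (triple \<alpha> C [] \<bullet> word_triple w \<bullet> triple [] C \<alpha>)"
proof -
  let ?l = "triple \<alpha> C []" and ?r = "triple [] C \<alpha>"
  have S: "?l \<in> \<S>" "?r \<in> \<S>" "word_triple w \<in> \<S>"
    using \<alpha> w by (auto intro: triple_mem_S word_triple_mem)
  have "normal_form ?l \<star> monomial w \<star> normal_form ?r \<approx> normal_form ?l \<star> normal_form (word_triple w) \<star> normal_form ?r"
    by (rule normal_form_sandwich[OF \<alpha> word_normal_form[OF w]])
  also have "\<dots> \<approx> normal_form (?l \<bullet> word_triple w) \<star> normal_form ?r"
    using S by (intro rel_cong_mult_right normal_form_mult normal_form_mem)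
  also have "\<dots> \<approx> normal_form (?l \<bullet> word_triple w \<bullet> ?r)"
    using S by (intro normal_form_mult) auto
  finally show ?thesis .
qed

lemma normal_form_sup:
  assumes \<alpha>: "\<alpha> \<in> lists \<L>" "sup A B \<in> \<I>_word \<alpha>"
  shows "normal_form (triple \<alpha> (sup A B) \<alpha>) \<approx>
    normal_form (triple \<alpha> A \<alpha>) + normal_form (triple \<alpha> B \<alpha>) - normal_form (triple \<alpha> (inf A B) \<alpha>)"
proof -
  let ?C = "sup A B"
  let ?s = "\<lambda>x. normal_form (triple \<alpha> ?C []) \<star> x \<star> normal_form (triple [] ?C \<alpha>)"
  have p: "?s (p X) \<approx> normal_form (triple \<alpha> X \<alpha>)" if "X \<le> ?C" for X
    using normal_form_sandwich_word[OF \<alpha>, of "[Gen_p X]"] that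
    by (simp add: prod_same generators_intro inf.absorb1 inf.absorb2)
  have "normal_form (triple \<alpha> ?C \<alpha>) \<approx> ?s (p ?C)"
    using rel_cong_sym[OF p] by simp
  also have "\<dots> \<approx> ?s (p A + p B - p (inf A B))"
    by (rule normal_form_sandwich[OF \<alpha> rel_cong_relation[OF relations.p_sup]])
  also have "\<dots> = ?s (p A) + ?s (p B) - ?s (p (inf A B))"
    by (simp add: free_mult_add_left free_mult_add_right free_mult_minus_left free_mult_minus_right)
  also have "\<dots> \<approx> normal_form (triple \<alpha> A \<alpha>) + normal_form (triple \<alpha> B \<alpha>) - normal_form (triple \<alpha> (inf A B) \<alpha>)"
    by (intro rel_cong_minus rel_cong_add p) (auto simp: le_infI1)
  finally show ?thesis .
qed

lemma normal_form_diff: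
  assumes "\<alpha> \<in> lists \<L>" "A \<in> \<I>_word \<alpha>"
  shows "normal_form (triple \<alpha> A \<alpha>) \<approx>
    normal_form (triple \<alpha> (A - B) \<alpha>) + normal_form (triple \<alpha> (inf A B) \<alpha>)"
proof -
  have "inf (A - B) (inf A B) = bot"
    by (rule inf_bot_mono[OF inf_minus[of A B]]) auto
  then show ?thesis
    using normal_form_sup[of \<alpha> "A - B" "inf A B"] assms by (simp add: sup_minus)
qed

lemma normal_form_regular:
  assumes \<alpha>: "\<alpha> \<in> lists \<L>" "A \<in> \<I>_word \<alpha>" and A: "A \<in> regular"
  shows "normal_form (triple \<alpha> A \<alpha>) \<approx>
    (\<Sum>a\<in>\<Delta> A. normal_form (triple (\<alpha> @ [a]) (\<theta> a A) (\<alpha> @ [a])))"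
proof -
  let ?s = "\<lambda>x. normal_form (triple \<alpha> A []) \<star> x \<star> normal_form (triple [] A \<alpha>)"
  have "normal_form (triple \<alpha> A \<alpha>) \<approx> ?s (p A)"
    using rel_cong_sym[OF normal_form_sandwich_word[OF \<alpha>, of "[Gen_p A]"]]
    by (simp add: prod_same generators_intro)
  also have "\<dots> \<approx> ?s (\<Sum>a\<in>\<Delta> A. s a (\<theta> a A) \<star> s_star a (\<theta> a A))"
    by (rule normal_form_sandwich[OF \<alpha> rel_cong_relation[OF relations.p_regular[OF A]]])
  also have "\<dots> = (\<Sum>a\<in>\<Delta> A. ?s (monomial [Gen_s a (\<theta> a A), Gen_s_star a (\<theta> a A)]))"
    by (simp add: free_mult_sum_left free_mult_sum_right)
  also have "\<dots> \<approx> (\<Sum>a\<in>\<Delta> A. normal_form (triple (\<alpha> @ [a]) (\<theta> a A) (\<alpha> @ [a])))"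
  proof (rule rel_cong_sum)
    fix a assume "a \<in> \<Delta> A"
    then have a: "a \<in> \<L>" by (simp add: \<Delta>_def)
    have gen: "Gen_s a (\<theta> a A) \<in> generators" "Gen_s_star a (\<theta> a A) \<in> generators"
      using a range_mem_ideal[OF a order.refl] by (simp_all add: generators_intro)
    have "triple \<alpha> A [] \<bullet> triple [a] (\<theta> a A) [a] \<bullet> triple [] A \<alpha> = triple (\<alpha> @ [a]) (\<theta> a A) (\<alpha> @ [a])"
      using prod_right[of "[a]" \<alpha> A "[]" "\<theta> a A" "[a]"] a
        prod_left[of "[a]" "\<alpha> @ [a]" "\<theta> a A" "[]" A \<alpha>] by simp
    then show "?s (monomial [Gen_s a (\<theta> a A), Gen_s_star a (\<theta> a A)]) \<approx>
        normal_form (triple (\<alpha> @ [a]) (\<theta> a A) (\<alpha> @ [a]))"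
      using normal_form_sandwich_word[OF \<alpha>, of "[Gen_s a (\<theta> a A), Gen_s_star a (\<theta> a A)]"] gen
      by (simp add: prod_same)
  qed
  finally show ?thesis .
qed

subsection \<open>Covers\<close>

text \<open>
  For a set \<open>Z\<close> of idempotents, the left ideal generated by their normal forms, modulo the relations.
  It is spanned by the products with semigroup elements.
\<close>

inductive_set left_span :: "('l, 'b) triple set \<Rightarrow> (('l, 'b) generator list \<Rightarrow>\<^sub>0 'r) set"
  for Z :: "('l, 'b) triple set" where
  base: "x \<approx> 0 \<Longrightarrow> x \<in> left_span Z"
| mult: "\<lbrakk>t \<in> \<S>; z \<in> Z\<rbrakk> \<Longrightarrow> scale c (normal_form (t \<bullet> z)) \<in> left_span Z"
| add: "\<lbrakk>x \<in> left_span Z; y \<in> left_span Z\<rbrakk> \<Longrightarrow> x + y \<in> left_span Z"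

lemma left_span_cong:
  assumes "x \<in> left_span Z" "y \<approx> x"
  shows "y \<in> left_span Z"
proof -
  have "y - x \<approx> 0" using assms(2) by (simp add: rel_cong_def)
  then have "x + (y - x) \<in> left_span Z"
    by (intro left_span.add[OF assms(1)] left_span.base)
  then show ?thesis by simp
qed

lemma left_span_scale: "x \<in> left_span Z \<Longrightarrow> scale r x \<in> left_span Z"
proof (induction rule: left_span.induct)
  case (base x)
  then show ?case using rel_cong_scale[of x 0 r] by (auto intro: left_span.base)
next
  case (mult t z c)
  then show ?case using left_span.mult[of t z Z "r * c"] by (simp add: scale_scale)
qed (simp add: scale_add left_span.add)

lemma left_span_minus: "\<lbrakk>x \<in> left_span Z; y \<in> left_span Z\<rbrakk> \<Longrightarrow> x - y \<in> left_span Z"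
  using left_span.add[of x Z "scale (- 1) y"] by (simp add: left_span_scale) (simp add: scale_uminus_one)

lemma left_span_sum: "(\<And>i. i \<in> I \<Longrightarrow> x i \<in> left_span Z) \<Longrightarrow> (\<Sum>i\<in>I. x i) \<in> left_span Z"
  by (induction I rule: infinite_finite_induct) (auto intro: left_span.add left_span.base)

lemma left_span_normal_form: "\<lbrakk>t \<in> \<S>; z \<in> Z\<rbrakk> \<Longrightarrow> normal_form (t \<bullet> z) \<in> left_span Z"
  using left_span.mult[of t z Z 1] by (simp add: scale_one)

lemma left_span_empty: "x \<in> left_span {} \<Longrightarrow> x \<approx> 0"
proof (induction rule: left_span.induct)
  case (add x y)
  then show ?case using rel_cong_add[of x 0 y 0] by simp
qed auto

lemma E_prod_right_commute:
  "\<lbrakk>t \<in> \<S>; x \<in> E; y \<in> E\<rbrakk> \<Longrightarrow> t \<bullet> x \<bullet> y = t \<bullet> y \<bullet> x"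
  using E_commute[of x y] by (simp add: prod_assoc E_subset_S)

lemma scaled_normal_form_mult:
  "\<lbrakk>t \<in> \<S>; u \<in> \<S>\<rbrakk> \<Longrightarrow> scale c (normal_form t) \<star> normal_form u \<approx> scale c (normal_form (t \<bullet> u))"
  by (simp add: scale_free_mult_left rel_cong_scale normal_form_mult)

lemma left_span_mult_right:
  assumes "x \<in> left_span Z" "Z \<subseteq> E" "e \<in> E"
  shows "x \<star> normal_form e \<in> left_span Z"
  using assms(1)
proof (induction rule: left_span.induct)
  case (base x)
  then show ?case
    using rel_cong_mult_right[of x 0 "normal_form e"] assms(3)
    by (auto intro!: left_span.base simp: normal_form_mem E_subset_S)
next
  case (mult t z c)
  then have z: "z \<in> E" using assms(2) by auto
  have "scale c (normal_form (t \<bullet> z)) \<star> normal_form e \<approx> scale c (normal_form (t \<bullet> e \<bullet> z))"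
    using scaled_normal_form_mult[of "t \<bullet> z" e c] mult z assms(3)
    by (simp add: E_subset_S E_prod_right_commute[of t z e])
  moreover have "scale c (normal_form (t \<bullet> e \<bullet> z)) \<in> left_span Z"
    using mult assms(3) by (intro left_span.mult) (auto simp: E_subset_S)
  ultimately show ?case by (rule left_span_cong[rotated])
qed (simp add: free_mult_add_left left_span.add)

lemma left_span_insert:
  assumes "x \<in> left_span (insert e Z)" "Z \<subseteq> E" "e \<in> E"
  shows "x - x \<star> normal_form e \<in> left_span Z"
  using assms(1)
proof (induction rule: left_span.induct)
  case (base x)
  then show ?case
    using left_span_mult_right[OF left_span.base assms(2,3)] by (blast intro: left_span_minus left_span.base)
next
  case (mult t z c)
  show ?case
  proof (cases "z = e")
    case True
    have "scale c (normal_form (t \<bullet> e)) \<star> normal_form e \<approx> scale c (normal_form (t \<bullet> e))"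
      using scaled_normal_form_mult[of "t \<bullet> e" e c] mult assms(3)
      by (simp add: E_subset_S prod_assoc E_idem)
    from rel_cong_minus[OF rel_cong_refl[of "scale c (normal_form (t \<bullet> e))"] this]
    show ?thesis using True by (simp add: left_span.base)
  next
    case False
    then have "scale c (normal_form (t \<bullet> z)) \<in> left_span Z" using mult by (simp add: left_span.mult)
    then show ?thesis using left_span_mult_right[OF _ assms(2,3)] left_span_minus by blast
  qed
next
  case (add x y)
  have "x + y - (x + y) \<star> normal_form e = (x - x \<star> normal_form e) + (y - y \<star> normal_form e)"
    by (simp add: free_mult_add_left)
  then show ?case using left_span.add[OF add.IH] by (simp only:)
qed

text \<open>
  The part of \<open>A\<close> lying over members of \<open>Z\<close> with words that are prefixes of \<open>\<alpha>\<close>: it is in the left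
  ideal, and its complement in \<open>A\<close> does not meet any of these members.
\<close>

lemma ex_prefix_part:
  assumes \<alpha>: "\<alpha> \<in> lists \<L>" "A \<in> \<I>_word \<alpha>" and Z: "Z \<subseteq> E" and "finite Y" "Y \<subseteq> Z"
  shows "\<exists>B. normal_form (triple \<alpha> (inf A B) \<alpha>) \<in> left_span Z \<and>
    (\<forall>\<gamma> \<mu> C. \<alpha> = \<gamma> @ \<mu> \<and> triple \<gamma> C \<gamma> \<in> Y \<longrightarrow> inf (A - B) (\<theta>_word \<mu> C) = bot)"
  using assms(4,5)
proof induction
  case empty
  show ?case by (intro exI[of _ bot]) (simp add: left_span.base)
next
  case (insert z Y)
  then obtain B where B: "normal_form (triple \<alpha> (inf A B) \<alpha>) \<in> left_span Z"
    "\<forall>\<gamma> \<mu> C. \<alpha> = \<gamma> @ \<mu> \<and> triple \<gamma> C \<gamma> \<in> Y \<longrightarrow> inf (A - B) (\<theta>_word \<mu> C) = bot"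
    by auto
  have "z \<in> E" "z \<in> Z" using insert.prems Z by auto
  then obtain \<delta> F where z: "z = triple \<delta> F \<delta>" "\<delta> \<in> lists \<L>" by (metis E_cases)
  have eqD: "C = bot \<or> (\<gamma> = \<delta> \<and> C = F)" if "triple \<gamma> C \<gamma> = triple \<delta> F \<delta>" for \<gamma> C
    using that by (auto simp: triple_def split: if_splits)
  have words: "\<mu> \<in> lists \<L>" if "\<alpha> = \<gamma> @ \<mu>" for \<gamma> \<mu> using \<alpha> that by simp
  show ?case
  proof (cases "\<exists>\<mu>. \<alpha> = \<delta> @ \<mu>")
    case True
    then obtain \<mu> where \<mu>: "\<alpha> = \<delta> @ \<mu>" by blast
    let ?F = "\<theta>_word \<mu> F"
    have prod: "triple \<alpha> X \<alpha> \<bullet> z = triple \<alpha> (inf X ?F) \<alpha>" for X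
      using prod_left[OF words[OF \<mu>], of \<alpha> X \<delta> F \<delta>] \<mu> z by simp
    have mem: "inf A X \<in> \<I>_word \<alpha>" for X using \<alpha> by (auto intro: inf_mem_\<I>_word)
    have part: "normal_form (triple \<alpha> (inf (inf A X) ?F) \<alpha>) \<in> left_span Z" for X
      using left_span_normal_form[of "triple \<alpha> (inf A X) \<alpha>" z Z] \<open>z \<in> Z\<close> \<alpha> mem
      by (simp add: prod triple_mem_S)
    have eq: "inf A (sup B ?F) = sup (inf A B) (inf A ?F)" by (rule inf_sup_distrib1)
    have "normal_form (triple \<alpha> (inf A (sup B ?F)) \<alpha>) \<approx> normal_form (triple \<alpha> (inf A B) \<alpha>) +
        normal_form (triple \<alpha> (inf A ?F) \<alpha>) - normal_form (triple \<alpha> (inf (inf A B) (inf A ?F)) \<alpha>)"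
      unfolding eq using \<alpha> mem[of "sup B ?F"] by (intro normal_form_sup) (simp_all add: eq)
    moreover have "normal_form (triple \<alpha> (inf A ?F) \<alpha>) \<in> left_span Z"
      using part[of A] by simp
    moreover have "normal_form (triple \<alpha> (inf (inf A B) (inf A ?F)) \<alpha>) \<in> left_span Z"
    proof -
      have "inf (inf A B) (inf A ?F) = inf (inf A B) ?F" by (simp add: inf.assoc inf.left_commute)
      then show ?thesis using part[of B] by simp
    qed
    ultimately have "normal_form (triple \<alpha> (inf A (sup B ?F)) \<alpha>) \<in> left_span Z"
      using left_span_cong left_span_minus left_span.add B(1) by metis
    moreover have "inf (A - sup B ?F) (\<theta>_word \<nu> C) = bot"
      if h: "\<alpha> = \<gamma> @ \<nu>" "triple \<gamma> C \<gamma> \<in> insert z Y" for \<gamma> \<nu> C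
    proof (cases "triple \<gamma> C \<gamma> \<in> Y")
      case True
      then have "inf (A - B) (\<theta>_word \<nu> C) = bot" using B(2) h by blast
      then show ?thesis by (rule inf_bot_mono) (simp_all add: gba_minus_sup)
    next
      case False
      then consider "C = bot" | "\<gamma> = \<delta>" "C = F" using h eqD z by auto
      then show ?thesis
      proof cases
        case 1
        then show ?thesis using words[OF h(1)] by (simp add: \<theta>_word_simps)
      next
        case 2
        then have "\<nu> = \<mu>" using h \<mu> by simp
        then show ?thesis using 2 inf_bot_mono[OF inf_minus[of A "sup B ?F"], of "A - sup B ?F" ?F] by simp
      qed
    qed
    ultimately show ?thesis by (intro exI[of _ "sup B ?F"]) blast
  next
    case False
    have "inf (A - B) (\<theta>_word \<nu> C) = bot"
      if "\<alpha> = \<gamma> @ \<nu>" "triple \<gamma> C \<gamma> \<in> insert z Y" for \<gamma> \<nu> C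
    proof (cases "triple \<gamma> C \<gamma> \<in> Y")
      case True
      then show ?thesis using B(2) that by blast
    next
      case notY: False
      then have "C = bot" using that eqD z False by auto
      then show ?thesis using words[OF that(1)] by (simp add: \<theta>_word_simps)
    qed
    then show ?thesis using B(1) by blast
  qed
qed

text \<open>The left word of a semigroup element, with a dummy value at the zero.\<close>

fun word_of :: "('l, 'b) triple \<Rightarrow> 'l list" where
  "word_of Zero = []"
| "word_of (Triple \<alpha> A \<beta>) = \<alpha>"

text \<open>
  The left ideal of a finite cover contains the covered idempotent. The set \<open>Z\<close> is kept fixed, and the
  induction is on a bound \<open>n\<close> on how much longer than \<open>\<alpha>\<close> the words of those members of \<open>Z\<close> can be that
  meet \<open>(\<alpha>, A, \<alpha>)\<close>.
\<close>

lemma cover_left_span: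
  assumes Z: "finite Z" "Z \<subseteq> E"
    and \<alpha>: "\<alpha> \<in> lists \<L>" "A \<in> \<I>_word \<alpha>"
    and len: "\<And>z. z \<in> Z \<Longrightarrow> triple \<alpha> A \<alpha> \<bullet> z \<noteq> Zero \<Longrightarrow> length (word_of z) \<le> length \<alpha> + n"
    and cover: "\<And>y. \<lbrakk>y \<in> E; y \<noteq> Zero; y \<preceq> triple \<alpha> A \<alpha>\<rbrakk> \<Longrightarrow> \<exists>z\<in>Z. y \<bullet> z \<noteq> Zero"
  shows "normal_form (triple \<alpha> A \<alpha>) \<in> left_span Z"
  using \<alpha> len cover
proof (induction n arbitrary: \<alpha> A rule: less_induct)
  case (less n)
  note \<alpha> = less.prems(1,2) and len = less.prems(3) and cover = less.prems(4)
  let ?x = "triple \<alpha> A \<alpha>"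
  have xE: "?x \<in> E" using \<alpha> by (rule triple_mem_E)
  obtain B where B: "normal_form (triple \<alpha> (inf A B) \<alpha>) \<in> left_span Z"
    "\<And>\<gamma> \<mu> C. \<alpha> = \<gamma> @ \<mu> \<Longrightarrow> triple \<gamma> C \<gamma> \<in> Z \<Longrightarrow> inf (A - B) (\<theta>_word \<mu> C) = bot"
    using ex_prefix_part[OF \<alpha> Z(2,1)] by blast
  let ?A = "A - B"
  have le: "?A \<le> A" by (rule gba_minus_le)
  have A': "?A \<in> \<I>_word \<alpha>" using \<alpha>(2) le by (rule \<I>_word_downward)
  have below: "?x \<bullet> z \<noteq> Zero" if "y \<in> E" "y \<preceq> ?x" "z \<in> Z" "y \<bullet> z \<noteq> Zero" for y z
  proof
    assume "?x \<bullet> z = Zero"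
    moreover have "y \<bullet> z = y \<bullet> (?x \<bullet> z)"
      using that xE Z(2) prod_assoc[of y ?x z] by (auto simp: E_le_def E_subset_S)
    ultimately show False using that by simp
  qed
  \<comment> \<open>A member of \<open>Z\<close> meeting \<open>(\<alpha>, C, \<alpha>)\<close> has a word properly extending \<open>\<alpha>\<close>; its next letter is in \<open>\<Delta> C\<close>.\<close>
  have extend: "\<exists>a\<in>\<Delta> C. 0 < n" if C: "C \<noteq> bot" "C \<le> ?A" for C
  proof -
    have CI: "C \<in> \<I>_word \<alpha>" using A' C(2) by (rule \<I>_word_downward)
    let ?y = "triple \<alpha> C \<alpha>"
    have y: "?y \<in> E" "?y \<noteq> Zero" using \<alpha>(1) CI C by (auto intro: triple_mem_E)
    have "?y \<preceq> ?x" using E_le_triple_iff[OF \<alpha>(1) \<alpha>(1) C(1), of A] C(2) le by auto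
    then obtain z where z: "z \<in> Z" "?y \<bullet> z \<noteq> Zero" using cover y by blast
    then obtain \<gamma> F where z': "z = triple \<gamma> F \<gamma>" "\<gamma> \<in> lists \<L>" using Z(2) by (metis E_cases subsetD)
    have F: "F \<noteq> bot" using z z' by auto
    show ?thesis
    proof (cases \<gamma> \<alpha> rule: word_cases)
      case (left \<mu>)
      then have "\<mu> \<in> lists \<L>" using \<alpha>(1) by simp
      then have "?y \<bullet> z = triple \<alpha> (inf C (\<theta>_word \<mu> F)) \<alpha>"
        using prod_left[of \<mu> \<alpha> C \<gamma> F \<gamma>] left z' by simp
      moreover have "inf C (\<theta>_word \<mu> F) = bot"
        using inf_bot_mono[OF B(2)[OF left, of F]] z z' C(2) by simp
      ultimately show ?thesis using z by simp
    next
      case (right \<nu>)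
      have "\<nu> \<noteq> []"
      proof
        assume "\<nu> = []"
        then have "?y \<bullet> z = triple \<alpha> (inf C F) \<alpha>" using right z' by (simp add: prod_same)
        moreover have "inf C (\<theta>_word [] F) = bot"
          using inf_bot_mono[OF B(2)[of \<gamma> "[]" F]] right \<open>\<nu> = []\<close> z z' C(2) by simp
        ultimately show False using z by simp
      qed
      then obtain a \<nu>' where \<nu>: "\<nu> = a # \<nu>'" by (cases \<nu>) auto
      then have a: "a \<in> \<L>" "\<nu>' \<in> lists \<L>" using right z' by auto
      have "?y \<bullet> z = triple \<gamma> (inf (\<theta>_word \<nu> C) F) \<gamma>"
        using prod_right[of \<nu> \<alpha> C \<alpha> F \<gamma>] right z' a \<nu> by simp
      moreover have "\<theta>_word \<nu> C = bot" if "\<theta> a C = bot"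
        using that a \<nu> by (simp add: \<theta>_word_simps(1))
      ultimately have "\<theta> a C \<noteq> bot" using z(2) by auto
      then have "a \<in> \<Delta> C" using a by (simp add: \<Delta>_def)
      moreover have "length \<gamma> \<le> length \<alpha> + n"
        using len[OF z(1) below[OF y(1) \<open>?y \<preceq> ?x\<close> z]] z' F by (simp add: triple_def)
      ultimately show ?thesis using right \<nu> by auto
    qed (use z z' in \<open>simp add: prod_parallel\<close>)
  qed
  have next_le: "triple (\<alpha> @ [a]) (\<theta> a C) (\<alpha> @ [a]) \<preceq> ?x" if "a \<in> \<Delta> C" "C \<le> A" for a C
    using that E_le_triple_iff[of \<alpha> "\<alpha> @ [a]" "\<theta> a C" A] \<alpha>(1) \<theta>_word_mono[of "[a]" C A]
    by (auto simp: \<Delta>_def)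
  have next_mem: "\<theta> a C \<in> \<I>_word (\<alpha> @ [a])" if "a \<in> \<Delta> C" "C \<le> A" for a C
    using \<I>_word_append[OF \<I>_word_downward[OF \<alpha>(2) that(2)] \<alpha>(1), of "[a]"] that by (auto simp: \<Delta>_def)
  \<comment> \<open>The letters in question are read off from the members of \<open>Z\<close>, so they are finite in number.\<close>
  have letters: "\<Delta> C \<subseteq> (\<lambda>z. word_of z ! length \<alpha>) ` Z" if C: "C \<le> ?A" for C
  proof
    fix a assume a: "a \<in> \<Delta> C"
    then have aL: "a \<in> \<L>" "\<theta> a C \<noteq> bot" by (auto simp: \<Delta>_def)
    have CA: "C \<le> A" using C le by (rule order.trans)
    let ?y = "triple (\<alpha> @ [a]) (\<theta> a C) (\<alpha> @ [a])"
    have "?y \<in> E" "?y \<noteq> Zero" using \<alpha>(1) aL next_mem[OF a CA] by (simp_all add: triple_mem_E)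
    then obtain z where z: "z \<in> Z" "?y \<bullet> z \<noteq> Zero" using cover next_le[OF a CA] by blast
    then obtain \<gamma> F where z': "z = triple \<gamma> F \<gamma>" "\<gamma> \<in> lists \<L>" using Z(2) by (metis E_cases subsetD)
    have F: "F \<noteq> bot" using z z' by auto
    have "\<gamma> ! length \<alpha> = a"
    proof (cases \<gamma> "\<alpha> @ [a]" rule: word_cases)
      case (left \<mu>)
      show ?thesis
      proof (cases \<mu> rule: rev_cases)
        case Nil
        then have "\<gamma> = \<alpha> @ [a]" using left by simp
        then show ?thesis by simp
      next
        case (snoc \<mu>' b)
        then have \<mu>': "\<alpha> = \<gamma> @ \<mu>'" "b = a" "\<mu> = \<mu>' @ [a]" using left by auto
        have "?y \<bullet> z = triple (\<alpha> @ [a]) (inf (\<theta> a C) (\<theta>_word \<mu> F)) (\<alpha> @ [a])"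
          using prod_left[of \<mu> "\<alpha> @ [a]" "\<theta> a C" \<gamma> F \<gamma>] left z' \<alpha>(1) aL \<mu>' by simp
        also have "inf (\<theta> a C) (\<theta>_word \<mu> F) = \<theta> a (inf C (\<theta>_word \<mu>' F))"
          using aL \<mu>' by (simp add: \<theta>_simps \<theta>_word_append)
        also have "inf C (\<theta>_word \<mu>' F) = bot"
          using inf_bot_mono[OF B(2)[OF \<mu>'(1), of F]] z z' C by simp
        finally show ?thesis using z aL by (simp add: \<theta>_simps)
      qed
    next
      case (right \<nu>)
      then show ?thesis by simp
    qed (use z z' in \<open>simp add: prod_parallel\<close>)
    then show "a \<in> (\<lambda>z. word_of z ! length \<alpha>) ` Z"
      using z(1) z' F by (intro image_eqI[of _ _ z]) (auto simp: triple_def)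
  qed
  have regular: "?A \<in> regular"
    unfolding regular_def
  proof (intro CollectI allI impI conjI)
    fix C assume C: "C \<noteq> bot \<and> C \<le> ?A"
    then show "\<Delta> C \<noteq> {}" using extend by blast
    show "finite (\<Delta> C)" using C letters[of C] Z(1) by (blast intro: finite_subset finite_imageI)
  qed
  have "normal_form (triple (\<alpha> @ [a]) (\<theta> a ?A) (\<alpha> @ [a])) \<in> left_span Z" if a: "a \<in> \<Delta> ?A" for a
  proof -
    have aL: "a \<in> \<L>" "\<theta> a ?A \<noteq> bot" using a by (auto simp: \<Delta>_def)
    then have "?A \<noteq> bot" using \<theta>_simps(1) by metis
    then have n: "0 < n" using extend[of ?A] by auto
    let ?y = "triple (\<alpha> @ [a]) (\<theta> a ?A) (\<alpha> @ [a])"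
    have yE: "?y \<in> E" using \<alpha>(1) aL next_mem[OF a le] by (simp add: triple_mem_E)
    show ?thesis
    proof (rule less.IH[of "n - 1"])
      show "\<alpha> @ [a] \<in> lists \<L>" using \<alpha>(1) aL by simp
      show "length (word_of z) \<le> length (\<alpha> @ [a]) + (n - 1)" if "z \<in> Z" "?y \<bullet> z \<noteq> Zero" for z
        using len[OF that(1) below[OF yE next_le[OF a le] that]] n by simp
      show "\<exists>z\<in>Z. y \<bullet> z \<noteq> Zero" if "y \<in> E" "y \<noteq> Zero" "y \<preceq> ?y" for y
        using cover[OF that(1,2)] E_le_trans[OF that(1) yE xE that(3) next_le[OF a le]] by blast
    qed (use n next_mem[OF a le] in auto)
  qed
  then have "normal_form (triple \<alpha> ?A \<alpha>) \<in> left_span Z"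
    by (intro left_span_cong[OF left_span_sum normal_form_regular[OF \<alpha>(1) A' regular]])
  then show ?case
    using B(1) by (intro left_span_cong[OF left_span.add normal_form_diff[OF \<alpha>]])
qed

subsection \<open>Linear relations between indicators\<close>

text \<open>
  A function \<open>r + \<Sum>\<^sub>i c\<^sub>i e\<^sub>i\<close> that vanishes at all tight filters containing \<open>x\<close> and disjoint from \<open>Z\<close> is
  zero, after multiplication by \<open>x\<close>, modulo the left ideal of \<open>Z\<close>. The induction step splits off a
  summand \<open>e\<^sub>j\<close> by replacing \<open>x\<close> by \<open>x e\<^sub>j\<close> on the one hand and adding \<open>e\<^sub>j\<close> to \<open>Z\<close> on the other. For the
  empty sum, either \<open>Z\<close> covers \<open>x\<close> or some tight filter shows \<open>r = 0\<close>.
\<close>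

lemma vanishing_left_span:
  fixes e :: "'i \<Rightarrow> ('l, 'b) triple" and c :: "'i \<Rightarrow> 'r"
  assumes "finite I" "\<And>i. i \<in> I \<Longrightarrow> e i \<in> E"
    and "x \<in> E" "finite Z" "Z \<subseteq> E"
    and "\<And>\<xi>. \<lbrakk>\<xi> \<in> tight_filters; x \<in> \<xi>; Z \<inter> \<xi> = {}\<rbrakk> \<Longrightarrow>
      r + (\<Sum>i\<in>I. if e i \<in> \<xi> then c i else 0) = 0"
  shows "scale r (normal_form x) + (\<Sum>i\<in>I. scale (c i) (normal_form (x \<bullet> e i))) \<in> left_span Z"
  using assms
proof (induction I arbitrary: x Z r rule: finite_induct)
  case empty
  show ?case
  proof (cases "\<forall>y\<in>E. y \<noteq> Zero \<and> y \<preceq> x \<longrightarrow> (\<exists>z\<in>Z. y \<bullet> z \<noteq> Zero)")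
    case True
    obtain \<alpha> A where x: "x = triple \<alpha> A \<alpha>" "\<alpha> \<in> lists \<L>" "A \<in> \<I>_word \<alpha>"
      using \<open>x \<in> E\<close> by (rule E_cases)
    have "length (word_of z) \<le> length \<alpha> + (\<Sum>z\<in>Z. length (word_of z))" if "z \<in> Z" for z
      using member_le_sum[OF that, of "\<lambda>z. length (word_of z)"] \<open>finite Z\<close> by simp
    then have "normal_form x \<in> left_span Z"
      unfolding x(1) using empty x True
      by (intro cover_left_span[where n = "\<Sum>z\<in>Z. length (word_of z)"]) auto
    then show ?thesis by (simp add: left_span_scale)
  next
    case False
    then obtain y where y: "y \<in> E" "y \<noteq> Zero" "y \<preceq> x" "\<forall>z\<in>Z. y \<bullet> z = Zero" by blast
    obtain \<xi> where \<xi>: "\<xi> \<in> tight_filters" "y \<in> \<xi>" using ex_tight_filter[OF y(1,2)] by blast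
    have "x \<in> \<xi>" using tight_filter_upward[OF \<xi> \<open>x \<in> E\<close> y(3)] .
    moreover have "z \<notin> \<xi>" if "z \<in> Z" for z
    proof
      assume "z \<in> \<xi>"
      then have "y \<bullet> z \<in> \<xi>" using tight_filter_prod_iff[OF \<xi>(1) y(1)] \<xi>(2) that empty.prems by blast
      then show False using y(4) that tight_filter_Zero[OF \<xi>(1)] by simp
    qed
    ultimately have "r = 0" using empty.prems(5)[OF \<xi>(1)] by auto
    moreover have "scale 0 (normal_form x) \<in> left_span Z"
      unfolding scale_0 by (simp add: left_span.base)
    ultimately show ?thesis by (simp only: sum.empty add_0_right)
  qed
next
  case (insert j I)
  let ?n = "normal_form"
  let ?G = "\<lambda>r x. scale r (?n x) + (\<Sum>i\<in>I. scale (c i) (?n (x \<bullet> e i)))"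
  have E: "e j \<in> E" "\<And>i. i \<in> I \<Longrightarrow> e i \<in> E" "x \<in> E" using insert.prems by auto
  note S = E[THEN E_subset_S]
  have 1: "?G (r + c j) (x \<bullet> e j) \<in> left_span Z"
  proof (rule insert.IH)
    show "r + c j + (\<Sum>i\<in>I. if e i \<in> \<xi> then c i else 0) = 0"
      if "\<xi> \<in> tight_filters" "x \<bullet> e j \<in> \<xi>" "Z \<inter> \<xi> = {}" for \<xi>
    proof -
      have "x \<in> \<xi>" "e j \<in> \<xi>" using that tight_filter_prod_iff[OF that(1) E(3,1)] by auto
      then show ?thesis using insert.prems(5)[OF that(1) _ that(3)] insert.hyps by (simp add: add.assoc)
    qed
  qed (use insert.prems in auto)
  have 2: "?G r x \<in> left_span (insert (e j) Z)"
  proof (rule insert.IH)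
    show "r + (\<Sum>i\<in>I. if e i \<in> \<xi> then c i else 0) = 0"
      if "\<xi> \<in> tight_filters" "x \<in> \<xi>" "insert (e j) Z \<inter> \<xi> = {}" for \<xi>
      using insert.prems(5)[OF that(1,2)] that(3) insert.hyps by simp
  qed (use insert.prems in auto)
  have "?G r x \<star> ?n (e j) = scale r (?n x) \<star> ?n (e j) + (\<Sum>i\<in>I. scale (c i) (?n (x \<bullet> e i)) \<star> ?n (e j))"
    by (simp add: free_mult_add_left free_mult_sum_left)
  also have "\<dots> \<approx> ?G r (x \<bullet> e j)"
  proof (intro rel_cong_add rel_cong_sum)
    show "scale r (?n x) \<star> ?n (e j) \<approx> scale r (?n (x \<bullet> e j))"
      using S by (intro scaled_normal_form_mult)
    show "scale (c i) (?n (x \<bullet> e i)) \<star> ?n (e j) \<approx> scale (c i) (?n (x \<bullet> e j \<bullet> e i))" if "i \<in> I" for i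
      using scaled_normal_form_mult[of "x \<bullet> e i" "e j" "c i"] S that
        E_prod_right_commute[of x "e i" "e j"] E by simp
  qed
  finally have mult: "?G r x \<star> ?n (e j) \<approx> ?G r (x \<bullet> e j)" .
  have "?G r x \<star> ?n (e j) + scale (c j) (?n (x \<bullet> e j)) \<approx> ?G (r + c j) (x \<bullet> e j)"
    using rel_cong_add[OF mult rel_cong_refl[of "scale (c j) (?n (x \<bullet> e j))"]]
    by (simp add: scale_add_left add_ac)
  then have 3: "?G r x \<star> ?n (e j) + scale (c j) (?n (x \<bullet> e j)) \<in> left_span Z"
    using 1 by (rule left_span_cong[rotated])
  have 4: "?G r x - ?G r x \<star> ?n (e j) \<in> left_span Z"
    using left_span_insert[OF 2 insert.prems(4) E(1)] .
  have "scale r (?n x) + (\<Sum>i\<in>insert j I. scale (c i) (?n (x \<bullet> e i))) =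
      (?G r x - ?G r x \<star> ?n (e j)) + (?G r x \<star> ?n (e j) + scale (c j) (?n (x \<bullet> e j)))"
    using insert.hyps by (simp add: add_ac)
  then show ?case using left_span.add[OF 4 3] by (simp only:)
qed

text \<open>
  An element of the form \<open>\<Sum>\<^sub>k e\<^sub>k y\<^sub>k\<close> with commuting idempotents \<open>e\<^sub>k\<close> vanishes as soon as all \<open>e\<^sub>k\<close>
  annihilate it: multiply by the product of the \<open>1 - e\<^sub>k\<close>.
\<close>

lemma annihilated_by_idempotents:
  assumes "finite I" "\<And>i. i \<in> I \<Longrightarrow> e i \<in> E"
    and h: "\<And>i. i \<in> I \<Longrightarrow> normal_form (e i) \<star> h \<approx> 0"
    and "\<And>i. i \<in> I \<Longrightarrow> y i \<in> carrier (free_algebra generators)"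
    and "h \<approx> (\<Sum>i\<in>I. normal_form (e i) \<star> y i)"
  shows "h \<approx> 0"
  using assms
proof (induction I arbitrary: y rule: finite_induct)
  case empty
  then show ?case by simp
next
  case (insert j I)
  let ?n = "\<lambda>i. normal_form (e i)"
  have E: "e j \<in> E" "\<And>i. i \<in> I \<Longrightarrow> e i \<in> E" using insert.prems by auto
  have nF: "?n i \<in> carrier (free_algebra generators)" if "i \<in> insert j I" for i
    using that insert.prems(1) by (intro normal_form_mem E_subset_S)
  interpret F: nonunital_algebra "free_algebra generators :: ('r, _) module"
    by (rule nonunital_algebra_free_algebra)
  have yF: "y i \<in> carrier (free_algebra generators)" if "i \<in> insert j I" for i
    using that insert.prems(3) by blast
  define y' where "y' i = y i - ?n j \<star> y i" for i
  have "?n j \<star> y i \<in> carrier (free_algebra generators)" if "i \<in> insert j I" for i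
    using F.m_closed[OF nF yF] that by (simp add: free_algebra_simps)
  then have y'F: "y' i \<in> carrier (free_algebra generators)" if "i \<in> I" for i
    using that yF unfolding y'_def by (intro free_algebra_minus_mem) auto
  have comm: "?n j \<star> (?n i \<star> z) \<approx> ?n i \<star> (?n j \<star> z)"
    if "i \<in> insert j I" "z \<in> carrier (free_algebra generators)" for i z
  proof -
    have S: "e i \<in> \<S>" "e j \<in> \<S>" using that E E_subset_S by auto
    have "?n j \<star> ?n i \<approx> normal_form (e j \<bullet> e i)" using S by (intro normal_form_mult)
    also have "e j \<bullet> e i = e i \<bullet> e j" using that E by (auto intro: E_commute)
    also have "normal_form (e i \<bullet> e j) \<approx> ?n i \<star> ?n j" using S by (intro rel_cong_sym[OF normal_form_mult])
    finally show ?thesis using rel_cong_mult_right[OF _ that(2)] by (simp flip: free_mult_assoc)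
  qed
  have idem: "?n j \<star> (?n j \<star> z) \<approx> ?n j \<star> z" if "z \<in> carrier (free_algebra generators)" for z
    using rel_cong_mult_right[OF normal_form_mult that, of "e j" "e j"] E
    by (simp add: E_subset_S E_idem free_mult_assoc)
  \<comment> \<open>Multiplication by \<open>1 - e\<^sub>j\<close> fixes \<open>h\<close> and removes the summand of \<open>j\<close>.\<close>
  let ?h = "\<Sum>i\<in>insert j I. ?n i \<star> y i"
  have "h \<approx> h - ?n j \<star> h"
    using rel_cong_sym[OF rel_cong_minus[OF rel_cong_refl[of h] insert.prems(2)[of j]]] by simp
  also have "\<dots> \<approx> ?h - ?n j \<star> ?h"
    using insert.prems(4) nF by (intro rel_cong_minus rel_cong_mult_left) auto
  also have "\<dots> = (?n j \<star> y j - ?n j \<star> (?n j \<star> y j)) + (\<Sum>i\<in>I. ?n i \<star> y i - ?n j \<star> (?n i \<star> y i))"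
    using insert.hyps by (simp add: free_mult_add_right free_mult_sum_right sum_subtractf)
  also have "\<dots> \<approx> (?n j \<star> y j - ?n j \<star> y j) + (\<Sum>i\<in>I. ?n i \<star> y i - ?n i \<star> (?n j \<star> y i))"
    using yF by (intro rel_cong_add rel_cong_minus rel_cong_sum idem comm rel_cong_refl) auto
  also have "\<dots> = (\<Sum>i\<in>I. ?n i \<star> y' i)"
    by (simp add: y'_def free_mult_minus_right)
  finally show ?case
    using insert.prems y'F by (intro insert.IH[of y']) auto
qed

text \<open>
  Linear relations in one degree. With \<open>e\<^sub>i = t\<^sub>i t\<^sub>i\<^sup>*\<close>, multiplying \<open>\<Sum>\<^sub>i c\<^sub>i t\<^sub>i\<close> by \<open>e\<^sub>k\<close> gives
  \<open>(\<Sum>\<^sub>i c\<^sub>i e\<^sub>k e\<^sub>i) t\<^sub>k\<close>, whose first factor vanishes by the relation between the idempotents \<open>e\<^sub>i\<close>.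
\<close>

lemma graded_relation:
  fixes t :: "'i \<Rightarrow> ('l, 'b) triple" and c :: "'i \<Rightarrow> 'r"
  assumes I: "finite I" and t: "\<And>i. i \<in> I \<Longrightarrow> t i \<in> \<S> - {Zero}" and g: "\<And>i. i \<in> I \<Longrightarrow> grade (t i) = g"
    and vanish: "\<And>\<xi>. \<xi> \<in> tight_filters \<Longrightarrow> (\<Sum>i\<in>I. if t i \<bullet> star (t i) \<in> \<xi> then c i else 0) = 0"
  shows "(\<Sum>i\<in>I. scale (c i) (normal_form (t i))) \<approx> 0"
proof -
  define e where "e i = t i \<bullet> star (t i)" for i
  have tS: "t i \<in> \<S>" if "i \<in> I" for i using t that by blast
  have E: "e i \<in> E" if "i \<in> I" for i using tS that by (auto simp: e_def)
  note eS = E_subset_S[OF E]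
  let ?h = "\<Sum>i\<in>I. scale (c i) (normal_form (t i))"
  show ?thesis
  proof (rule annihilated_by_idempotents[OF I])
    show "e i \<in> E" if "i \<in> I" for i using E that .
    show "scale (c i) (normal_form (t i)) \<in> carrier (free_algebra generators)" if "i \<in> I" for i
      using normal_form_mem[OF tS[OF that]]
        nonunital_algebra.smult_closed[OF nonunital_algebra_free_algebra, of "normal_form (t i)" generators "c i"]
      by (simp add: free_algebra_simps)
    have "scale (c i) (normal_form (t i)) \<approx> normal_form (e i) \<star> scale (c i) (normal_form (t i))" if "i \<in> I" for i
      using rel_cong_sym[OF rel_cong_scale[OF normal_form_mult[OF eS[OF that] tS[OF that]]], of "c i"]
        prod_star_prod[OF tS[OF that]] by (simp add: e_def scale_free_mult_right)
    then show "?h \<approx> (\<Sum>i\<in>I. normal_form (e i) \<star> scale (c i) (normal_form (t i)))"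
      by (rule rel_cong_sum)
    show "normal_form (e k) \<star> ?h \<approx> 0" if k: "k \<in> I" for k
    proof -
      have "normal_form (e k) \<star> ?h = (\<Sum>i\<in>I. scale (c i) (normal_form (e k) \<star> normal_form (t i)))"
        by (simp add: free_mult_sum_right scale_free_mult_right)
      also have "\<dots> \<approx> (\<Sum>i\<in>I. scale (c i) (normal_form (e k \<bullet> t i)))"
        using k tS eS by (intro rel_cong_sum rel_cong_scale normal_form_mult) auto
      also have "\<dots> = (\<Sum>i\<in>I. scale (c i) (normal_form (e k \<bullet> e i \<bullet> t k)))"
      proof (intro sum.cong refl)
        fix i assume i: "i \<in> I"
        have "e k \<bullet> e i \<bullet> t k = e i \<bullet> (e k \<bullet> t k)"
          using E_commute[OF E[OF k] E[OF i]] i k tS eS by (simp add: prod_assoc)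
        also have "\<dots> = e i \<bullet> t k" using prod_star_prod[OF tS[OF k]] by (simp add: e_def)
        also have "\<dots> = e k \<bullet> t i"
          unfolding e_def using same_grade_compatible[OF t[OF i] t[OF k]] g i k by simp
        finally show "scale (c i) (normal_form (e k \<bullet> t i)) = scale (c i) (normal_form (e k \<bullet> e i \<bullet> t k))"
          by simp
      qed
      also have "\<dots> \<approx> (\<Sum>i\<in>I. scale (c i) (normal_form (e k \<bullet> e i)) \<star> normal_form (t k))"
        using k tS eS by (intro rel_cong_sum rel_cong_sym[OF scaled_normal_form_mult]) auto
      also have "\<dots> = (\<Sum>i\<in>I. scale (c i) (normal_form (e k \<bullet> e i))) \<star> normal_form (t k)"
        by (simp add: free_mult_sum_left)
      also have "\<dots> \<approx> 0 \<star> normal_form (t k)"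
      proof (intro rel_cong_mult_right normal_form_mem tS k)
        have "scale 0 (normal_form (e k)) + (\<Sum>i\<in>I. scale (c i) (normal_form (e k \<bullet> e i))) \<in> left_span {}"
          using I E k vanish by (intro vanishing_left_span) (auto simp: e_def)
        then show "(\<Sum>i\<in>I. scale (c i) (normal_form (e k \<bullet> e i))) \<approx> 0"
          by (intro left_span_empty) (simp only: scale_0 add_0_left)
      qed
      finally show ?thesis by simp
    qed
  qed
qed

text \<open>Injectivity: write an element in normal forms and sort these by their grades.\<close>

lemma rep_kernel:
  assumes x: "x \<in> carrier (free_algebra generators)" and rep: "rep x = 0"
  shows "x \<approx> (0 :: _ \<Rightarrow>\<^sub>0 'r)"
proof -
  let ?c = "Poly_Mapping.lookup x"
  have w: "set w \<subseteq> generators" "w \<noteq> []" if "w \<in> Poly_Mapping.keys x" for w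
    using that x by (auto simp: mem_carrier_free_algebra)
  note S = word_triple_mem[OF w(1)]
  define K where "K = {w \<in> Poly_Mapping.keys x. word_triple w \<noteq> Zero}"
  let ?gr = "\<lambda>w. grade (word_triple w)"
  have "x = (\<Sum>w\<in>Poly_Mapping.keys x. scale (?c w) (monomial w))"
    using poly_mapping_sum_single[of x] by (simp add: scale_single)
  also have "\<dots> \<approx> (\<Sum>w\<in>Poly_Mapping.keys x. scale (?c w) (normal_form (word_triple w)))"
    using w by (intro rel_cong_sum rel_cong_scale word_normal_form)
  also have "\<dots> = (\<Sum>w\<in>K. scale (?c w) (normal_form (word_triple w)))"
    by (rule sum.mono_neutral_right) (auto simp: K_def)
  also have "\<dots> = (\<Sum>g\<in>?gr ` K. \<Sum>w\<in>{w \<in> K. ?gr w = g}. scale (?c w) (normal_form (word_triple w)))"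
    by (rule sum.group[symmetric]) (auto simp: K_def)
  also have "\<dots> \<approx> (\<Sum>g\<in>?gr ` K. 0)"
  proof (intro rel_cong_sum graded_relation)
    fix g \<xi> assume \<xi>: "\<xi> \<in> tight_filters"
    let ?Kg = "{w \<in> K. ?gr w = g}"
    have coeff: "Poly_Mapping.lookup (lscale (?c w) (basis (word_triple w))) g \<xi> =
        (if w \<in> ?Kg \<and> word_triple w \<bullet> star (word_triple w) \<in> \<xi> then ?c w else 0)"
      if "w \<in> Poly_Mapping.keys x" for w
      using that \<xi> by (auto simp: K_def basis_def lookup_single when_def fun_apply_simps indicator_def)
    have sum_apply: "(\<Sum>w\<in>W. f w) \<xi> = (\<Sum>w\<in>W. f w \<xi>)"
      for W and f :: "('l, 'b) generator list \<Rightarrow> ('l, 'b) triple set \<Rightarrow> 'r"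
      by (induction W rule: infinite_finite_induct) (auto simp: fun_apply_simps)
    have "0 = Poly_Mapping.lookup (rep x) g \<xi>"
      by (simp add: rep fun_apply_simps)
    also have "\<dots> = (\<Sum>w\<in>Poly_Mapping.keys x. Poly_Mapping.lookup (lscale (?c w) (basis (word_triple w))) g \<xi>)"
      by (simp only: rep_def lin_ext_def lookup_sum sum_apply)
    also have "\<dots> = (\<Sum>w\<in>Poly_Mapping.keys x.
        if w \<in> ?Kg \<and> word_triple w \<bullet> star (word_triple w) \<in> \<xi> then ?c w else 0)"
      by (intro sum.cong refl coeff)
    also have "\<dots> = (\<Sum>w\<in>?Kg. if word_triple w \<bullet> star (word_triple w) \<in> \<xi> then ?c w else 0)"
      by (rule sum.mono_neutral_cong_right) (auto simp: K_def)
    finally show "(\<Sum>w\<in>?Kg. if word_triple w \<bullet> star (word_triple w) \<in> \<xi> then ?c w else 0) = 0"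
      by simp
  qed (use S in \<open>auto simp: K_def\<close>)
  finally show ?thesis by simp
qed

lemma rep_normal_form: "t \<in> \<S> \<Longrightarrow> rep (normal_form t) = basis t"
proof (cases t)
  case (Triple \<alpha> A \<beta>)
  assume "t \<in> \<S>"
  then have *: "\<alpha> \<in> lists \<L>" "\<beta> \<in> lists \<L>" "A \<in> \<I>_word \<alpha>" "A \<in> \<I>_word \<beta>"
    using Triple by (auto simp: \<S>_def)
  moreover have "A \<noteq> bot" using \<open>t \<in> \<S>\<close> Triple by (simp add: \<S>_def)
  ultimately show ?thesis
    using Triple word_triple_normal_form[of \<alpha> \<beta> A] by (simp add: rep_single) (simp add: triple_def)
qed simp

lemma rep_surj: "carrier skew_group_ring \<subseteq> rep ` (carrier (free_algebra generators) :: (_ \<Rightarrow>\<^sub>0 'r) set)"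
proof
  let ?F = "carrier (free_algebra generators) :: (_ \<Rightarrow>\<^sub>0 'r) set"
  fix f :: "('l \<times> bool) list \<Rightarrow>\<^sub>0 (('l, 'b) triple set \<Rightarrow> 'r)"
  assume "f \<in> carrier skew_group_ring"
  then show "f \<in> rep ` ?F"
  proof (induction rule: skew_group_ring_induct)
    case zero
    show ?case by (intro image_eqI[of _ _ 0]) (auto simp: mem_carrier_free_algebra)
  next
    case (basis c t)
    have "scale c (normal_form t) \<in> ?F"
      using normal_form_mem[OF basis]
        nonunital_algebra.smult_closed[OF nonunital_algebra_free_algebra, of "normal_form t" generators c]
      by (simp add: free_algebra_simps)
    then show ?case
      using basis by (intro image_eqI[of _ _ "scale c (normal_form t)"]) (simp_all add: rep_scale rep_normal_form)
  next
    case (add f h)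
    then obtain x y where "f = rep x" "h = rep y" "x \<in> ?F" "y \<in> ?F" by blast
    then show ?case by (intro image_eqI[of _ _ "x + y"]) (simp_all add: rep_add free_algebra_add_mem)
  qed
qed

theorem bds_algebra_iso:
  "\<exists>\<Psi>\<in>algebra_iso (bds_algebra :: ('r, _) module) skew_group_ring.
    \<forall>x\<in>generators. \<Psi> (generator_class x) = basis (generator_triple x)"
proof -
  interpret algebra_ideal "free_algebra generators :: ('r, _) module" rel_ideal
    by (rule algebra_ideal_relations)
  have "\<exists>\<Psi>\<in>algebra_iso (bds_algebra :: ('r, _) module) skew_group_ring.
    \<forall>x\<in>carrier (free_algebra generators). \<Psi> (coset x) = rep x"
    unfolding bds_algebra_def presented_algebra_def
    using rep_kernel rep_relation_ideal rep_surj
    by (intro quotient_algebra_iso[OF nonunital_algebra_skew_group_ring])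
      (auto simp: free_algebra_simps skew_group_ring_simps rep_mem rep_add rep_mult rep_scale
        skew_mult_eq_skew_ext rel_cong_zero)
  then obtain \<Psi> where \<Psi>: "\<Psi> \<in> algebra_iso (bds_algebra :: ('r, _) module) skew_group_ring"
    "\<And>x. x \<in> carrier (free_algebra generators) \<Longrightarrow> \<Psi> (coset x) = rep x" by blast
  have "\<Psi> (generator_class x) = basis (generator_triple x)" if "x \<in> generators" for x
    using \<Psi>(2)[OF single_mem_free_algebra[of "[x]" generators 1]] that
    by (simp add: generator_class_def rep_single)
  then show ?thesis using \<Psi>(1) by blast
qed

lemma nonunital_algebra_bds_algebra: "nonunital_algebra (bds_algebra :: ('r, _) module)"
  unfolding bds_algebra_def presented_algebra_def
  by (rule algebra_ideal.nonunital_algebra_quotient[OF algebra_ideal_relations])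

lemma basis_generator_triple:
  "basis (generator_triple (Gen_p B)) =
    Poly_Mapping.single \<one>\<^bsub>\<G>\<^esub> (indicator (triple [] B []))"
  "a \<in> \<L> \<Longrightarrow> basis (generator_triple (Gen_s a B)) =
    Poly_Mapping.single (positive_word [a]) (indicator (triple [a] B [a]))"
  "a \<in> \<L> \<Longrightarrow> basis (generator_triple (Gen_s_star a B)) =
    Poly_Mapping.single (inv\<^bsub>\<G>\<^esub> positive_word [a]) (indicator (triple [] B []))"
proof -
  show "basis (generator_triple (Gen_p B)) =
    Poly_Mapping.single \<one>\<^bsub>\<G>\<^esub> (indicator (triple [] B []))"
    by (simp add: basis_E triple_mem_E)
  assume "a \<in> \<L>"
  then have "positive_word [a] \<in> carrier (\<G>)" by (simp add: positive_word_closed)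
  then show "basis (generator_triple (Gen_s a B)) =
      Poly_Mapping.single (positive_word [a]) (indicator (triple [a] B [a]))"
    and "basis (generator_triple (Gen_s_star a B)) =
      Poly_Mapping.single (inv\<^bsub>\<G>\<^esub> positive_word [a]) (indicator (triple [] B []))"
    by (simp_all add: basis_def grade_triple prod_same positive_word_Nil[of \<L>])
qed

end

theorem theorem3p2:
  fixes \<L> :: "'l set"
    and \<theta> :: "'l \<Rightarrow> 'b::generalized_boolean_algebra \<Rightarrow> 'b"
    and \<I> :: "'l \<Rightarrow> 'b set"
  defines "LB \<equiv> (gbds.bds_algebra \<L> \<theta> \<I> :: ('r::{comm_ring, comm_monoid_mult}, _) module)"
    and "LS \<equiv> (gbds.skew_group_ring \<L> \<theta> \<I> :: ('r, _) module)"
  assumes "gbds \<L> \<theta> \<I>"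
  shows "nonunital_algebra LB \<and> nonunital_algebra LS \<and>
    (\<exists>\<Psi> \<in> algebra_iso LB LS.
      (\<forall>B. \<Psi> (gbds.generator_class \<L> \<theta> \<I> (Gen_p B)) =
         Poly_Mapping.single \<one>\<^bsub>free_group \<L>\<^esub> (gbds.indicator \<L> \<theta> \<I> (triple [] B []))) \<and>
      (\<forall>a\<in>\<L>. \<forall>A\<in>\<I> a. \<Psi> (gbds.generator_class \<L> \<theta> \<I> (Gen_s a A)) =
         Poly_Mapping.single (positive_word [a]) (gbds.indicator \<L> \<theta> \<I> (triple [a] A [a]))) \<and>
      (\<forall>a\<in>\<L>. \<forall>A\<in>\<I> a. \<Psi> (gbds.generator_class \<L> \<theta> \<I> (Gen_s_star a A)) =
         Poly_Mapping.single (inv\<^bsub>free_group \<L>\<^esub> positive_word [a])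
           (gbds.indicator \<L> \<theta> \<I> (triple [] A []))))"
proof -
  interpret gbds_coeff \<L> \<theta> \<I> "TYPE('r)"
    using assms(3) by (simp add: gbds_coeff_def)
  obtain \<Psi> where "\<Psi> \<in> algebra_iso LB LS"
    and \<Psi>: "\<And>x. x \<in> generators \<Longrightarrow> \<Psi> (generator_class x) = basis (generator_triple x)"
    using bds_algebra_iso unfolding LB_def LS_def by blast
  then show ?thesis
    using nonunital_algebra_bds_algebra nonunital_algebra_skew_group_ring
    unfolding LB_def LS_def
    by (intro conjI bexI[of _ \<Psi>] allI ballI)
      (simp_all add: generators_intro basis_generator_triple del: generator_triple.simps)
qed

end
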